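(* Let $n\ge 2$ and $\gamma\in(0,\tfrac n2)$. For $k=0,1,2,\dots$ let $\mu_k=-k(k+n-2)$ be the eigenvalues of $\Delta_{\mathbb S^{n-1}}$, and let $P^k_\gamma$ be the projection of the conformal fractional Laplacian $P^{g_0}_\gamma$ on $\mathbb R\times\mathbb S^{n-1}$ over an eigenspace $\langle E_k\rangle$, where $E_k$ is an eigenfunction with eigenvalue $\mu_k$. Then for every $v_k\in C_0^\infty(\mathbb R)$, $$\widehat{P_\gamma^k (v_k)}(\xi)=\Theta^k_\gamma(\xi)\,\widehat{v_k}(\xi),\qquad \xi\in\mathbb R,$$ where $$\Theta^k_{\gamma}(\xi)=2^{2\gamma}\,\frac{\left|\Gamma\left(\tfrac{1}{2}+\tfrac{\gamma}{2}+\tfrac{1}{2}\sqrt{(\tfrac{n}{2}-1)^2-\mu_k}+\tfrac{\xi}{2}i\right)\right|^2}{\left|\Gamma\left(\tfrac{1}{2}-\tfrac{\gamma}{2}+\tfrac{1}{2}\sqrt{(\tfrac{n}{2}-1)^2-\mu_k}+\tfrac{\xi}{2}i\right)\right|^2}.$$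
   Context: The one-dimensional Fourier transform is $\hat v(\xi)=\frac1{\sqrt{2\pi}}\int_{\mathbb R}e^{-i\xi t}v(t)\,dt$. The fractional Laplacian $(-\Delta)^\gamma$ on $\mathbb R^n$ is the Fourier multiplier with symbol $|\xi|^{2\gamma}$. Write points of $\mathbb R^n\setminus\{0\}$ as $x=r\theta$, $r=|x|>0$, $\theta\in\mathbb S^{n-1}$, and set $r=e^{-t}$, $t\in\mathbb R$. Then $|dx|^2=e^{-2t}g_0$ with $g_0=dt^2+g_{\mathbb S^{n-1}}$ on $\mathbb R\times\mathbb S^{n-1}$. The conformal fractional Laplacian $P_\gamma^{g}$ is in general constructed from scattering theory (here, on hyperbolic space $\mathbb H^{n+1}$, whose conformal infinity contains $(\mathbb R\times \mathbb S^{n-1},[g_0])$). It satisfies $P_\gamma^{|dx|^2}=(-\Delta)^\gamma$ and the conformal covariance $P_\gamma^{g_w}(f)=w^{-\frac{n+2\gamma}{n-2\gamma}}P_\gamma^g(fw)$ for $g_w=w^{\frac4{n-2\gamma}}g$, $w>0$. Hence, for $v\in C_0^\infty(\mathbb R\times\mathbb S^{n-1})$, the operator $P_\gamma^{g_0}$ is given explicitly by $$(P_\gamma^{g_0}v)(t,\theta)=r^{\frac{n+2\gamma}{2}}\,\big((-\Delta)^\gamma w\big)(r\theta),\qquad w(r\theta)=r^{-\frac{n-2\gamma}{2}}v(-\ln r,\theta),\qquad r=e^{-t}.$$ Functions on $\mathbb R\times\mathbb S^{n-1}$ are decomposed as $\sum_k v_k(t)E_k(\theta)$ with $\{E_k\}$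 an $L^2(\mathbb S^{n-1})$-orthonormal basis of eigenfunctions of $\Delta_{\mathbb S^{n-1}}$ (with some abuse of notation, indexed by $k$, with eigenvalue $\mu_k=-k(k+n-2)$, repeated according to multiplicity). The projection $P^k_\gamma$ acts on functions $v_k(t)$ by taking the $E_k$-coefficient of $P^{g_0}_\gamma(v_kE_k)$: $(P^k_\gamma v_k)(t)=\int_{\mathbb S^{n-1}}P_\gamma^{g_0}(v_kE_k)(t,\theta)\,\overline{E_k(\theta)}\,d\theta$. *)

theory Defs
  imports "HOL-Analysis.Analysis"
begin

section \<open>Smooth functions and the Laplacians\<close>

text \<open>\<open>Ck_on k U f\<close> is used for open \<open>U\<close>: all iterated partial derivatives of \<open>f\<close> of order
  at most \<open>k\<close> exist and are continuous on \<open>U\<close>, those of order less than \<open>k\<close> being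
  differentiable there.\<close>

fun Ck_on :: "nat \<Rightarrow> 'a::euclidean_space set \<Rightarrow> ('a \<Rightarrow> complex) \<Rightarrow> bool" where
  "Ck_on 0 U f \<longleftrightarrow> continuous_on U f"
| "Ck_on (Suc k) U f \<longleftrightarrow>
     (\<forall>x\<in>U. f differentiable (at x)) \<and>
     (\<forall>i\<in>Basis. Ck_on k U (\<lambda>x. frechet_derivative f (at x) i))"

definition smooth_on :: "'a::euclidean_space set \<Rightarrow> ('a \<Rightarrow> complex) \<Rightarrow> bool" where
  "smooth_on U f \<longleftrightarrow> (\<forall>k. Ck_on k U f)"

definition compactly_supported :: "('a::euclidean_space \<Rightarrow> complex) \<Rightarrow> bool" where
  "compactly_supported f \<longleftrightarrow> compact (closure {x. f x \<noteq> 0})"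

definition laplacian :: "('a::euclidean_space \<Rightarrow> complex) \<Rightarrow> 'a \<Rightarrow> complex" where
  "laplacian f x =
     (\<Sum>i\<in>Basis. frechet_derivative (\<lambda>y. frechet_derivative f (at y) i) (at x) i)"

text \<open>Functions on the unit sphere are functions on the ambient space of which only the values
  on \<open>sphere 0 1\<close> are used. Note that \<open>sgn x = x /\<^sub>R norm x\<close>, so that \<open>\<lambda>x. f (sgn x)\<close>
  is the extension of \<open>f\<close> that is homogeneous of degree 0; the Laplace-Beltrami operator of the
  round sphere is the restriction to the sphere of the Euclidean Laplacian of this extension.\<close>

definition smooth_on_sphere :: "('a::euclidean_space \<Rightarrow> complex) \<Rightarrow> bool" where
  "smooth_on_sphere f \<longleftrightarrow> smooth_on (UNIV - {0}) (\<lambda>x. f (sgn x))"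

definition sphere_laplacian :: "('a::euclidean_space \<Rightarrow> complex) \<Rightarrow> 'a \<Rightarrow> complex" where
  "sphere_laplacian f \<theta> = laplacian (\<lambda>x. f (sgn x)) \<theta>"

text \<open>The surface measure: the area of \<open>A\<close> is \<open>DIM('a)\<close> times the volume of the cone
  \<open>{r \<theta> | 0 < r \<le> 1, \<theta> \<in> A}\<close>.\<close>

definition sphere_measure :: "'a::euclidean_space measure" where
  "sphere_measure =
     scale_measure (of_nat DIM('a))
       (distr (restrict_space lborel (cball 0 1 - {0})) (restrict_space borel (sphere 0 1)) sgn)"

lemma sets_sphere_measure:
  "sets (sphere_measure :: 'a::euclidean_space measure) = sets (restrict_space borel (sphere 0 1))"
  by (simp add: sphere_measure_def)

lemma emeasure_sphere_measure:
  fixes A :: "'a::euclidean_space set"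
  assumes "A \<in> sets borel" "A \<subseteq> sphere 0 1"
  shows "emeasure sphere_measure A =
           of_nat DIM('a) * emeasure lborel {x. 0 < norm x \<and> norm x \<le> 1 \<and> sgn x \<in> A}"
proof -
  have sgn: "sgn \<in> borel_measurable (borel :: 'a measure)"
    unfolding sgn_div_norm by measurable
  have "sgn \<in> restrict_space lborel (cball 0 1 - {0}) \<rightarrow>\<^sub>M restrict_space borel (sphere 0 (1::real) :: 'a set)"
    by (intro measurable_restrict_space3) (auto simp: sgn norm_sgn)
  moreover have "A \<in> sets (restrict_space borel (sphere 0 1))"
    using assms by (auto simp: sets_restrict_space)
  moreover have "sgn -` A \<inter> (cball 0 1 - {0}) = {x. 0 < norm x \<and> norm x \<le> 1 \<and> sgn x \<in> A}"
    by auto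
  moreover have "emeasure (restrict_space lborel (cball 0 1 - {0})) {x. 0 < norm x \<and> norm x \<le> 1 \<and> sgn x \<in> A}
      = emeasure lborel {x :: 'a. 0 < norm x \<and> norm x \<le> 1 \<and> sgn x \<in> A}"
    by (rule emeasure_restrict_space) auto
  ultimately show ?thesis
    by (simp add: sphere_measure_def emeasure_distr space_restrict_space)
qed

definition is_sphere_eigenfunction :: "real \<Rightarrow> ('a::euclidean_space \<Rightarrow> complex) \<Rightarrow> bool" where
  "is_sphere_eigenfunction \<mu> E \<longleftrightarrow>
     smooth_on_sphere E \<and> (\<exists>\<theta>\<in>sphere 0 1. E \<theta> \<noteq> 0) \<and>
     (\<forall>\<theta>\<in>sphere 0 1. sphere_laplacian E \<theta> = of_real \<mu> * E \<theta>)"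

definition sphere_eigenvalue :: "nat \<Rightarrow> nat \<Rightarrow> real" where
  "sphere_eigenvalue n k = - real k * (real k + real n - 2)"


section \<open>Fourier transform and fractional Laplacian\<close>

text \<open>The unitary normalization, with constant \<open>(2\<pi>)\<close> to the power \<open>- DIM('a) / 2\<close>.\<close>

definition fourier :: "('a::euclidean_space \<Rightarrow> complex) \<Rightarrow> 'a \<Rightarrow> complex" where
  "fourier f \<xi> =
     (1 / of_real (sqrt (2 * pi) ^ DIM('a))) * (LINT x|lborel. exp (- \<i> * of_real (\<xi> \<bullet> x)) * f x)"

definition inverse_fourier :: "('a::euclidean_space \<Rightarrow> complex) \<Rightarrow> 'a \<Rightarrow> complex" where
  "inverse_fourier g x =
     (1 / of_real (sqrt (2 * pi) ^ DIM('a))) * (LINT \<xi>|lborel. exp (\<i> * of_real (\<xi> \<bullet> x)) * g \<xi>)"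

lemma fourier_real:
  fixes v :: "real \<Rightarrow> complex"
  shows "fourier v \<xi> = (1 / of_real (sqrt (2 * pi))) * (LINT t|lborel. exp (- \<i> * of_real (\<xi> * t)) * v t)"
  by (simp add: fourier_def)

definition fractional_laplacian ::
    "real \<Rightarrow> ('a::euclidean_space \<Rightarrow> complex) \<Rightarrow> 'a \<Rightarrow> complex" where
  "fractional_laplacian \<gamma> w =
     inverse_fourier (\<lambda>\<xi>. of_real (norm \<xi> powr (2 * \<gamma>)) * fourier w \<xi>)"


section \<open>The conformal fractional Laplacian on the cylinder\<close>

text \<open>A function on \<open>\<real> \<times> S\<^sup>n\<^sup>-\<^sup>1\<close> is a curried function of \<open>t\<close> and \<open>\<theta>\<close>. \<open>cylinder_to_euclidean\<close>
  vanishes at the origin because \<open>0 powr a = 0\<close>; for compactly supported \<open>v\<close> it vanishes in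
  a neighbourhood of the origin.\<close>

definition cylinder_to_euclidean ::
    "real \<Rightarrow> (real \<Rightarrow> 'a::euclidean_space \<Rightarrow> complex) \<Rightarrow> 'a \<Rightarrow> complex" where
  "cylinder_to_euclidean \<gamma> v x =
     of_real (norm x powr (- ((real DIM('a) - 2 * \<gamma>) / 2))) * v (- ln (norm x)) (sgn x)"

definition P_cyl ::
    "real \<Rightarrow> (real \<Rightarrow> 'a::euclidean_space \<Rightarrow> complex) \<Rightarrow> real \<Rightarrow> 'a \<Rightarrow> complex" where
  "P_cyl \<gamma> v t \<theta> =
     (let r = exp (- t) in
        of_real (r powr ((real DIM('a) + 2 * \<gamma>) / 2)) *
        fractional_laplacian \<gamma> (cylinder_to_euclidean \<gamma> v) (r *\<^sub>R \<theta>))"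

text \<open>The \<open>E\<close>-coefficient of the operator applied to \<open>v E\<close>, for an \<open>L\<^sup>2\<close>-normalized \<open>E\<close>.\<close>

definition P_proj ::
    "real \<Rightarrow> ('a::euclidean_space \<Rightarrow> complex) \<Rightarrow> (real \<Rightarrow> complex) \<Rightarrow> real \<Rightarrow> complex" where
  "P_proj \<gamma> E v t =
     (LINT \<theta>|sphere_measure. P_cyl \<gamma> (\<lambda>s \<omega>. v s * E \<omega>) t \<theta> * cnj (E \<theta>))"

definition Theta :: "nat \<Rightarrow> real \<Rightarrow> nat \<Rightarrow> real \<Rightarrow> real" where
  "Theta n \<gamma> k \<xi> =
     (let s = sqrt ((real n / 2 - 1)\<^sup>2 - sphere_eigenvalue n k) in
        2 powr (2 * \<gamma>) *
        (cmod (Gamma (Complex (1/2 + \<gamma>/2 + s/2) (\<xi>/2))))\<^sup>2 /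
        (cmod (Gamma (Complex (1/2 - \<gamma>/2 + s/2) (\<xi>/2))))\<^sup>2)"

end

theory Submission
  imports Defs
begin

text \<open>
  Why the theorem holds. With \<open>r = exp (- t)\<close> the one-dimensional Fourier transform in \<open>t\<close> is a Mellin
  transform in \<open>r\<close>, and in polar coordinates the integral over \<open>t\<close> and over the sphere becomes one integral over
  the whole space. Writing \<open>Y x = cnj (E (x / \<bar>x\<bar>))\<close>, \<open>w\<close> for the function on the Euclidean space that
  corresponds to \<open>v E\<close>, \<open>f\<close> for its fractional Laplacian and \<open>n\<close> for the dimension, the claim reads
  \<open>\<integral> f \<bar>x\<bar>\<^sup>a Y = \<Theta> \<integral> w \<bar>x\<bar>\<^sup>d Y\<close> with \<open>a = \<gamma> - n/2 + \<i>\<xi>\<close> and \<open>d = - n/2 - \<gamma> + \<i>\<xi>\<close>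
  (\<open>mellin_multiplier\<close>).

  The Fourier transform of \<open>\<bar>x\<bar>\<^sup>a Y\<close> is a multiple of \<open>\<bar>\<xi>\<bar>\<close> to the power \<open>- n - a\<close>, times \<open>Y\<close>, and
  the multiple is elementary up to a quotient of two Gamma values (\<open>hecke_riesz\<close>). Applied once to \<open>f\<close> this moves the integral to the
  Fourier side, where \<open>f\<close> is \<open>\<bar>\<xi>\<bar>\<close> to the power \<open>2\<gamma>\<close> times the transform of \<open>w\<close>; the power of \<open>\<bar>\<xi>\<bar>\<close>
  is absorbed in the homogeneous factor, and a second application moves the integral back to \<open>w\<close>. The four Gamma values
  form two pairs of complex conjugates, which gives the squared absolute values in \<open>\<Theta>\<close>.

  The formula for the transform of \<open>\<bar>x\<bar>\<^sup>a Y\<close> follows from \<open>\<bar>x\<bar>\<^sup>a = \<bar>x\<bar>\<^sup>k \<bar>x\<bar>\<^sup>a\<^sup>-\<^sup>k\<close>: the second factor is a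
  superposition of Gaussians by the Gamma integral, and a Gaussian times the solid harmonic \<open>\<bar>x\<bar>\<^sup>k Y\<close> is
  reproduced by the Fourier transform (\<open>bochner_hecke\<close>). The latter is proved here without polynomials or singularities:
  the moments \<open>\<integral> (\<theta> \<bullet> \<omega>)\<^sup>j Y \<theta> d\<theta>\<close> satisfy a two-term recursion by Green's identity (\<open>moment_rec\<close>), so the
  exponential series of the integral of \<open>exp (t (x \<bullet> \<omega>))\<close> against \<open>\<bar>x\<bar>\<^sup>k Y\<close> times a Gaussian can be summed
  explicitly for every complex \<open>t\<close>, up to a constant that may depend on \<open>\<omega>\<close>. The constant is found from
  real \<open>t \<rightarrow> \<infinity>\<close>, where the Gaussian is an approximate identity.

  The integrals over \<open>f\<close> converge absolutely at infinity only because \<open>f\<close> decays like \<open>\<bar>x\<bar>\<close> to the power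
  \<open>- n - 2\<gamma>\<close> (\<open>fractional_laplacian_decay\<close>). This decay comes again from \<open>hecke_riesz\<close>, with the constant
  harmonic: away from the support of \<open>w\<close>, the fractional Laplacian is, up to a constant factor, the integral of \<open>w y\<close> times that power of
  \<open>\<bar>x - y\<bar>\<close>.
\<close>

abbreviation partial :: "'a::euclidean_space \<Rightarrow> ('a \<Rightarrow> complex) \<Rightarrow> 'a \<Rightarrow> complex" where
  "partial i f \<equiv> \<lambda>x. frechet_derivative f (at x) i"

text \<open>The complex power \<open>\<bar>x\<bar>\<^sup>a\<close>. Its value at the origin is the artificial \<open>1\<close>, because
  \<open>ln 0 = 0\<close>; hence the many statements that hold only almost everywhere.\<close>

abbreviation npow :: "complex \<Rightarrow> 'a::real_normed_vector \<Rightarrow> complex" where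
  "npow a x \<equiv> exp (a * of_real (ln (norm x)))"

abbreviation gauss :: "real \<Rightarrow> 'a::real_normed_vector \<Rightarrow> complex" where
  "gauss s x \<equiv> of_real (exp (- s * (norm x)\<^sup>2))"

text \<open>The factor \<open>c\<close> is \<open>- \<i>\<close> for the Fourier transform and \<open>\<i>\<close> for its inverse, both without their
  normalization.\<close>

abbreviation exp_transform :: "complex \<Rightarrow> ('a::euclidean_space \<Rightarrow> complex) \<Rightarrow> 'a \<Rightarrow> complex" where
  "exp_transform c G x \<equiv> LINT \<xi>|lborel. exp (c * of_real (\<xi> \<bullet> x)) * G \<xi>"

section \<open>Calculus of the classes of continuously differentiable functions\<close>

lemma frechet_derivative_cong_open:
  assumes "open U" "x \<in> U" "\<And>y. y \<in> U \<Longrightarrow> f y = g y"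
  shows "frechet_derivative f (at x) = frechet_derivative g (at x)"
proof -
  have "(f has_derivative D) (at x) \<longleftrightarrow> (g has_derivative D) (at x)" for D
    using assms by (auto intro: has_derivative_transform_within_open[of f D x UNIV U g]
       has_derivative_transform_within_open[of g D x UNIV U f])
  then show ?thesis by (simp add: frechet_derivative_def)
qed

lemma differentiable_cong_open:
  assumes "open U" "x \<in> U" "\<And>y. y \<in> U \<Longrightarrow> f y = g y"
  shows "f differentiable (at x) \<longleftrightarrow> g differentiable (at x)"
proof -
  have "(f has_derivative D) (at x) \<longleftrightarrow> (g has_derivative D) (at x)" for D
    using assms by (auto intro: has_derivative_transform_within_open[of f D x UNIV U g]
       has_derivative_transform_within_open[of g D x UNIV U f])
  then show ?thesis by (simp add: differentiable_def)
qed

text \<open>The iterated derivatives at a point of the open set \<open>U\<close> depend only on the values in \<open>U\<close>.\<close>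

lemma Ck_on_cong:
  assumes "open U" "\<And>y. y \<in> U \<Longrightarrow> f y = g y" "Ck_on k U f"
  shows "Ck_on k U g"
  using assms
proof (induction k arbitrary: f g)
  case 0
  then show ?case using continuous_on_cong[of U U f g] by simp
next
  case (Suc k)
  have "Ck_on k U (partial i g)" if "i \<in> Basis" for i
  proof (rule Suc.IH[OF \<open>open U\<close>])
    show "Ck_on k U (partial i f)" using Suc.prems that by simp
    show "partial i f y = partial i g y" if "y \<in> U" for y
      using frechet_derivative_cong_open[OF \<open>open U\<close> that Suc.prems(2)] by simp
  qed
  moreover have "\<forall>x\<in>U. g differentiable (at x)"
    using Suc.prems differentiable_cong_open[OF \<open>open U\<close> _ Suc.prems(2)] by auto
  ultimately show ?case by simp
qed

lemma Ck_on_subset: "Ck_on k U f \<Longrightarrow> V \<subseteq> U \<Longrightarrow> Ck_on k V f"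
  by (induction k arbitrary: f) (auto intro: continuous_on_subset)

lemma Ck_on_Un: "open U \<Longrightarrow> open V \<Longrightarrow> Ck_on k U f \<Longrightarrow> Ck_on k V f \<Longrightarrow> Ck_on k (U \<union> V) f"
  by (induction k arbitrary: f) (auto intro: continuous_on_open_Un)

lemma Ck_on_imp_continuous_on: "Ck_on k U f \<Longrightarrow> continuous_on U f"
  by (cases k) (auto intro!: continuous_at_imp_continuous_on differentiable_imp_continuous_within)

lemma Ck_on_SucD: "Ck_on (Suc k) U f \<Longrightarrow> Ck_on k U f"
proof (induction k arbitrary: f)
  case 0
  then show ?case using Ck_on_imp_continuous_on by (metis Ck_on.simps(1))
next
  case (Suc k)
  then show ?case by (metis Ck_on.simps(2))
qed

lemma Ck_on_mono: "Ck_on m U f \<Longrightarrow> k \<le> m \<Longrightarrow> Ck_on k U f"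
  by (induction m arbitrary: k) (auto simp: le_Suc_eq dest: Ck_on_SucD simp del: Ck_on.simps)

lemma has_derivative_frechet: "f differentiable (at x) \<Longrightarrow> (f has_derivative frechet_derivative f (at x)) (at x)"
  by (simp add: frechet_derivative_works)

lemma partial_eqI: "(f has_derivative D) (at x) \<Longrightarrow> frechet_derivative f (at x) i = D i"
  using frechet_derivative_at by metis

text \<open>This is the rule by which all closure properties are proved: it replaces the chosen Frechet derivative by any explicit one.\<close>

lemma Ck_on_SucI:
  assumes "open U" "\<And>x. x \<in> U \<Longrightarrow> (f has_derivative D x) (at x)"
    "\<And>i. i \<in> Basis \<Longrightarrow> Ck_on k U (\<lambda>x. D x i)"
  shows "Ck_on (Suc k) U f"
  using assms by (auto simp: differentiable_def intro: Ck_on_cong[OF assms(1) _ assms(3)] simp: partial_eqI[OF assms(2)])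

lemma Ck_on_const: "Ck_on k U (\<lambda>x. c)"
  by (induction k arbitrary: c) (auto simp: frechet_derivative_const)

lemma Ck_on_linear:
  assumes "open U" "bounded_linear f"
  shows "Ck_on k U f"
proof -
  have "Ck_on (Suc k) U f"
    by (rule Ck_on_SucI[OF \<open>open U\<close>, where D="\<lambda>x. f"])
      (auto intro: bounded_linear_imp_has_derivative assms(2) Ck_on_const)
  then show ?thesis by (rule Ck_on_SucD)
qed

lemma Ck_on_add:
  assumes "open U"
  shows "Ck_on k U f \<Longrightarrow> Ck_on k U g \<Longrightarrow> Ck_on k U (\<lambda>x. f x + g x)"
proof (induction k arbitrary: f g)
  case (Suc k)
  show ?case
  proof (rule Ck_on_SucI[OF assms])
    show "((\<lambda>x. f x + g x) has_derivative (\<lambda>h. frechet_derivative f (at x) h + frechet_derivative g (at x) h)) (at x)" if "x \<in> U" for x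
      using Suc.prems that by (intro has_derivative_add has_derivative_frechet) auto
  qed (use Suc in auto)
qed (auto intro: continuous_on_add)

lemma Ck_on_mult:
  assumes "open U"
  shows "Ck_on k U f \<Longrightarrow> Ck_on k U g \<Longrightarrow> Ck_on k U (\<lambda>x. f x * g x)"
proof (induction k arbitrary: f g)
  case (Suc k)
  show ?case
  proof (rule Ck_on_SucI[OF assms])
    show "((\<lambda>x. f x * g x) has_derivative (\<lambda>h. f x * frechet_derivative g (at x) h + frechet_derivative f (at x) h * g x)) (at x)" if "x \<in> U" for x
      using Suc.prems that by (intro has_derivative_mult has_derivative_frechet) auto
    show "Ck_on k U (\<lambda>x. f x * frechet_derivative g (at x) i + frechet_derivative f (at x) i * g x)" if "i \<in> Basis" for i
      using Suc.prems that by (intro Ck_on_add assms Suc.IH Ck_on_SucD[of k U f] Ck_on_SucD[of k U g]) auto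
  qed
qed (auto intro: continuous_on_mult)

lemma Ck_on_cmult: "open U \<Longrightarrow> Ck_on k U f \<Longrightarrow> Ck_on k U (\<lambda>x. c * f x)"
  by (intro Ck_on_mult Ck_on_const)

lemma Ck_on_minus: "open U \<Longrightarrow> Ck_on k U f \<Longrightarrow> Ck_on k U (\<lambda>x. - f x)"
  using Ck_on_cmult[of U k f "-1"] by simp

lemma Ck_on_diff: "open U \<Longrightarrow> Ck_on k U f \<Longrightarrow> Ck_on k U g \<Longrightarrow> Ck_on k U (\<lambda>x. f x - g x)"
  using Ck_on_add[of U k f "\<lambda>x. - g x"] Ck_on_minus[of U k g] by simp

lemma Ck_on_sum: "open U \<Longrightarrow> (\<And>i. i \<in> S \<Longrightarrow> Ck_on k U (f i)) \<Longrightarrow> Ck_on k U (\<lambda>x. \<Sum>i\<in>S. f i x)"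
  by (induction S rule: infinite_finite_induct) (auto intro: Ck_on_const Ck_on_add)

lemma Ck_on_cnj:
  assumes "open U"
  shows "Ck_on k U f \<Longrightarrow> Ck_on k U (\<lambda>x. cnj (f x))"
proof (induction k arbitrary: f)
  case (Suc k)
  show ?case
  proof (rule Ck_on_SucI[OF assms])
    show "((\<lambda>x. cnj (f x)) has_derivative (\<lambda>h. cnj (frechet_derivative f (at x) h))) (at x)" if "x \<in> U" for x
      using Suc.prems that by (intro bounded_linear.has_derivative[OF bounded_linear_cnj] has_derivative_frechet) auto
  qed (use Suc in auto)
qed (auto intro: continuous_on_cnj)

lemma real_Ck_SucD:
  fixes g :: "real \<Rightarrow> complex"
  assumes "Ck_on (Suc k) UNIV g"
  shows "(g has_vector_derivative partial 1 g s) (at s)" "Ck_on k UNIV (partial 1 g)"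
proof -
  have D: "(g has_derivative frechet_derivative g (at s)) (at s)"
    using assms by (intro has_derivative_frechet) auto
  have "frechet_derivative g (at s) h = h *\<^sub>R partial 1 g s" for h
    using linear_scale[OF has_derivative_linear[OF D], of h 1] by (metis real_scaleR_def mult.right_neutral)
  then have "frechet_derivative g (at s) = (\<lambda>h. h *\<^sub>R partial 1 g s)"
    by (rule ext)
  with D show "(g has_vector_derivative partial 1 g s) (at s)"
    unfolding has_vector_derivative_def by metis
qed (use assms in auto)

lemma real_Ck_SucI:
  fixes g :: "real \<Rightarrow> complex"
  assumes "\<And>s. (g has_vector_derivative g' s) (at s)" "Ck_on k UNIV g'"
  shows "Ck_on (Suc k) UNIV g"
  by (rule Ck_on_SucI[where D="\<lambda>s h. h *\<^sub>R g' s"]) (use assms in \<open>auto simp: has_vector_derivative_def\<close>)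

lemma has_derivative_compose_real:
  fixes g :: "real \<Rightarrow> complex" and q :: "'a::euclidean_space \<Rightarrow> real"
  assumes "(g has_vector_derivative g') (at (q x))" "(q has_derivative q') (at x)"
  shows "((\<lambda>x. g (q x)) has_derivative (\<lambda>h. of_real (q' h) * g')) (at x)"
  using has_derivative_compose[OF assms(2) assms(1)[unfolded has_vector_derivative_def]]
  by (simp add: scaleR_conv_of_real)

text \<open>Only the gradient of \<open>q\<close> enters, in one class lower; this is what makes the induction in \<open>Ck_on_ln_norm\<close> work.\<close>

lemma Ck_on_compose_real:
  fixes g :: "real \<Rightarrow> complex" and q :: "'a::euclidean_space \<Rightarrow> real"
  assumes "open U" "\<And>x. x \<in> U \<Longrightarrow> (q has_derivative q' x) (at x)"
  shows "Ck_on k UNIV g \<Longrightarrow> (\<And>i. i \<in> Basis \<Longrightarrow> Ck_on (k-1) U (\<lambda>x. of_real (q' x i))) \<Longrightarrow> Ck_on k U (\<lambda>x. g (q x))"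
proof (induction k arbitrary: g)
  case 0
  have "continuous_on U q"
    using assms by (auto intro!: continuous_at_imp_continuous_on has_derivative_continuous)
  then show ?case using 0 by (auto intro: continuous_on_compose2[of UNIV g])
next
  case (Suc k)
  show ?case
  proof (rule Ck_on_SucI[OF assms(1)])
    show "((\<lambda>x. g (q x)) has_derivative (\<lambda>h. of_real (q' x h) * partial 1 g (q x))) (at x)" if "x \<in> U" for x
      using Suc.prems that assms(2) by (intro has_derivative_compose_real real_Ck_SucD)
    show "Ck_on k U (\<lambda>x. of_real (q' x i) * partial 1 g (q x))" if "i \<in> Basis" for i
      using Suc.prems(2)[OF that] by (intro Ck_on_mult Suc.IH assms(1) real_Ck_SucD Suc.prems Ck_on_mono[OF Suc.prems(2)]) (auto simp: that)
  qed
qed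

lemma has_derivative_ln_norm:
  fixes x :: "'a::euclidean_space"
  assumes "x \<noteq> 0"
  shows "((\<lambda>x. ln (norm x)) has_derivative (\<lambda>h. (x \<bullet> h) / (norm x)\<^sup>2)) (at x)"
  by (rule derivative_eq_intros refl has_derivative_norm | use assms in \<open>simp add: sgn_div_norm field_simps power2_eq_square inner_commute\<close>)+

lemma Ck_on_exp: "Ck_on k UNIV (\<lambda>s::real. exp (c * of_real s))"
proof (induction k)
  case 0
  show ?case by (auto intro!: continuous_intros)
next
  case (Suc k)
  show ?case
  proof (rule real_Ck_SucI)
    show "((\<lambda>s. exp (c * of_real s)) has_vector_derivative c * exp (c * of_real s)) (at s)" for s
      by (rule has_vector_derivative_real_field) (auto intro!: derivative_eq_intros)
  qed (use Suc in \<open>auto intro: Ck_on_cmult\<close>)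
qed

text \<open>Expresses \<open>1 / \<bar>x\<bar>\<^sup>2\<close>, the radial factor of the gradient of \<open>ln \<bar>x\<bar>\<close>, as a function of \<open>ln \<bar>x\<bar>\<close>.\<close>

lemma npow_minus_2:
  fixes x :: "'a::euclidean_space"
  assumes "x \<noteq> 0"
  shows "npow (- 2) x = (1 / of_real ((norm x)\<^sup>2) :: complex)"
proof -
  have "exp (- 2 * ln (norm x)) = 1 / (norm x)^2"
    using assms by (simp add: exp_minus exp_double field_simps)
  then show ?thesis
    by (metis (no_types, opaque_lifting) exp_of_real of_real_1 of_real_divide of_real_minus of_real_mult of_real_numeral)
qed

lemma Ck_on_ln_norm_gradient:
  fixes i :: "'a::euclidean_space"
  assumes "Ck_on k (UNIV - {0::'a}) (\<lambda>x. npow (- 2) x)"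
  shows "Ck_on k (UNIV - {0}) (\<lambda>x. of_real ((x \<bullet> i) / (norm x)\<^sup>2))"
proof (rule Ck_on_cong)
  show "Ck_on k (UNIV - {0}) (\<lambda>x. of_real (x \<bullet> i) * npow (- 2) x)"
    by (intro Ck_on_mult assms Ck_on_linear open_delete bounded_linear_intros open_UNIV)
      (auto intro: bounded_linear_compose[OF bounded_linear_of_real bounded_linear_inner_left])
  show "of_real (y \<bullet> i) * exp (- 2 * of_real (ln (norm y))) = (of_real ((y \<bullet> i) / (norm y)\<^sup>2)::complex)"
    if "y \<in> UNIV - {0}" for y :: 'a
    using that by (subst npow_minus_2) auto
qed auto

text \<open>All radial functions are treated as functions of \<open>ln \<bar>x\<bar>\<close>. The induction closes because the gradient
  \<open>x / \<bar>x\<bar>\<^sup>2\<close> of \<open>ln \<bar>x\<bar>\<close> is the linear function \<open>x\<close> times such a radial function.\<close>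

lemma Ck_on_ln_norm:
  fixes g :: "real \<Rightarrow> complex"
  shows "Ck_on k UNIV g \<Longrightarrow> Ck_on k (UNIV - {0}) (\<lambda>x::'a::euclidean_space. g (ln (norm x)))"
proof (induction k arbitrary: g)
  case 0
  have "continuous_on (UNIV - {0}) (\<lambda>x::'a. ln (norm x))"
    by (auto intro!: continuous_intros)
  then show ?case using 0 by (auto intro: continuous_on_compose2[of UNIV g])
next
  case (Suc k)
  show ?case
  proof (rule Ck_on_compose_real[where q'="\<lambda>x h. (x \<bullet> h) / (norm x)\<^sup>2"])
    show "Ck_on (Suc k - 1) (UNIV - {0}) (\<lambda>x::'a. of_real (x \<bullet> i / (norm x)\<^sup>2))" if "i \<in> Basis" for i
      unfolding diff_Suc_1 by (rule Ck_on_ln_norm_gradient[OF Suc.IH[OF Ck_on_exp[of k "-2"]]])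
  qed (use Suc.prems in \<open>auto simp: has_derivative_ln_norm intro: open_delete\<close>)
qed

lemma Ck_on_inner:
  fixes g :: "real \<Rightarrow> complex"
  assumes "Ck_on k UNIV g"
  shows "Ck_on k UNIV (\<lambda>x::'a::euclidean_space. g (\<omega> \<bullet> x))"
  by (rule Ck_on_compose_real[where q'="\<lambda>x h. \<omega> \<bullet> h", OF _ _ assms])
    (auto intro: derivative_eq_intros Ck_on_const)

section \<open>Laplacians of plane and of radial functions\<close>

lemma laplacian_eqI:
  assumes "open U" "x \<in> U" "\<And>y. y \<in> U \<Longrightarrow> (f has_derivative D y) (at y)"
    "\<And>i. i \<in> Basis \<Longrightarrow> ((\<lambda>y. D y i) has_derivative D2 i) (at x)"
  shows "laplacian f x = (\<Sum>i\<in>Basis. D2 i i)"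
  unfolding laplacian_def
proof (rule sum.cong[OF refl])
  fix i :: 'a assume i: "i \<in> Basis"
  have "frechet_derivative (partial i f) (at x) = frechet_derivative (\<lambda>y. D y i) (at x)"
    by (rule frechet_derivative_cong_open[OF assms(1,2)]) (use assms(3) in \<open>auto intro: partial_eqI\<close>)
  then show "frechet_derivative (partial i f) (at x) i = D2 i i"
    using partial_eqI[OF assms(4)[OF i]] by simp
qed

lemma laplacian_cong_open:
  assumes "open U" "x \<in> U" "\<And>y. y \<in> U \<Longrightarrow> f y = g y"
  shows "laplacian f x = laplacian g x"
proof -
  have "frechet_derivative (partial i f) (at x) = frechet_derivative (partial i g) (at x)" for i
    by (rule frechet_derivative_cong_open[OF assms(1,2)])
      (simp add: frechet_derivative_cong_open[OF assms(1) _ assms(3)])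
  then show ?thesis by (simp add: laplacian_def)
qed

lemma Ck_on_2_D:
  assumes "Ck_on 2 U f"
  shows "x \<in> U \<Longrightarrow> (f has_derivative frechet_derivative f (at x)) (at x)"
    and "x \<in> U \<Longrightarrow> i \<in> Basis \<Longrightarrow> (partial i f has_derivative frechet_derivative (partial i f) (at x)) (at x)"
    and "i \<in> Basis \<Longrightarrow> Ck_on 1 U (partial i f)"
  using assms by (auto simp: numeral_2_eq_2 intro: has_derivative_frechet)

lemma Ck_on_laplacian: "open U \<Longrightarrow> Ck_on (Suc (Suc k)) U f \<Longrightarrow> Ck_on k U (laplacian f)"
  unfolding laplacian_def[abs_def] by (intro Ck_on_sum) auto

lemma laplacian_plane:
  fixes g :: "real \<Rightarrow> complex" and \<omega> :: "'a::euclidean_space"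
  assumes "\<And>s. (g has_vector_derivative g' s) (at s)" "\<And>s. (g' has_vector_derivative g'' s) (at s)"
  shows "laplacian (\<lambda>x. g (\<omega> \<bullet> x)) x = of_real ((norm \<omega>)\<^sup>2) * g'' (\<omega> \<bullet> x)"
proof -
  have q: "((\<lambda>x. \<omega> \<bullet> x) has_derivative (\<lambda>h. \<omega> \<bullet> h)) (at y)" for y
    by (auto intro!: derivative_eq_intros)
  have "laplacian (\<lambda>x. g (\<omega> \<bullet> x)) x = (\<Sum>i\<in>Basis. of_real (\<omega> \<bullet> i) * (of_real (\<omega> \<bullet> i) * g'' (\<omega> \<bullet> x)))"
    by (rule laplacian_eqI[of UNIV _ _ "\<lambda>y h. of_real (\<omega> \<bullet> h) * g' (\<omega> \<bullet> y)"])
      (auto intro!: has_derivative_compose_real q assms has_derivative_mult_right)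
  also have "\<dots> = of_real (\<Sum>i\<in>Basis. (\<omega> \<bullet> i) * (\<omega> \<bullet> i)) * g'' (\<omega> \<bullet> x)"
    by (simp add: sum_distrib_right mult.assoc)
  finally show ?thesis
    by (simp add: power2_norm_eq_inner euclidean_inner[of \<omega> \<omega>])
qed

text \<open>A function that is homogeneous of degree 0 is constant on the rays, so its derivative in the direction \<open>x\<close> vanishes at \<open>x\<close>.\<close>

lemma homogeneous_0_euler:
  fixes Y :: "'a::euclidean_space \<Rightarrow> complex"
  assumes "\<And>c x. c > 0 \<Longrightarrow> Y (c *\<^sub>R x) = Y x" "(Y has_derivative D) (at x)"
  shows "D x = 0"
proof -
  have "((\<lambda>t::real. (1 + t) *\<^sub>R x) has_derivative (\<lambda>t. t *\<^sub>R x)) (at 0)"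
    by (auto intro!: derivative_eq_intros)
  then have "((\<lambda>t::real. Y ((1 + t) *\<^sub>R x)) has_derivative (\<lambda>t. D (t *\<^sub>R x))) (at 0)"
    by (rule has_derivative_compose) (use assms(2) in simp)
  then have "((\<lambda>t::real. Y x) has_derivative (\<lambda>t. D (t *\<^sub>R x))) (at 0)"
    by (rule has_derivative_transform_within_open[of _ _ _ _ "{-1<..}"]) (use assms(1) in auto)
  then have "(\<lambda>t. D (t *\<^sub>R x)) = (\<lambda>t. 0)"
    using has_derivative_unique[OF _ has_derivative_const] by blast
  from fun_cong[OF this, of 1] show ?thesis by simp
qed

text \<open>Separation of variables in the coordinate \<open>ln \<bar>x\<bar>\<close>: the mixed terms vanish by Euler's relation. For constant \<open>Y\<close> and
  exponential \<open>\<Phi>\<close> this is the Laplacian of a power of \<open>\<bar>x\<bar>\<close>.\<close>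

lemma laplacian_radial:
  fixes Y :: "'a::euclidean_space \<Rightarrow> complex" and \<Phi> :: "real \<Rightarrow> complex"
  assumes hom: "\<And>c x. c > 0 \<Longrightarrow> Y (c *\<^sub>R x) = Y x" and Y: "Ck_on 2 (UNIV - {0}) Y"
    and \<Phi>: "\<And>s. (\<Phi> has_vector_derivative \<Phi>' s) (at s)" "\<And>s. (\<Phi>' has_vector_derivative \<Phi>'' s) (at s)"
    and x: "x \<noteq> 0"
  shows "laplacian (\<lambda>x. \<Phi> (ln (norm x)) * Y x) x =
    (\<Phi>'' (ln (norm x)) + (of_nat DIM('a) - 2) * \<Phi>' (ln (norm x))) / of_real ((norm x)\<^sup>2) * Y x
      + \<Phi> (ln (norm x)) * laplacian Y x"
proof -
  define q where "q = (\<lambda>x::'a. ln (norm x))"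
  define DY where "DY = (\<lambda>x. frechet_derivative Y (at x))"
  define D where "D = (\<lambda>y h::'a. \<Phi> (q y) * DY y h + of_real ((y \<bullet> h) / (norm y)\<^sup>2) * \<Phi>' (q y) * Y y)"
  define D2 where "D2 = (\<lambda>i h. (\<Phi> (q x) * frechet_derivative (partial i Y) (at x) h
       + of_real ((x \<bullet> h) / (norm x)\<^sup>2) * \<Phi>' (q x) * DY x i)
     + (of_real ((x \<bullet> i) / (norm x)\<^sup>2) * \<Phi>' (q x) * DY x h
        + (of_real ((x \<bullet> i) / (norm x)\<^sup>2) * (of_real ((x \<bullet> h) / (norm x)\<^sup>2) * \<Phi>'' (q x))
           + of_real ((h \<bullet> i) / (norm x)\<^sup>2 - 2 * (x \<bullet> i) * (x \<bullet> h) / (norm x)^4) * \<Phi>' (q x)) * Y x))"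
  have q: "(q has_derivative (\<lambda>h. (y \<bullet> h) / (norm y)\<^sup>2)) (at y)" if "y \<noteq> 0" for y
    unfolding q_def using that by (rule has_derivative_ln_norm)
  note q1 = has_derivative_compose_real[OF \<Phi>(1) q] and q2 = has_derivative_compose_real[OF \<Phi>(2) q]
  have c: "((\<lambda>y. of_real ((y \<bullet> i) / (norm y)\<^sup>2) :: complex) has_derivative
      (\<lambda>h. of_real ((h \<bullet> i) / (norm x)\<^sup>2 - 2 * (x \<bullet> i) * (x \<bullet> h) / (norm x)^4))) (at x)" for i
  proof -
    have n4: "norm x ^ 4 = (x \<bullet> x)\<^sup>2"
      by (simp add: power2_norm_eq_inner[symmetric])
    show ?thesis
      unfolding n4 power2_norm_eq_inner
      by (intro bounded_linear.has_derivative[OF bounded_linear_of_real])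
        (auto intro!: derivative_eq_intros simp: x inner_commute field_simps power2_eq_square)
  qed
  have 1: "((\<lambda>x. \<Phi> (q x) * Y x) has_derivative D y) (at y)" if "y \<in> UNIV - {0}" for y
    unfolding D_def DY_def using that
    by (intro has_derivative_mult q1 Ck_on_2_D[OF Y]) auto
  have 2: "((\<lambda>y. D y i) has_derivative D2 i) (at x)" if "i \<in> Basis" for i
    unfolding D_def D2_def DY_def
    by (rule has_derivative_add has_derivative_mult q1 q2 c Ck_on_2_D[OF Y] | use x that in simp)+
  have n0: "norm x \<noteq> 0" using x by simp
  have sum_sq: "(\<Sum>i\<in>Basis. (of_real (x \<bullet> i))\<^sup>2) = (of_real ((norm x)\<^sup>2) :: complex)"
    unfolding power2_norm_eq_inner euclidean_inner[of x x] by (simp add: power2_eq_square)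
  have "(\<Sum>i\<in>Basis. of_real (x \<bullet> i) * DY x i) = DY x (\<Sum>i\<in>Basis. (x \<bullet> i) *\<^sub>R i)"
    using Ck_on_2_D(1)[OF Y, of x] x
    by (simp add: DY_def linear_sum[OF has_derivative_linear] linear_scale[OF has_derivative_linear] scaleR_conv_of_real)
  also have "\<dots> = 0"
    using homogeneous_0_euler[OF hom, of "DY x" x] Ck_on_2_D(1)[OF Y, of x] x by (simp add: euclidean_representation DY_def)
  finally have eu: "(\<Sum>i\<in>Basis. of_real (x \<bullet> i) * DY x i) = 0" .
  have "laplacian (\<lambda>x. \<Phi> (q x) * Y x) x = (\<Sum>i\<in>Basis. D2 i i)"
    by (rule laplacian_eqI[OF _ _ 1 2, of "UNIV - {0}"]) (use x in auto)
  also have "\<dots> = (\<Sum>i\<in>Basis. \<Phi> (q x) * frechet_derivative (partial i Y) (at x) i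
       + (2 * \<Phi>' (q x) / of_real ((norm x)\<^sup>2)) * (of_real (x \<bullet> i) * DY x i)
       + (\<Phi>'' (q x) - 2 * \<Phi>' (q x)) * Y x / (of_real ((norm x)\<^sup>2))\<^sup>2 * (of_real (x \<bullet> i))\<^sup>2
       + \<Phi>' (q x) * Y x / of_real ((norm x)\<^sup>2))"
    by (rule sum.cong[OF refl]) (use n0 in \<open>simp add: D2_def field_simps power_numeral_reduce\<close>)
  also have "\<dots> = \<Phi> (q x) * laplacian Y x
       + (\<Phi>'' (q x) - 2 * \<Phi>' (q x)) * Y x / (of_real ((norm x)\<^sup>2))\<^sup>2 * of_real ((norm x)\<^sup>2)
       + of_nat DIM('a) * (\<Phi>' (q x) * Y x / of_real ((norm x)\<^sup>2))"
    by (simp only: sum.distrib sum_distrib_left[symmetric] sum_sq eu laplacian_def sum_constant) simp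
  also have "\<dots> = (\<Phi>'' (q x) + (of_nat DIM('a) - 2) * \<Phi>' (q x)) / of_real ((norm x)\<^sup>2) * Y x + \<Phi> (q x) * laplacian Y x"
    using n0 by (simp add: field_simps power2_eq_square)
  finally show ?thesis by (simp add: q_def)
qed

lemma laplacian_homogeneous_0:
  fixes Y :: "'a::euclidean_space \<Rightarrow> complex"
  assumes hom: "\<And>c x. c > 0 \<Longrightarrow> Y (c *\<^sub>R x) = Y x" and Y: "Ck_on 2 (UNIV - {0}) Y" and x: "x \<noteq> 0" and c: "c > 0"
  shows "laplacian Y (c *\<^sub>R x) = laplacian Y x / of_real (c\<^sup>2)"
proof -
  have scale: "((\<lambda>y::'a. (1/c) *\<^sub>R y) has_derivative (\<lambda>h. (1/c) *\<^sub>R h)) (at y)" for y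
    by (auto intro!: derivative_eq_intros)
  have "(Y has_derivative (\<lambda>h. frechet_derivative Y (at ((1/c) *\<^sub>R y)) ((1/c) *\<^sub>R h))) (at y)" if "y \<noteq> 0" for y
  proof -
    have "((\<lambda>y. Y ((1/c) *\<^sub>R y)) has_derivative (\<lambda>h. frechet_derivative Y (at ((1/c) *\<^sub>R y)) ((1/c) *\<^sub>R h))) (at y)"
      by (rule has_derivative_compose[OF scale Ck_on_2_D(1)[OF Y]]) (use that c in auto)
    then show ?thesis using hom[of "1/c"] c by simp
  qed
  moreover have "frechet_derivative Y (at y) (r *\<^sub>R h) = of_real r * frechet_derivative Y (at y) h" if "y \<noteq> 0" for y h r
    using linear_scale[OF has_derivative_linear[OF Ck_on_2_D(1)[OF Y]], of y r h] that by (simp add: scaleR_conv_of_real)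
  ultimately have 1: "(Y has_derivative (\<lambda>h. of_real (1/c) * frechet_derivative Y (at ((1/c) *\<^sub>R y)) h)) (at y)" if "y \<in> UNIV - {0}" for y
    using that c by simp
  have D2: "((\<lambda>y. frechet_derivative Y (at ((1/c) *\<^sub>R y)) i) has_derivative (\<lambda>h. frechet_derivative (partial i Y) (at x) ((1/c) *\<^sub>R h))) (at (c *\<^sub>R x))"
    if "i \<in> Basis" for i
    by (rule has_derivative_compose[OF scale, of "partial i Y"])
       (use Ck_on_2_D(2)[OF Y, of x i] that c x in auto)
  have "laplacian Y (c *\<^sub>R x) = (\<Sum>i\<in>Basis. of_real (1/c) * frechet_derivative (partial i Y) (at x) ((1/c) *\<^sub>R i))"
    by (rule laplacian_eqI[OF _ _ 1, of "UNIV - {0}" _ "\<lambda>i h. of_real (1/c) * frechet_derivative (partial i Y) (at x) ((1/c) *\<^sub>R h)"])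
      (use c x D2 in \<open>auto intro!: has_derivative_mult_right simp del: of_real_divide\<close>)
  also have "\<dots> = (\<Sum>i\<in>Basis. frechet_derivative (partial i Y) (at x) i / of_real (c\<^sup>2))"
  proof (rule sum.cong[OF refl])
    fix i :: 'a assume "i \<in> Basis"
    then have "frechet_derivative (partial i Y) (at x) ((1/c) *\<^sub>R i) = of_real (1/c) * frechet_derivative (partial i Y) (at x) i"
      using linear_scale[OF has_derivative_linear[OF Ck_on_2_D(2)[OF Y]], of x i "1/c" i] x by (simp add: scaleR_conv_of_real)
    then show "of_real (1/c) * frechet_derivative (partial i Y) (at x) ((1/c) *\<^sub>R i) = frechet_derivative (partial i Y) (at x) i / of_real (c\<^sup>2)"
      using c by (simp add: field_simps power2_eq_square)
  qed
  finally show ?thesis by (simp add: laplacian_def sum_divide_distrib)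
qed

section \<open>Integration by parts\<close>

lemma AE_lborel_nonzero: "AE x in lborel. x \<noteq> (0::'a::euclidean_space)"
  by (rule AE_lborel_singleton)

lemma lborel_integral_translate:
  fixes f :: "'a::euclidean_space \<Rightarrow> 'b::{banach, second_countable_topology}"
  assumes "f \<in> borel_measurable borel"
  shows "(LINT x|lborel. f (c + x)) = (LINT x|lborel. f x)"
  using integral_distr[of "(+) c" lborel borel f] assms by (simp add: lborel_distr_plus)

lemma lborel_integral_reflect:
  fixes f :: "real \<Rightarrow> complex"
  shows "(LINT t|lborel. f (- t)) = (LINT q|lborel. f q)"
  using lborel_integral_real_affine[of "-1" f 0] by simp

lemma continuous_compact_support_integrable:
  fixes f :: "'a::euclidean_space \<Rightarrow> complex"
  assumes "continuous_on UNIV f" "compact K" "\<And>x. x \<notin> K \<Longrightarrow> f x = 0"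
  shows "integrable lborel f"
proof -
  have "integrable lborel (\<lambda>x. indicator K x *\<^sub>R f x)"
    using borel_integrable_compact[OF assms(2), of f] assms(1) continuous_on_subset
    by (auto simp: set_integrable_def)
  moreover have "(\<lambda>x. indicator K x *\<^sub>R f x) = f"
    using assms(3) by (auto simp: indicator_def)
  ultimately show ?thesis by simp
qed

lemma continuous_compact_support_bounded:
  fixes f :: "'a::euclidean_space \<Rightarrow> complex"
  assumes "continuous_on UNIV f" "compact K" "\<And>x. x \<notin> K \<Longrightarrow> f x = 0"
  obtains B where "B > 0" "\<And>x. norm (f x) \<le> B"
proof -
  have "bounded (f ` K)"
    using assms by (intro compact_imp_bounded compact_continuous_image) (auto intro: continuous_on_subset)
  then obtain B where "B > 0" "\<And>x. x \<in> K \<Longrightarrow> norm (f x) \<le> B"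
    by (auto simp: bounded_pos)
  with that[of B] show ?thesis using assms(3) by (metis less_eq_real_def norm_zero)
qed

lemma partial_zero_outside:
  assumes "closed K" "\<And>x. x \<notin> K \<Longrightarrow> f x = 0" "x \<notin> K"
  shows "frechet_derivative f (at x) i = 0"
  using frechet_derivative_cong_open[of "- K" x f "\<lambda>_. 0"] assms by (simp add: frechet_derivative_const open_Compl)

text \<open>Differentiate the translation-invariant integral of \<open>F (x + t i)\<close> at \<open>t = 0\<close> under the integral sign. This avoids Fubini's theorem for a
  single coordinate.\<close>

lemma integral_partial_zero:
  fixes F :: "'a::euclidean_space \<Rightarrow> complex"
  assumes F: "Ck_on 1 UNIV F" and K: "compact K" "\<And>x. x \<notin> K \<Longrightarrow> F x = 0" and i: "i \<in> Basis"
  shows "integrable lborel (partial i F)" "(LINT x|lborel. partial i F x) = 0"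
proof -
  have dF: "(F has_derivative frechet_derivative F (at x)) (at x)" for x
    using F by (auto intro: has_derivative_frechet)
  have cD: "continuous_on UNIV (partial i F)" using F i by auto
  have cF: "continuous_on UNIV F" by (rule Ck_on_imp_continuous_on[OF F])
  have DK: "partial i F x = 0" if "x \<notin> K" for x
    using that by (intro partial_zero_outside[OF compact_imp_closed[OF K(1)] K(2)]) auto
  show "integrable lborel (partial i F)"
    by (rule continuous_compact_support_integrable[OF cD K(1) DK])
  obtain B where B: "B > 0" "\<And>x. norm (partial i F x) \<le> B"
    using continuous_compact_support_bounded[OF cD K(1) DK] by blast
  obtain R where R: "\<And>x. x \<in> K \<Longrightarrow> norm x \<le> R"
    using compact_imp_bounded[OF K(1)] by (auto simp: bounded_iff)
  have lin: "((\<lambda>t. F (x + t *\<^sub>R i)) has_vector_derivative partial i F (x + t *\<^sub>R i)) (at t)" for x t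
  proof -
    have "((\<lambda>t. x + t *\<^sub>R i) has_derivative (\<lambda>t. t *\<^sub>R i)) (at t)"
      by (auto intro!: derivative_eq_intros)
    from has_derivative_compose[OF this dF] show ?thesis
      by (simp add: has_vector_derivative_def linear_scale[OF has_derivative_linear[OF dF]])
  qed
  have mv: "norm (F (x + t *\<^sub>R i) - F x) \<le> B * \<bar>t\<bar>" for x t
  proof -
    have "norm (F (x + t *\<^sub>R i) - F (x + 0 *\<^sub>R i)) \<le> B * norm (t - 0)"
      by (rule differentiable_bound[of UNIV "\<lambda>t. F (x + t *\<^sub>R i)" "\<lambda>t h. h *\<^sub>R partial i F (x + t *\<^sub>R i)" B])
        (use lin B in \<open>auto simp: has_vector_derivative_def intro!: onorm_le mult_mono mult.commute
           simp: mult.commute[of B]\<close>)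
    then show ?thesis by simp
  qed
  define s where "s = (\<lambda>n x. of_nat (Suc n) * (F (x + (1 / real (Suc n)) *\<^sub>R i) - F x))"
  have cs: "continuous_on UNIV (s n)" for n
    unfolding s_def by (intro continuous_intros continuous_on_compose2[OF cF]) auto
  have "(\<lambda>n. LINT x|lborel. s n x) \<longlonglongrightarrow> (LINT x|lborel. partial i F x)"
  proof (rule integral_dominated_convergence)
    show "partial i F \<in> borel_measurable lborel" "s n \<in> borel_measurable lborel" for n
      using cD cs by (auto intro: borel_measurable_continuous_onI)
    show "integrable lborel (\<lambda>x::'a. B * indicator (cball 0 (R + 1)) x)"
      by (intro integrable_mult_right integrable_real_indicator) (simp_all add: emeasure_lborel_cball_finite[unfolded infinity_ennreal_def])
    show "AE x in lborel. (\<lambda>n. s n x) \<longlonglongrightarrow> partial i F x"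
    proof (rule AE_I2)
      fix x
      have "((\<lambda>t. norm (F (x + t *\<^sub>R i) - F x - t *\<^sub>R partial i F x) / norm t) \<longlongrightarrow> 0) (at 0)"
        using lin[of x 0] by (simp add: has_vector_derivative_def has_derivative_iff_norm)
      moreover have "filterlim (\<lambda>n. 1 / real (Suc n)) (at 0) sequentially"
        using LIMSEQ_inverse_real_of_nat by (auto simp: filterlim_at inverse_eq_divide)
      ultimately have "(\<lambda>n. norm (F (x + (1 / real (Suc n)) *\<^sub>R i) - F x - (1 / real (Suc n)) *\<^sub>R partial i F x) / norm (1 / real (Suc n))) \<longlonglongrightarrow> 0"
        by (rule filterlim_compose)
      moreover have "norm (F (x + (1 / real (Suc n)) *\<^sub>R i) - F x - (1 / real (Suc n)) *\<^sub>R partial i F x) / norm (1 / real (Suc n))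
          = norm (s n x - partial i F x)" for n
      proof -
        have "s n x - partial i F x = of_nat (Suc n) * (F (x + (1 / real (Suc n)) *\<^sub>R i) - F x - (1 / real (Suc n)) *\<^sub>R partial i F x)"
          by (simp add: s_def scaleR_conv_of_real right_diff_distrib del: of_nat_Suc)
        then show ?thesis by (simp only: norm_mult norm_of_nat) simp
      qed
      ultimately have "(\<lambda>n. s n x - partial i F x) \<longlonglongrightarrow> 0"
        by (simp add: tendsto_norm_zero_iff)
      then show "(\<lambda>n. s n x) \<longlonglongrightarrow> partial i F x"
        by (rule LIM_zero_cancel)
    qed
    show "AE x in lborel. norm (s n x) \<le> B * indicator (cball 0 (R + 1)) x" for n
    proof (rule AE_I2)
      fix x
      show "norm (s n x) \<le> B * indicator (cball 0 (R + 1)) x"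
      proof (cases "norm x \<le> R + 1")
        case True
        have "norm (s n x) \<le> real (Suc n) * (B * \<bar>1 / real (Suc n)\<bar>)"
          unfolding s_def norm_mult norm_of_nat by (intro mult_left_mono mv) auto
        with True show ?thesis by simp
      next
        case False
        have "norm x \<le> norm (x + (1 / real (Suc n)) *\<^sub>R i) + norm ((1 / real (Suc n)) *\<^sub>R i)"
          using norm_triangle_ineq4[of "x + (1 / real (Suc n)) *\<^sub>R i" "(1 / real (Suc n)) *\<^sub>R i"] by simp
        also have "norm ((1 / real (Suc n)) *\<^sub>R i) \<le> 1" using i by simp
        finally have "x + (1 / real (Suc n)) *\<^sub>R i \<notin> K" "x \<notin> K"
          using R[of x] R[of "x + (1 / real (Suc n)) *\<^sub>R i"] False by auto
        then show ?thesis using False B by (simp add: s_def K(2))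
      qed
    qed
  qed
  moreover have "(LINT x|lborel. s n x) = 0" for n
  proof -
    have iF: "integrable lborel F" by (rule continuous_compact_support_integrable[OF cF K])
    have "integrable lborel (\<lambda>x. F (h + x))" "(LINT x|lborel. F (h + x)) = (LINT x|lborel. F x)" for h
      using iF integrable_distr[of "(+) h" lborel borel F] lborel_integral_translate[of F h]
        borel_measurable_continuous_onI[OF cF]
      by (simp_all add: lborel_distr_plus)
    from this[of "(1 / real (Suc n)) *\<^sub>R i"] iF show ?thesis
      by (simp add: s_def add.commute)
  qed
  ultimately show "(LINT x|lborel. partial i F x) = 0"
    by (simp add: LIMSEQ_const_iff)
qed


text \<open>Glues \<open>f\<close> on \<open>U\<close> to the zero function on the complement of \<open>K\<close>.\<close>

lemma Ck_on_UNIV_vanishing: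
  assumes "open U" "closed K" "K \<subseteq> U" "Ck_on k U f" "\<And>x. x \<notin> K \<Longrightarrow> f x = 0"
  shows "Ck_on k UNIV f"
proof -
  have "Ck_on k (- K) f"
    by (rule Ck_on_cong[OF _ _ Ck_on_const[of k _ 0]]) (use assms in auto)
  then have "Ck_on k (U \<union> - K) f"
    using assms by (intro Ck_on_Un) auto
  moreover have "U \<union> - K = UNIV" using assms by auto
  ultimately show ?thesis by simp
qed

lemma laplacian_zero_outside:
  assumes "closed K" "\<And>x. x \<notin> K \<Longrightarrow> f x = 0" "x \<notin> K"
  shows "laplacian f x = 0"
  unfolding laplacian_def
  by (intro sum.neutral ballI partial_zero_outside[OF assms(1) _ assms(3)] partial_zero_outside[OF assms(1,2)]) auto

text \<open>The function \<open>\<phi>\<close> need only be smooth near the support of \<open>u\<close>; it is used with powers of \<open>\<bar>x\<bar>\<close>, which are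
  singular at the origin. The proof integrates the divergence of \<open>\<phi> \<nabla>u - u \<nabla>\<phi>\<close>, which extends by zero.\<close>

lemma green_identity:
  fixes u \<phi> :: "'a::euclidean_space \<Rightarrow> complex"
  assumes u: "Ck_on 2 UNIV u" and K: "compact K" "\<And>x. x \<notin> K \<Longrightarrow> u x = 0"
    and \<phi>: "Ck_on 2 U \<phi>" "open U" "K \<subseteq> U"
  shows "integrable lborel (\<lambda>x. laplacian u x * \<phi> x)" "integrable lborel (\<lambda>x. u x * laplacian \<phi> x)"
    "(LINT x|lborel. laplacian u x * \<phi> x) = (LINT x|lborel. u x * laplacian \<phi> x)"
proof -
  note K' = compact_imp_closed[OF K(1)]
  have uU: "Ck_on 2 U u" using Ck_on_subset[OF u] by simp
  have Lu: "laplacian u x = 0" if "x \<notin> K" for x by (rule laplacian_zero_outside[OF K' K(2) that])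
  have ext: "continuous_on UNIV f" if "continuous_on U f" "\<And>x. x \<notin> K \<Longrightarrow> f x = 0" for f :: "'a \<Rightarrow> complex"
    using Ck_on_UNIV_vanishing[OF \<phi>(2) K' \<phi>(3), of 0 f] that by simp
  have cL: "continuous_on U (laplacian f)" if "Ck_on 2 U f" for f :: "'a \<Rightarrow> complex"
    using Ck_on_laplacian[OF \<phi>(2), of 0 f] that by (simp add: numeral_2_eq_2)
  show 1: "integrable lborel (\<lambda>x. laplacian u x * \<phi> x)"
    by (rule continuous_compact_support_integrable[OF ext K(1)])
      (use Lu in \<open>auto intro!: continuous_on_mult cL uU Ck_on_imp_continuous_on[OF \<phi>(1)]\<close>)
  show 2: "integrable lborel (\<lambda>x. u x * laplacian \<phi> x)"
    by (rule continuous_compact_support_integrable[OF ext K(1)])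
      (use K(2) in \<open>auto intro!: continuous_on_mult cL \<phi>(1) Ck_on_imp_continuous_on[OF uU]\<close>)
  define F where "F = (\<lambda>i x. partial i u x * \<phi> x - u x * partial i \<phi> x)"
  have FK: "F i x = 0" if "x \<notin> K" for i x
    using K(2)[OF that] partial_zero_outside[OF K' K(2) that] by (simp add: F_def)
  have F1: "Ck_on 1 UNIV (F i)" if "i \<in> Basis" for i
  proof (rule Ck_on_UNIV_vanishing[OF \<phi>(2) K' \<phi>(3) _ FK])
    show "Ck_on 1 U (F i)"
      unfolding F_def
      by (intro Ck_on_diff Ck_on_mult \<phi>(2) Ck_on_2_D(3)[OF uU that] Ck_on_2_D(3)[OF \<phi>(1) that]
          Ck_on_mono[OF uU] Ck_on_mono[OF \<phi>(1)]) auto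
  qed
  have div: "(\<Sum>i\<in>Basis. partial i (F i) x) = laplacian u x * \<phi> x - u x * laplacian \<phi> x" for x
  proof (cases "x \<in> K")
    case True
    with \<phi>(3) have x: "x \<in> U" by auto
    have "partial i (F i) x = frechet_derivative (partial i u) (at x) i * \<phi> x - u x * frechet_derivative (partial i \<phi>) (at x) i" if "i \<in> Basis" for i
    proof -
      have "(F i has_derivative (\<lambda>h. (partial i u x * frechet_derivative \<phi> (at x) h + frechet_derivative (partial i u) (at x) h * \<phi> x)
           - (u x * frechet_derivative (partial i \<phi>) (at x) h + frechet_derivative u (at x) h * partial i \<phi> x))) (at x)"
        unfolding F_def by (intro has_derivative_diff has_derivative_mult Ck_on_2_D[OF uU] Ck_on_2_D[OF \<phi>(1)] x that)
      from partial_eqI[OF this, of i] show ?thesis by simp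
    qed
    then show ?thesis by (simp add: laplacian_def sum_distrib_left sum_distrib_right sum_subtractf)
  next
    case False
    then have "partial i (F i) x = 0" for i by (intro partial_zero_outside[OF K' FK])
    with False show ?thesis by (simp add: Lu K(2))
  qed
  have "(LINT x|lborel. laplacian u x * \<phi> x) - (LINT x|lborel. u x * laplacian \<phi> x)
      = (LINT x|lborel. (\<Sum>i\<in>Basis. partial i (F i) x))"
    unfolding div using 1 2 by simp
  also have "\<dots> = (\<Sum>i\<in>Basis. LINT x|lborel. partial i (F i) x)"
    by (intro Bochner_Integration.integral_sum integral_partial_zero(1)[OF F1 K(1) FK])
  also have "\<dots> = 0"
    by (intro sum.neutral ballI integral_partial_zero(2)[OF F1 K(1) FK])
  finally show "(LINT x|lborel. laplacian u x * \<phi> x) = (LINT x|lborel. u x * laplacian \<phi> x)" by simp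
qed

section \<open>Polar coordinates with a logarithmic radius\<close>

abbreviation polar :: "'a::euclidean_space \<Rightarrow> real \<times> 'a" where
  "polar x \<equiv> (- ln (norm x), sgn x)"

text \<open>In the coordinate \<open>t = - ln r\<close> the radial measure \<open>r\<^sup>n\<^sup>-\<^sup>1 dr\<close> is \<open>exp (- n t) dt\<close>.\<close>

abbreviation (input) radial_measure :: "nat \<Rightarrow> real measure" where
  "radial_measure n \<equiv> density lborel (\<lambda>t. ennreal (exp (- real n * t)))"

lemma space_sphere_measure [simp]: "space (sphere_measure :: 'a::euclidean_space measure) = sphere 0 1"
  by (simp add: sphere_measure_def space_restrict_space space_scale_measure)

lemma measurable_sgn [measurable]: "(sgn :: 'a::euclidean_space \<Rightarrow> 'a) \<in> borel_measurable borel"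
  unfolding sgn_div_norm by measurable

lemma sets_sphere_measure_iff:
  "B \<in> sets (sphere_measure :: 'a::euclidean_space measure) \<longleftrightarrow> B \<in> sets borel \<and> B \<subseteq> sphere 0 1"
  unfolding sets_sphere_measure by (subst sets_restrict_space_iff) auto

lemma emeasure_cone_le:
  fixes B :: "'a::euclidean_space set"
  shows "emeasure lborel {x. 0 < norm x \<and> norm x \<le> 1 \<and> sgn x \<in> B} \<le> emeasure lborel (cball (0::'a) 1)"
  by (intro emeasure_mono) auto

lemma finite_measure_sphere_measure: "finite_measure (sphere_measure :: 'a::euclidean_space measure)"
proof
  have "emeasure (sphere_measure :: 'a measure) (sphere 0 1) \<le> of_nat DIM('a) * emeasure lborel (cball (0::'a) 1)"
    using mult_left_mono[OF emeasure_cone_le[of "sphere (0::'a) 1"], of "of_nat DIM('a)"]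
    by (subst emeasure_sphere_measure) auto
  also have "\<dots> < \<infinity>"
    using emeasure_lborel_cball_finite[of "0::'a" 1] by (simp add: ennreal_mult_less_top of_nat_less_top)
  finally show "emeasure (sphere_measure :: 'a measure) (space sphere_measure) \<noteq> \<infinity>" by simp
qed

interpretation sphere: finite_measure "sphere_measure :: 'a::euclidean_space measure"
  by (rule finite_measure_sphere_measure)

text \<open>Cones scale like the \<open>n\<close>-th power of the radius; the surface measure is defined by the cone of radius 1.\<close>

lemma emeasure_cone:
  fixes B :: "'a::euclidean_space set"
  assumes B: "B \<in> sets borel" "B \<subseteq> sphere 0 1" and r: "r > 0"
  shows "of_nat DIM('a) * emeasure lborel {x. x \<noteq> 0 \<and> norm x < r \<and> sgn x \<in> B}
    = ennreal (r ^ DIM('a)) * emeasure sphere_measure B"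
proof -
  let ?A = "{x. 0 < norm x \<and> norm x \<le> 1 \<and> sgn x \<in> B}"
  let ?C = "{x. x \<noteq> 0 \<and> norm x < r \<and> sgn x \<in> B}"
  have [measurable]: "B \<in> sets borel" by fact
  have mA: "?A \<in> sets borel" and mC: "?C \<in> sets borel" by measurable
  have "emeasure lborel ?C = emeasure lborel {x. 0 < norm x \<and> norm x \<le> r \<and> sgn x \<in> B}"
  proof (rule emeasure_eq_AE)
    have "sphere (0::'a) r \<in> null_sets lborel"
      using negligible_sphere[of "0::'a" r] by (simp add: negligible_iff_null_sets null_sets_completion_iff)
    then show "AE x in lborel. x \<in> ?C \<longleftrightarrow> x \<in> {x. 0 < norm x \<and> norm x \<le> r \<and> sgn x \<in> B}"
      by (auto dest!: AE_not_in)
  qed (use mC in simp_all)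
  also have "{x. 0 < norm x \<and> norm x \<le> r \<and> sgn x \<in> B} = (\<lambda>x. r *\<^sub>R x) ` ?A"
  proof (intro set_eqI iffI)
    fix x assume x: "x \<in> {x. 0 < norm x \<and> norm x \<le> r \<and> sgn x \<in> B}"
    then have "(1/r) *\<^sub>R x \<in> ?A" using r by (simp add: sgn_scaleR divide_le_eq)
    moreover have "x = r *\<^sub>R ((1/r) *\<^sub>R x)" using r by simp
    ultimately show "x \<in> (\<lambda>x. r *\<^sub>R x) ` ?A" by blast
  qed (use r in \<open>auto simp: sgn_scaleR mult_le_cancel_left1\<close>)
  also have "emeasure lborel ((\<lambda>x. r *\<^sub>R x) ` ?A) = emeasure lborel ((\<lambda>x. (1/r) *\<^sub>R x) -` ?A \<inter> space lborel)"
  proof -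
    have "(\<lambda>x. r *\<^sub>R x) ` ?A = (\<lambda>x. (1/r) *\<^sub>R x) -` ?A \<inter> space lborel"
    proof (intro set_eqI iffI)
      fix x assume x: "x \<in> (\<lambda>x. (1/r) *\<^sub>R x) -` ?A \<inter> space lborel"
      moreover have "x = r *\<^sub>R ((1/r) *\<^sub>R x)" using r by simp
      ultimately show "x \<in> (\<lambda>x. r *\<^sub>R x) ` ?A" by blast
    qed (use r in auto)
    then show ?thesis by simp
  qed
  also have "\<dots> = emeasure (distr lborel borel (\<lambda>x. (1/r) *\<^sub>R x)) ?A"
    using mA by (subst emeasure_distr) auto
  also have "\<dots> = ennreal (r ^ DIM('a)) * emeasure lborel ?A"
  proof -
    have "emeasure lborel ?A = emeasure (density (distr lborel borel (\<lambda>x::'a. 0 + (1/r) *\<^sub>R x)) (\<lambda>_. \<bar>1/r\<bar> ^ DIM('a))) ?A"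
      using r lborel_affine[of "1/r" "0::'a"] by simp
    also have "\<dots> = ennreal (\<bar>1/r\<bar> ^ DIM('a)) * emeasure (distr lborel borel (\<lambda>x. (1/r) *\<^sub>R x)) ?A"
      using mA by (subst emeasure_density_const) auto
    finally have "ennreal (r ^ DIM('a)) * emeasure lborel ?A
        = (ennreal (r ^ DIM('a)) * ennreal (\<bar>1/r\<bar> ^ DIM('a))) * emeasure (distr lborel borel (\<lambda>x. (1/r) *\<^sub>R x)) ?A"
      by (simp add: mult.assoc)
    also have "ennreal (r ^ DIM('a)) * ennreal (\<bar>1/r\<bar> ^ DIM('a)) = 1"
      using r by (simp add: ennreal_mult[symmetric] power_mult_distrib[symmetric])
    finally show ?thesis by simp
  qed
  finally show ?thesis
    using emeasure_sphere_measure[OF B] by (simp add: ac_simps)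
qed

lemma nn_integral_exp_tail:
  fixes d :: real
  assumes "d > 0"
  shows "(\<integral>\<^sup>+s. ennreal (exp (- d * s)) * indicator {t<..} s \<partial>lborel) = ennreal (exp (- d * t) / d)"
proof -
  have "(\<integral>\<^sup>+s. ennreal (exp (- d * s)) * indicator {t<..} s \<partial>lborel)
      = (\<integral>\<^sup>+s. ennreal (exp (- d * s)) * indicator {t..} s \<partial>lborel)"
    by (intro nn_integral_cong_AE, use AE_lborel_singleton[of t] in eventually_elim)
      (simp split: split_indicator)
  also have "\<dots> = ennreal (0 - (- exp (- d * t) / d))"
  proof (rule nn_integral_FTC_atLeast)
    show "DERIV (\<lambda>s. - exp (- d * s) / d) s :> exp (- d * s)" for s
      using assms by (auto intro!: derivative_eq_intros)
    have "- d < 0" using assms by simp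
    from filterlim_compose[OF exp_at_bot filterlim_tendsto_neg_mult_at_bot[OF tendsto_const this filterlim_ident]]
    have "((\<lambda>s. exp (- d * s)) \<longlongrightarrow> 0) at_top" .
    from tendsto_mult_right_zero[OF this, of "- 1 / d"]
    show "((\<lambda>s. - exp (- d * s) / d) \<longlongrightarrow> 0) at_top" using assms by simp
  qed auto
  finally show ?thesis by simp
qed

lemma sigma_finite_radial: "sigma_finite_measure (radial_measure n)"
  using sigma_finite_lborel
  by (subst sigma_finite_measure.sigma_finite_iff_density_finite) auto

text \<open>The origin is removed because \<open>sgn 0 = 0\<close> does not lie on the sphere.\<close>

definition punctured :: "'a::euclidean_space measure" where
  "punctured = restrict_space lborel (- {0})"

lemma polar_measurable:
  "polar \<in> punctured \<rightarrow>\<^sub>M (borel \<Otimes>\<^sub>M (sphere_measure :: 'a::euclidean_space measure))"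
proof (rule measurable_Pair)
  show "(\<lambda>x. - ln (norm x)) \<in> punctured \<rightarrow>\<^sub>M borel"
    unfolding punctured_def by (intro measurable_restrict_space1) simp
  show "sgn \<in> punctured \<rightarrow>\<^sub>M (sphere_measure :: 'a measure)"
    unfolding punctured_def
    by (subst measurable_cong_sets[OF refl sets_sphere_measure], intro measurable_restrict_space3) (auto simp: norm_sgn)
qed

text \<open>Both measures are compared on rectangles \<open>A \<times> B\<close>. For fixed \<open>B\<close> they are measures in \<open>A\<close>, and these agree on the
  half-lines \<open>{t<..}\<close>, which correspond to the cones over \<open>B\<close> of radius \<open>exp (- t)\<close>.\<close>

lemma polar_distr:
  "distr punctured (borel \<Otimes>\<^sub>M (sphere_measure :: 'a::euclidean_space measure)) polar
    = radial_measure DIM('a) \<Otimes>\<^sub>M sphere_measure"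
proof (rule sym, rule pair_measure_eqI)
  let ?D = "distr punctured (borel \<Otimes>\<^sub>M (sphere_measure :: 'a measure)) polar"
  note m = polar_measurable
  show "sigma_finite_measure (radial_measure DIM('a))" by (rule sigma_finite_radial)
  show "sigma_finite_measure (sphere_measure :: 'a measure)" by unfold_locales
  show "sets (radial_measure DIM('a) \<Otimes>\<^sub>M sphere_measure) = sets ?D"
    by (simp cong: sets_pair_measure_cong)
  fix A :: "real set" and B :: "'a set"
  assume A: "A \<in> sets (radial_measure DIM('a))" and B: "B \<in> sets (sphere_measure :: 'a measure)"
  have B': "B \<in> sets borel" "B \<subseteq> sphere 0 1" using B by (auto simp: sets_sphere_measure_iff)
  define N where "N = distr (restrict_space lborel {x. x \<noteq> 0 \<and> sgn x \<in> B}) borel (\<lambda>x::'a. - ln (norm x))"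
  define M where "M = scale_measure (emeasure sphere_measure B) (radial_measure DIM('a))"
  have [measurable]: "B \<in> sets borel" by fact
  have S: "{x. x \<noteq> 0 \<and> sgn x \<in> B} \<in> sets borel" by measurable
  have eN: "emeasure N X = emeasure lborel {x. x \<noteq> 0 \<and> - ln (norm x) \<in> X \<and> sgn x \<in> B}" if "X \<in> sets borel" for X
  proof -
    have "emeasure N X = emeasure (restrict_space lborel {x. x \<noteq> 0 \<and> sgn x \<in> B}) ((\<lambda>x. - ln (norm x)) -` X \<inter> {x. x \<noteq> 0 \<and> sgn x \<in> B})"
      unfolding N_def using that
      by (subst emeasure_distr) (auto simp: space_restrict_space intro!: measurable_restrict_space1)
    also have "\<dots> = emeasure lborel ((\<lambda>x. - ln (norm x)) -` X \<inter> {x. x \<noteq> 0 \<and> sgn x \<in> B})"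
      using S by (intro emeasure_restrict_space) auto
    also have "(\<lambda>x. - ln (norm x)) -` X \<inter> {x. x \<noteq> 0 \<and> sgn x \<in> B} = {x. x \<noteq> 0 \<and> - ln (norm x) \<in> X \<and> sgn x \<in> B}"
      by auto
    finally show ?thesis .
  qed
  have "M = N"
  proof (rule measure_eqI_lessThan)
    fix t :: real
    have n: "real DIM('a) > 0" by simp
    have M: "emeasure M {t<..} = emeasure sphere_measure B * ennreal (exp (- real DIM('a) * t) / DIM('a))"
      unfolding M_def using nn_integral_exp_tail[OF n, of t] by (simp add: emeasure_density)
    show "emeasure M {t<..} < \<infinity>"
    proof -
      have "emeasure sphere_measure B < top" using sphere.emeasure_finite[of B] by (metis less_top infinity_ennreal_def)
      then show ?thesis unfolding M by (simp add: ennreal_mult_less_top)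
    qed
    have eq: "{x. x \<noteq> 0 \<and> - ln (norm x) \<in> {t<..} \<and> sgn x \<in> B} = {x. x \<noteq> 0 \<and> norm x < exp (- t) \<and> sgn x \<in> B}"
    proof -
      have "- ln (norm x) \<in> {t<..} \<longleftrightarrow> norm x < exp (- t)" if "x \<noteq> 0" for x :: 'a
        using that ln_less_cancel_iff[of "norm x" "exp (-t)"] by auto
      then show ?thesis by auto
    qed
    have "emeasure N {t<..} = emeasure lborel {x. x \<noteq> 0 \<and> norm x < exp (- t) \<and> sgn x \<in> B}"
      unfolding eq[symmetric] by (rule eN) simp
    then have "of_nat DIM('a) * emeasure N {t<..} = ennreal (exp (- t) ^ DIM('a)) * emeasure sphere_measure B"
      using emeasure_cone[OF B', of "exp (-t)"] by simp
    also have "exp (- t) ^ DIM('a) = exp (- real DIM('a) * t)"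
      by (simp add: exp_of_nat_mult[symmetric])
    also have "ennreal (exp (- real DIM('a) * t)) = of_nat DIM('a) * ennreal (exp (- real DIM('a) * t) / DIM('a))"
      by (simp add: ennreal_of_nat_eq_real_of_nat ennreal_mult[symmetric])
    finally have "of_nat DIM('a) * emeasure N {t<..} = of_nat DIM('a) * emeasure M {t<..}"
      unfolding M by (simp add: ac_simps)
    then show "emeasure M {t<..} = emeasure N {t<..}"
      by (subst (asm) ennreal_mult_cancel_left) (auto simp: )
  qed (auto simp: M_def N_def)
  moreover have "emeasure (radial_measure DIM('a)) A * emeasure sphere_measure B = emeasure M A"
    by (simp add: M_def mult.commute)
  moreover have "emeasure ?D (A \<times> B) = emeasure N A"
  proof -
    have AB: "A \<times> B \<in> sets (borel \<Otimes>\<^sub>M (sphere_measure :: 'a measure))" using A B by auto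
    have "emeasure ?D (A \<times> B) = emeasure punctured (polar -` (A \<times> B) \<inter> (- {0}))"
      by (subst emeasure_distr[OF m AB]) (simp add: punctured_def space_restrict_space)
    also have "\<dots> = emeasure lborel (polar -` (A \<times> B) \<inter> (- {0}))"
      unfolding punctured_def by (intro emeasure_restrict_space) auto
    also have "polar -` (A \<times> B) \<inter> (- {0}) = {x. x \<noteq> 0 \<and> - ln (norm x) \<in> A \<and> sgn x \<in> B}" by auto
    finally show ?thesis using eN A by simp
  qed
  ultimately show "emeasure (radial_measure DIM('a)) A * emeasure sphere_measure B = emeasure ?D (A \<times> B)" by simp
qed


lemma measurable_polar_inverse:
  fixes g :: "'a::euclidean_space \<Rightarrow> 'b::topological_space"
  assumes "g \<in> borel_measurable borel"
  shows "(\<lambda>(t, \<theta>). g (exp (- t) *\<^sub>R \<theta>)) \<in> borel_measurable (borel \<Otimes>\<^sub>M (sphere_measure :: 'a measure))"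
proof -
  have [measurable]: "(\<lambda>\<theta>. \<theta>) \<in> (sphere_measure :: 'a measure) \<rightarrow>\<^sub>M borel"
    by (subst measurable_cong_sets[OF sets_sphere_measure refl]) (intro measurable_restrict_space1 measurable_ident_sets refl)
  show ?thesis
    unfolding case_prod_beta
    by (intro measurable_compose[OF _ assms] borel_measurable_scaleR borel_measurable_exp borel_measurable_uminus
       measurable_compose[OF measurable_fst] measurable_compose[OF measurable_snd]) simp_all
qed

lemma polar_inverse: "x \<noteq> 0 \<Longrightarrow> exp (- (- ln (norm x))) *\<^sub>R sgn x = (x :: 'a::euclidean_space)"
  by (simp add: sgn_div_norm)

lemma integrable_punctured:
  fixes g :: "'a::euclidean_space \<Rightarrow> 'b::{banach, second_countable_topology}"
  shows "integrable punctured g \<longleftrightarrow> integrable lborel g" "(LINT x|punctured. g x) = (LINT x|lborel. g x)"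
proof -
  show "integrable punctured g \<longleftrightarrow> integrable lborel g"
    unfolding punctured_def
    by (subst integrable_restrict_space, simp, rule integrable_discrete_difference[of "{0}"]) auto
  show "(LINT x|punctured. g x) = (LINT x|lborel. g x)"
    unfolding punctured_def
    by (subst integral_restrict_space, simp, rule integral_discrete_difference[of "{0}"]) auto
qed

lemma integrable_polar_iff:
  fixes g :: "'a::euclidean_space \<Rightarrow> 'b::{banach, second_countable_topology}"
  assumes g: "g \<in> borel_measurable borel"
  shows "integrable lborel g \<longleftrightarrow> integrable (radial_measure DIM('a) \<Otimes>\<^sub>M sphere_measure) (\<lambda>(t, \<theta>). g (exp (- t) *\<^sub>R \<theta>))"
    "(LINT x|lborel. g x) = (LINT p|(radial_measure DIM('a) \<Otimes>\<^sub>M sphere_measure). (\<lambda>(t, \<theta>). g (exp (- t) *\<^sub>R \<theta>)) p)"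
proof -
  have eq: "(\<lambda>(t, \<theta>). g (exp (- t) *\<^sub>R \<theta>)) (polar x) = g x" if "x \<in> space punctured" for x
    using that polar_inverse[of x] by (simp add: punctured_def space_restrict_space)
  show "integrable lborel g \<longleftrightarrow> integrable (radial_measure DIM('a) \<Otimes>\<^sub>M sphere_measure) (\<lambda>(t, \<theta>). g (exp (- t) *\<^sub>R \<theta>))"
    unfolding polar_distr[symmetric] integrable_distr_eq[OF polar_measurable measurable_polar_inverse[OF g]]
    by (subst Bochner_Integration.integrable_cong[OF refl eq]) (simp_all add: integrable_punctured)
  show "(LINT x|lborel. g x) = (LINT p|(radial_measure DIM('a) \<Otimes>\<^sub>M sphere_measure). (\<lambda>(t, \<theta>). g (exp (- t) *\<^sub>R \<theta>)) p)"
    unfolding polar_distr[symmetric] integral_distr[OF polar_measurable measurable_polar_inverse[OF g]]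
    by (subst Bochner_Integration.integral_cong[OF refl eq]) (simp_all add: integrable_punctured)
qed

lemma pair_sigma_finite_polar: "pair_sigma_finite (radial_measure n) (sphere_measure :: 'a::euclidean_space measure)"
  by (intro pair_sigma_finite.intro sigma_finite_radial) unfold_locales

lemma polar_integral:
  fixes g :: "'a::euclidean_space \<Rightarrow> complex"
  assumes "integrable lborel g"
  shows "integrable lborel (\<lambda>t. exp (- real DIM('a) * t) *\<^sub>R (LINT \<theta>|sphere_measure. g (exp (- t) *\<^sub>R \<theta>)))"
    "(LINT x|lborel. g x) = (LINT t|lborel. exp (- real DIM('a) * t) *\<^sub>R (LINT \<theta>|sphere_measure. g (exp (- t) *\<^sub>R \<theta>)))"
proof -
  interpret P: pair_sigma_finite "radial_measure DIM('a)" "sphere_measure :: 'a measure" by (rule pair_sigma_finite_polar)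
  have g: "g \<in> borel_measurable borel" using assms by auto
  have "integrable (radial_measure DIM('a) \<Otimes>\<^sub>M sphere_measure) (\<lambda>(t, \<theta>). g (exp (- t) *\<^sub>R \<theta>))"
    using assms integrable_polar_iff(1)[OF g] by simp
  from P.integrable_fst'[OF this] P.integral_fst'[OF this]
  have 1: "integrable (radial_measure DIM('a)) (\<lambda>t. LINT \<theta>|sphere_measure. g (exp (- t) *\<^sub>R \<theta>))"
    and 2: "(LINT t|radial_measure DIM('a). LINT \<theta>|sphere_measure. g (exp (- t) *\<^sub>R \<theta>)) = (LINT x|lborel. g x)"
    using integrable_polar_iff(2)[OF g] by simp_all
  have m: "(\<lambda>t. LINT \<theta>|sphere_measure. g (exp (- t) *\<^sub>R \<theta>)) \<in> borel_measurable lborel"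
    using borel_measurable_integrable[OF 1] by simp
  show "integrable lborel (\<lambda>t. exp (- real DIM('a) * t) *\<^sub>R (LINT \<theta>|sphere_measure. g (exp (- t) *\<^sub>R \<theta>)))"
    using 1 by (subst (asm) integrable_density[OF m]) auto
  show "(LINT x|lborel. g x) = (LINT t|lborel. exp (- real DIM('a) * t) *\<^sub>R (LINT \<theta>|sphere_measure. g (exp (- t) *\<^sub>R \<theta>)))"
    unfolding 2[symmetric] by (subst integral_density[OF m]) auto
qed

lemma integrable_radial:
  fixes \<rho> :: "real \<Rightarrow> real"
  assumes "integrable lborel (\<lambda>t. exp (- real DIM('a) * t) * \<rho> (- t))" "\<rho> \<in> borel_measurable borel"
  shows "integrable lborel (\<lambda>x::'a::euclidean_space. \<rho> (ln (norm x)))"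
proof -
  interpret P: pair_sigma_finite "radial_measure DIM('a)" "sphere_measure :: 'a measure" by (rule pair_sigma_finite_polar)
  have [measurable]: "\<rho> \<in> borel_measurable borel" by fact
  have g: "(\<lambda>x::'a. \<rho> (ln (norm x))) \<in> borel_measurable borel" by measurable
  have i1: "integrable (radial_measure DIM('a)) (\<lambda>t. \<rho> (- t))"
    using assms by (subst integrable_density) auto
  have "integrable (radial_measure DIM('a) \<Otimes>\<^sub>M (sphere_measure :: 'a measure)) (\<lambda>(t, \<theta>). \<rho> (- t))"
  proof (rule P.Fubini_integrable)
    show "integrable (radial_measure DIM('a)) (\<lambda>t. LINT \<theta>|(sphere_measure :: 'a measure). norm (case (t, \<theta>) of (t, \<theta>) \<Rightarrow> \<rho> (- t)))"
      using i1 by (simp add: integrable_mult_right)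
  qed auto
  also have "?this \<longleftrightarrow> integrable (radial_measure DIM('a) \<Otimes>\<^sub>M (sphere_measure :: 'a measure)) (\<lambda>(t, \<theta>). \<rho> (ln (norm (exp (- t) *\<^sub>R \<theta>))))"
    by (rule Bochner_Integration.integrable_cong) (auto simp: space_pair_measure)
  finally show ?thesis
    by (subst integrable_polar_iff(1)[OF g])
qed

lemma integrable_exp_abs:
  fixes d :: real
  assumes "d > 0"
  shows "integrable lborel (\<lambda>t. exp (- d * \<bar>t\<bar>))"
proof -
  have 1: "integrable lborel (\<lambda>t. exp (- d * t) * indicator {-1<..} t)"
  proof (rule integrableI_nonneg)
    have "(\<integral>\<^sup>+ t. ennreal (exp (- d * t) * indicator {-1<..} t) \<partial>lborel) = (\<integral>\<^sup>+ t. ennreal (exp (- d * t)) * indicator {-1<..} t \<partial>lborel)"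
      by (intro nn_integral_cong) (auto split: split_indicator)
    also have "\<dots> < \<infinity>" using nn_integral_exp_tail[OF assms, of "-1"] by simp
    finally show "(\<integral>\<^sup>+ t. ennreal (exp (- d * t) * indicator {-1<..} t) \<partial>lborel) < \<infinity>" .
  qed auto
  have 2: "integrable lborel (\<lambda>t. exp (- d * (- t)) * indicator {-1<..} (- t))"
    using lborel_integrable_real_affine[OF 1, of "-1" 0] by simp
  show ?thesis
  proof (rule Bochner_Integration.integrable_bound[OF Bochner_Integration.integrable_add[OF 1 2]])
    show "AE t in lborel. norm (exp (- d * \<bar>t\<bar>)) \<le> norm (exp (- d * t) * indicator {-1<..} t + exp (- d * (- t)) * indicator {-1<..} (- t))"
    proof (rule AE_I2)
      fix t :: real
      have "exp (- d * \<bar>t\<bar>) \<le> exp (- d * t) * indicator {-1<..} t + exp (- d * (- t)) * indicator {-1<..} (- t)"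
        by (cases "t \<ge> 0") (simp_all split: split_indicator)
      then show "norm (exp (- d * \<bar>t\<bar>)) \<le> norm (exp (- d * t) * indicator {-1<..} t + exp (- d * (- t)) * indicator {-1<..} (- t))"
        by simp
    qed
  qed auto
qed

text \<open>The main criterion for absolute integrability: the first power is integrable at the origin, the second at infinity. In the coordinate
  \<open>ln \<bar>x\<bar>\<close> the two bounds together become exponential decay in both directions.\<close>

lemma integrable_two_powers:
  fixes g :: "'a::euclidean_space \<Rightarrow> 'b::{banach, second_countable_topology}"
  assumes g: "g \<in> borel_measurable borel" and \<alpha>: "- real DIM('a) < \<alpha>" and \<beta>: "\<beta> < - real DIM('a)"
    and a: "\<And>x. x \<noteq> 0 \<Longrightarrow> norm (g x) \<le> C * norm x powr \<alpha>" and b: "\<And>x. x \<noteq> 0 \<Longrightarrow> norm (g x) \<le> C * norm x powr \<beta>"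
  shows "integrable lborel g"
proof -
  \<comment> \<open>The rate of the exponential decay in the coordinate \<open>ln \<bar>x\<bar>\<close>.\<close>
  define d where "d = min (\<alpha> + DIM('a)) (- real DIM('a) - \<beta>)"
  have d: "d > 0" using \<alpha> \<beta> by (simp add: d_def)
  have C: "C \<ge> 0"
  proof -
    obtain i :: 'a where "i \<in> Basis" using nonempty_Basis by blast
    then have i: "i \<noteq> 0" "norm i = 1" by auto
    have "0 \<le> norm (g i)" by simp
    also have "\<dots> \<le> C * norm i powr \<alpha>" by (rule a[OF i(1)])
    finally show ?thesis using i by simp
  qed
  define \<rho> where "\<rho> = (\<lambda>q. C * exp (- real DIM('a) * q - d * \<bar>q\<bar>))"
  have "integrable lborel (\<lambda>t. C * exp (- d * \<bar>t\<bar>))"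
    using integrable_exp_abs[OF d] by simp
  also have "(\<lambda>t. C * exp (- d * \<bar>t\<bar>)) = (\<lambda>t. exp (- real DIM('a) * t) * \<rho> (- t))"
    by (auto simp: \<rho>_def fun_eq_iff exp_add[symmetric] exp_diff exp_minus field_simps)
  finally have "integrable lborel (\<lambda>x::'a. \<rho> (ln (norm x)))"
    by (rule integrable_radial) (simp add: \<rho>_def)
  then show ?thesis
  proof (rule Bochner_Integration.integrable_bound)
    show "g \<in> borel_measurable lborel" using g by simp
    show "AE x in lborel. norm (g x) \<le> norm (\<rho> (ln (norm x)))"
      using AE_lborel_singleton[of "0::'a"]
    proof eventually_elim
      case (elim x)
      define q where "q = ln (norm x)"
      have p: "norm x powr c = exp (c * q)" for c using elim by (simp add: powr_def q_def)
      have "norm (g x) \<le> C * exp (- real DIM('a) * q - d * \<bar>q\<bar>)"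
      proof (cases "q \<le> 0")
        case True
        have "d * q \<ge> (\<alpha> + DIM('a)) * q"
          using True by (intro mult_right_mono_neg) (auto simp: d_def)
        then have "\<alpha> * q \<le> - real DIM('a) * q - d * \<bar>q\<bar>"
          using True by (simp add: algebra_simps)
        then have "C * exp (\<alpha> * q) \<le> C * exp (- real DIM('a) * q - d * \<bar>q\<bar>)"
          using C by (intro mult_left_mono) simp_all
        with a[of x] elim show ?thesis by (simp add: p)
      next
        case False
        have "d * q \<le> (- real DIM('a) - \<beta>) * q"
          using False by (intro mult_right_mono) (auto simp: d_def)
        then have "\<beta> * q \<le> - real DIM('a) * q - d * \<bar>q\<bar>"
          using False by (simp add: algebra_simps)
        then have "C * exp (\<beta> * q) \<le> C * exp (- real DIM('a) * q - d * \<bar>q\<bar>)"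
          using C by (intro mult_left_mono) simp_all
        with b[of x] elim show ?thesis by (simp add: p)
      qed
      then show ?case using C by (simp add: \<rho>_def q_def)
    qed
  qed
qed

section \<open>Gamma integrals and Gaussians\<close>

text \<open>Euler's integral with the substitution \<open>t = exp u\<close>. In this form the scaling and the inversion of \<open>t\<close> are a translation
  and a reflection of \<open>u\<close>, which preserve Lebesgue measure.\<close>

lemma Gamma_log_integral:
  assumes "Re z > 0"
  shows "has_bochner_integral lborel (\<lambda>u. exp (z * of_real u - of_real (exp u))) (Gamma z)"
proof -
  let ?f = "\<lambda>t. of_real t powr (z - 1) / of_real (exp t) :: complex"
  let ?g = "\<lambda>u. exp (z * of_real u - of_real (exp u)) :: complex"
  have eq: "\<bar>exp u\<bar> *\<^sub>R ?f (exp u) = ?g u" for u :: real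
  proof -
    have "\<bar>exp u\<bar> *\<^sub>R ?f (exp u) = exp (of_real u) * exp ((z - 1) * of_real u) / exp (of_real (exp u))"
      by (simp add: scaleR_conv_of_real powr_def Ln_of_real exp_of_real)
    also have "\<dots> = exp (of_real u + (z - 1) * of_real u - of_real (exp u))"
      by (simp only: exp_add exp_diff)
    finally show ?thesis by (simp add: algebra_simps)
  qed
  have "(\<lambda>u. \<bar>exp u\<bar> *\<^sub>R ?f (exp u)) absolutely_integrable_on UNIV \<and> integral UNIV (\<lambda>u. \<bar>exp u\<bar> *\<^sub>R ?f (exp u)) = Gamma z"
  proof (subst has_absolute_integral_change_of_variables_real)
    have "range exp = {0::real<..}"
      by (auto simp: image_iff) (metis exp_ln)
    then show "?f absolutely_integrable_on range exp \<and> integral (range exp) ?f = Gamma z"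
      using absolutely_integrable_Gamma_integral'[OF assms] Gamma_integral_complex'[OF assms] by (simp add: integral_unique)
  qed (auto intro!: derivative_eq_intros simp: inj_on_def)
  then have 1: "?g absolutely_integrable_on UNIV" and 2: "integral UNIV ?g = Gamma z"
    by (simp_all only: eq)
  have "?g \<in> borel_measurable borel"
    by (intro borel_measurable_continuous_onI continuous_intros)
  then have m: "?g \<in> borel_measurable lborel" by simp
  have "integrable lebesgue ?g" using 1 by (simp add: set_integrable_def)
  then have 3: "integrable lborel ?g" using integrable_completion[OF m] by simp
  have "(LINT u|lborel. ?g u) = integral UNIV ?g"
    using integral_lborel[OF 3] by simp
  with 2 3 show ?thesis by (simp add: has_bochner_integral_iff)
qed

lemma Gamma_log_integral_scaled:
  assumes "Re z > 0" "c > 0"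
  shows "has_bochner_integral lborel (\<lambda>u. exp (z * of_real u - of_real (c * exp u))) (Gamma z * exp (- z * of_real (ln c)))"
proof -
  have "has_bochner_integral lborel (\<lambda>u. exp (z * of_real (ln c + 1 * u) - of_real (exp (ln c + 1 * u)))) (Gamma z)"
    using lborel_has_bochner_integral_real_affine_iff[of 1 "\<lambda>u. exp (z * of_real u - of_real (exp u))" "Gamma z" "ln c"]
      Gamma_log_integral[OF assms(1)] by simp
  from has_bochner_integral_mult_left[OF this, of "exp (- z * of_real (ln c))"]
  show ?thesis
    using assms(2) by (simp add: exp_add exp_diff exp_minus algebra_simps field_simps)
qed

text \<open>The moment \<open>\<integral> r\<^sup>p\<^sup>-\<^sup>1 exp (- s r\<^sup>2) dr\<close> over the positive half-line.\<close>

definition radial_gauss :: "real \<Rightarrow> real \<Rightarrow> real" where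
  "radial_gauss p s = Gamma (p / 2) * s powr (- p / 2) / 2"

lemma radial_gauss_integral:
  assumes "p > 0" "s > 0"
  shows "has_bochner_integral lborel (\<lambda>t. exp (- p * t - s * exp (- 2 * t))) (radial_gauss p s)"
proof -
  have p: "Re (of_real (p/2)) > 0" using assms by simp
  have "has_bochner_integral lborel (\<lambda>t. exp (of_real (p/2) * of_real (0 + (-2) * t) - of_real (s * exp (0 + (-2) * t)) :: complex))
      (Gamma (of_real (p/2)) * exp (- of_real (p/2) * of_real (ln s)) /\<^sub>R \<bar>-2\<bar>)"
    by (subst lborel_has_bochner_integral_real_affine_iff[of "-2" _ _ 0, symmetric])
      (use Gamma_log_integral_scaled[OF p assms(2)] in auto)
  from has_bochner_integral_bounded_linear[OF bounded_linear_Re this]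
  have "has_bochner_integral lborel (\<lambda>t. Re (exp (of_real (p/2) * of_real (0 + (-2) * t) - of_real (s * exp (0 + (-2) * t)) :: complex)))
      (Re (Gamma (of_real (p/2)) * exp (- of_real (p/2) * of_real (ln s)) /\<^sub>R \<bar>-2\<bar>))" .
  moreover have "exp (of_real (p/2) * of_real (0 + (-2) * t) - of_real (s * exp (0 + (-2) * t)) :: complex)
      = of_real (exp (- p * t - s * exp (- 2 * t)))" for t
    by (simp add: exp_of_real[symmetric])
  moreover have "Gamma (of_real (p/2)) * exp (- of_real (p/2) * of_real (ln s)) /\<^sub>R \<bar>-2\<bar> = (of_real (radial_gauss p s) :: complex)"
  proof -
    have "exp (- of_real (p/2) * of_real (ln s)) = (of_real (s powr (- p/2)) :: complex)"
      using assms by (simp add: powr_def exp_of_real[symmetric])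
    then show ?thesis
      by (simp add: radial_gauss_def Gamma_complex_of_real[symmetric] scaleR_conv_of_real)
  qed
  ultimately show ?thesis by (simp only: Re_complex_of_real)
qed

lemma radial_gauss_rec:
  assumes "p > 0" "s > 0"
  shows "radial_gauss (p + 2) s = p / (2 * s) * radial_gauss p s"
proof -
  have 1: "Gamma ((p + 2) / 2) = p / 2 * Gamma (p / 2)"
    using Gamma_plus1[of "p/2"] assms by (simp add: add_divide_distrib nonpos_Ints_def)
  have 2: "s powr (- (p + 2) / 2) = s powr (- p / 2) / s"
  proof -
    have "- (p + 2) / 2 = - p / 2 - 1" by (simp add: field_simps)
    then show ?thesis using assms by (simp only: powr_diff powr_one)
  qed
  show ?thesis unfolding radial_gauss_def 1 2 by simp
qed

lemma exp_Taylor_le: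
  fixes a :: real
  assumes "a \<ge> 0"
  shows "(\<Sum>j<N. a ^ j / fact j) \<le> exp a"
proof -
  have "(\<lambda>j. a ^ j / fact j) sums exp a"
    using exp_converges[of a] by (simp add: field_simps scaleR_conv_of_real)
  then show ?thesis
    using sum_le_suminf[of "\<lambda>j. a ^ j / fact j" "{..<N}"] assms by (auto simp: sums_iff)
qed

lemma power_le_fact_exp:
  fixes r :: real
  assumes "r \<ge> 0"
  shows "r ^ m \<le> fact m * exp r"
proof -
  have "r ^ m / fact m \<le> (\<Sum>j<Suc m. r ^ j / fact j)"
    using assms by (intro member_le_sum) auto
  also have "\<dots> \<le> exp r" by (rule exp_Taylor_le[OF assms])
  finally show ?thesis by (simp add: field_simps)
qed

lemma gauss_exponent_le:
  fixes a r s :: real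
  assumes "s > 0"
  shows "a * r - s * r\<^sup>2 \<le> a\<^sup>2 / (4 * s)"
proof -
  have "0 \<le> (2 * s * r - a)\<^sup>2 / (4 * s)" using assms by simp
  also have "\<dots> = a\<^sup>2 / (4 * s) - (a * r - s * r\<^sup>2)"
    using assms by (simp add: field_simps power2_eq_square)
  finally show ?thesis by simp
qed

text \<open>A Gaussian with an exponential factor is bounded and decays faster than every power.\<close>

lemma integrable_gaussian_bound:
  fixes f :: "'a::euclidean_space \<Rightarrow> 'b::{banach, second_countable_topology}"
  assumes f: "f \<in> borel_measurable borel" and s: "s > 0"
    and bound: "\<And>x. norm (f x) \<le> C * exp (a * norm x - s * (norm x)\<^sup>2)"
  shows "integrable lborel f"
proof -
  define N where "N = DIM('a) + 1"
  define M where "M = \<bar>C\<bar> * (exp (a\<^sup>2 / (4 * s)) + fact N * exp ((a + 1)\<^sup>2 / (4 * s)))"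
  have b: "norm (f x) \<le> \<bar>C\<bar> * exp (a * norm x - s * (norm x)\<^sup>2)" for x
    by (rule order_trans[OF bound mult_right_mono]) auto
  show ?thesis
  proof (rule integrable_two_powers[OF f, of 0 "- real N" M])
    show "- real DIM('a) < 0" "- real N < - real DIM('a)" by (simp_all add: N_def)
    fix x :: 'a assume x: "x \<noteq> 0"
    have "norm (f x) \<le> \<bar>C\<bar> * exp (a\<^sup>2 / (4 * s))"
      using gauss_exponent_le[OF s, of a "norm x"] by (intro order_trans[OF b]) (auto intro!: mult_left_mono)
    also have "\<dots> \<le> M" unfolding M_def by (intro mult_left_mono) auto
    finally show "norm (f x) \<le> M * norm x powr 0" using x by simp
    have "norm x ^ N * exp (a * norm x - s * (norm x)\<^sup>2) \<le> fact N * exp (norm x) * exp (a * norm x - s * (norm x)\<^sup>2)"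
      by (intro mult_right_mono power_le_fact_exp) auto
    also have "\<dots> = fact N * exp ((a + 1) * norm x - s * (norm x)\<^sup>2)"
      by (simp add: exp_add[symmetric] algebra_simps)
    also have "\<dots> \<le> fact N * exp ((a + 1)\<^sup>2 / (4 * s))"
      using gauss_exponent_le[OF s, of "a + 1" "norm x"] by (intro mult_left_mono) auto
    finally have "\<bar>C\<bar> * (norm x ^ N * exp (a * norm x - s * (norm x)\<^sup>2)) \<le> \<bar>C\<bar> * (fact N * exp ((a + 1)\<^sup>2 / (4 * s)))"
      by (intro mult_left_mono) auto
    also have "\<dots> \<le> M" unfolding M_def by (intro mult_left_mono) auto
    finally have "\<bar>C\<bar> * exp (a * norm x - s * (norm x)\<^sup>2) \<le> M / norm x ^ N"
      using x by (simp add: field_simps)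
    with b[of x] have "norm (f x) \<le> M / norm x ^ N" by linarith
    then show "norm (f x) \<le> M * norm x powr (- real N)"
      using x by (simp add: powr_minus powr_realpow field_simps)
  qed
qed

text \<open>For an integrand that splits in polar coordinates the integral is a product.\<close>

lemma polar_separated:
  fixes g :: "'a::euclidean_space \<Rightarrow> complex"
  assumes "integrable lborel g" "\<And>t \<theta>. norm \<theta> = 1 \<Longrightarrow> g (exp (- t) *\<^sub>R \<theta>) = \<psi> t * A \<theta>"
  shows "(LINT x|lborel. g x) = (LINT t|lborel. exp (- real DIM('a) * t) *\<^sub>R \<psi> t) * (LINT \<theta>|sphere_measure. A \<theta>)"
proof -
  have "(LINT \<theta>|sphere_measure. g (exp (- t) *\<^sub>R \<theta>)) = \<psi> t * (LINT \<theta>|sphere_measure. A \<theta>)" for t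
  proof -
    have "(LINT \<theta>|sphere_measure. g (exp (- t) *\<^sub>R \<theta>)) = (LINT \<theta>|sphere_measure. \<psi> t * A \<theta>)"
      by (rule Bochner_Integration.integral_cong) (use assms(2) in auto)
    then show ?thesis by simp
  qed
  then have "(LINT x|lborel. g x) = (LINT t|lborel. exp (- real DIM('a) * t) *\<^sub>R (\<psi> t * (LINT \<theta>|sphere_measure. A \<theta>)))"
    using polar_integral(2)[OF assms(1)] by simp
  then show ?thesis by (simp add: mult_scaleR_left[symmetric] del: mult_scaleR_left)
qed

lemma measure_sphere: "measure sphere_measure (sphere (0::'a::euclidean_space) 1) = 2 * pi powr (DIM('a) / 2) / Gamma (DIM('a) / 2)"
proof -
  have e: "{x::'a. 0 < norm x \<and> norm x \<le> 1 \<and> sgn x \<in> sphere 0 1} = cball 0 1 - {0}"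
    by (auto simp: norm_sgn)
  have "emeasure sphere_measure (sphere (0::'a) 1) = of_nat DIM('a) * emeasure lborel (cball (0::'a) 1)"
    by (subst emeasure_sphere_measure) (simp_all only: e emeasure_Diff_null_set[OF countable_imp_null_set_lborel[OF countable_insert[OF countable_empty]]] sets_lborel borel_closed closed_cball closed_sphere order_refl)
  then have "measure sphere_measure (sphere (0::'a) 1) = DIM('a) * unit_ball_vol DIM('a)"
    by (simp add: measure_def emeasure_cball ennreal_of_nat_eq_real_of_nat ennreal_mult[symmetric])
  also have "\<dots> = 2 * pi powr (DIM('a) / 2) / Gamma (DIM('a) / 2)"
  proof -
    have "Gamma (real DIM('a) / 2 + 1) = real DIM('a) / 2 * Gamma (real DIM('a) / 2)"
      by (rule Gamma_plus1) (auto dest: nonpos_Ints_nonpos)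
    moreover have "Gamma (real DIM('a) / 2) > 0" by (intro Gamma_real_pos) simp
    ultimately show ?thesis unfolding unit_ball_vol_def by (simp only:) simp
  qed
  finally show ?thesis .
qed

lemma gaussian_integral:
  assumes s: "s > 0"
  shows "(LINT x|lborel. complex_of_real (exp (- s * (norm (x::'a::euclidean_space))\<^sup>2))) = of_real ((pi / s) powr (DIM('a) / 2))"
proof -
  have n: "real DIM('a) > 0" by simp
  have i: "integrable lborel (\<lambda>x::'a. gauss s x)"
    by (rule integrable_gaussian_bound[OF _ s, of _ 1 0]) (auto simp: norm_exp_eq_Re)
  have "(LINT x|lborel. complex_of_real (exp (- s * (norm (x::'a))\<^sup>2)))
      = (LINT t|lborel. exp (- real DIM('a) * t) *\<^sub>R complex_of_real (exp (- s * exp (- 2 * t)))) * (LINT \<theta>|(sphere_measure :: 'a measure). 1)"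
    by (rule polar_separated[OF i]) (simp add: power_mult_distrib exp_double[symmetric])
  also have "(LINT \<theta>|(sphere_measure :: 'a measure). 1) = complex_of_real (measure sphere_measure (sphere (0::'a) 1))"
    by (simp add: scaleR_conv_of_real)
  also have "(LINT t|lborel. exp (- real DIM('a) * t) *\<^sub>R complex_of_real (exp (- s * exp (- 2 * t))))
      = (LINT t|lborel. complex_of_real (exp (- real DIM('a) * t - s * exp (- 2 * t))))"
    by (rule Bochner_Integration.integral_cong) (simp_all add: scaleR_conv_of_real of_real_mult[symmetric] exp_add[symmetric] del: of_real_mult)
  also have "\<dots> = of_real (radial_gauss DIM('a) s)"
    using radial_gauss_integral[OF n s] by (simp add: has_bochner_integral_iff)
  also have "complex_of_real (radial_gauss DIM('a) s) * of_real (measure sphere_measure (sphere (0::'a) 1)) = of_real ((pi / s) powr (DIM('a) / 2))"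
  proof -
    have "Gamma (real DIM('a) / 2) > 0" by (intro Gamma_real_pos) simp
    then have "radial_gauss DIM('a) s * measure sphere_measure (sphere (0::'a) 1) = (pi / s) powr (DIM('a) / 2)"
    proof -
      have "s powr (- real DIM('a) / 2) = 1 / s powr (DIM('a) / 2)"
        by (simp add: powr_minus_divide)
      moreover have "(pi / s) powr (DIM('a) / 2) = pi powr (DIM('a) / 2) / s powr (DIM('a) / 2)"
        by (rule powr_divide)
      ultimately show ?thesis
        unfolding radial_gauss_def measure_sphere by (simp only:) (use less_imp_neq[OF \<open>Gamma (real DIM('a) / 2) > 0\<close>] in simp)
    qed
    then show ?thesis by (metis of_real_mult)
  qed
  finally show ?thesis .
qed


lemma Ck_on_pos_power: "Ck_on k UNIV (\<lambda>s. of_real (max 0 s ^ Suc k))"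
proof (induction k)
  case 0
  show ?case by (auto intro!: continuous_intros)
next
  case (Suc k)
  show ?case
  proof (rule real_Ck_SucI)
    show "Ck_on k UNIV (\<lambda>s. of_nat (k + 2) * of_real (max 0 s ^ Suc k))"
      by (intro Ck_on_cmult Suc.IH open_UNIV)
    fix s :: real
    have "((\<lambda>s. max 0 s ^ Suc (Suc k)) has_real_derivative real (k + 2) * max 0 s ^ Suc k) (at s)"
    proof (cases "s = 0")
      case False
      show ?thesis
      proof (cases "s > 0")
        case True
        have "((\<lambda>s. s ^ Suc (Suc k)) has_real_derivative real (k + 2) * max 0 s ^ Suc k) (at s)"
          using True DERIV_pow[of "Suc (Suc k)" s UNIV] by simp
        then show ?thesis
          by (rule has_field_derivative_transform_within_open[of _ _ _ "{0<..}"]) (use True in auto)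
      next
        case neg: False
        have "((\<lambda>s. 0) has_real_derivative real (k + 2) * max 0 s ^ Suc k) (at s)"
          using neg by auto
        then show ?thesis
          by (rule has_field_derivative_transform_within_open[of _ _ _ "{..<0}"]) (use neg False in auto)
      qed
    next
      case True
      have "((\<lambda>h. max 0 h ^ Suc (Suc k) / h) \<longlongrightarrow> 0) (at (0::real))"
      proof (rule Lim_null_comparison)
        show "\<forall>\<^sub>F h in at 0. norm (max 0 h ^ Suc (Suc k) / h) \<le> \<bar>h\<bar> ^ Suc k"
        proof (rule always_eventually, rule allI)
          fix h :: real
          show "norm (max 0 h ^ Suc (Suc k) / h) \<le> \<bar>h\<bar> ^ Suc k"
          proof (cases "h > 0")
            case False
            then have "max 0 h = 0" by simp
            then show ?thesis by (simp del: power_Suc add: zero_power)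
          qed simp
        qed
        show "((\<lambda>h. \<bar>h\<bar> ^ Suc k) \<longlongrightarrow> 0) (at (0::real))"
          by (intro tendsto_null_power tendsto_rabs_zero tendsto_ident_at) auto
      qed
      with True show ?thesis by (simp add: DERIV_def)
    qed
    from has_vector_derivative_of_real[OF this]
    show "((\<lambda>s. of_real (max 0 s ^ Suc (Suc k))) has_vector_derivative of_nat (k + 2) * complex_of_real (max 0 s ^ Suc k)) (at s)"
      by simp
  qed
qed

text \<open>A cutoff in \<open>ln \<bar>x\<bar>\<close>; two continuous derivatives are enough for Green's identity.\<close>

definition bump :: "real \<Rightarrow> real" where
  "bump q = max 0 (1 - q\<^sup>2) ^ 3"

lemma bump_C2: "Ck_on 2 UNIV (\<lambda>q. complex_of_real (bump q))"
proof -
  have "Ck_on 2 UNIV (\<lambda>q::real. complex_of_real (max 0 (1 - q\<^sup>2) ^ Suc 2))"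
  proof (rule Ck_on_compose_real[where q'="\<lambda>q h. - 2 * q * h" and g="\<lambda>s. of_real (max 0 s ^ Suc 2)"])
    show "Ck_on 2 UNIV (\<lambda>s. complex_of_real (max 0 s ^ Suc 2))" by (rule Ck_on_pos_power)
    show "((\<lambda>q. 1 - q\<^sup>2) has_derivative (*) (- 2 * x)) (at x)" for x :: real
      by (auto intro!: derivative_eq_intros)
    show "Ck_on (2 - 1) UNIV (\<lambda>x. complex_of_real (- 2 * x * i))" for i :: real
      by (intro Ck_on_linear open_UNIV bounded_linear_compose[OF bounded_linear_of_real]
          bounded_linear_mult_const bounded_linear_const_mult bounded_linear_ident)
  qed auto
  then show ?thesis by (simp add: bump_def numeral_3_eq_3)
qed

lemma bump_nonneg: "0 \<le> bump q" by (simp add: bump_def)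

lemma bump_zero: "\<bar>q\<bar> > 1 \<Longrightarrow> bump q = 0"
proof -
  assume "\<bar>q\<bar> > 1"
  then have "1 < q\<^sup>2" using one_less_power[of "\<bar>q\<bar>" 2] by simp
  then show ?thesis by (simp add: bump_def max_def)
qed

lemma integral_exp_bump:
  "integrable lborel (\<lambda>q. exp (c * q) * bump q)" "(LINT q|lborel. exp (c * q) * bump q) > 0"
proof -
  have m: "continuous_on UNIV bump" unfolding bump_def by (intro continuous_intros)
  have 1: "integrable lborel (\<lambda>q. indicator {-1..1} q *\<^sub>R (exp (c * q) * bump q))"
  proof -
    have "continuous_on {-1..1} (\<lambda>q. exp (c * q) * bump q)"
      by (intro continuous_intros continuous_on_subset[OF m]) auto
    from borel_integrable_compact[OF compact_Icc this] show ?thesis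
      by (simp add: set_integrable_def)
  qed
  also have "(\<lambda>q. indicator {-1..1} q *\<^sub>R (exp (c * q) * bump q)) = (\<lambda>q. exp (c * q) * bump q)"
    by (auto simp: indicator_def fun_eq_iff intro!: bump_zero)
  finally show i: "integrable lborel (\<lambda>q. exp (c * q) * bump q)" .
  \<comment> \<open>A lower bound of the integrand on \<open>{0..1/2}\<close>.\<close>
  define e where "e = exp (- \<bar>c\<bar>) * (3/4) ^ 3"
  have "0 < e / 2" by (simp add: e_def)
  also have "e / 2 = (LINT q|lborel. e * indicator {0..1/2::real} q)" by simp
  also have "\<dots> \<le> (LINT q|lborel. exp (c * q) * bump q)"
  proof (rule integral_mono[OF _ i])
    show "integrable lborel (\<lambda>q. e * indicator {0..1/2::real} q)"
      by (intro integrable_mult_right integrable_real_indicator) (auto simp: less_top[symmetric])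
    fix q :: real
    show "e * indicator {0..1/2} q \<le> exp (c * q) * bump q"
    proof (cases "q \<in> {0..1/2}")
      case True
      then have "q\<^sup>2 \<le> (1/2)\<^sup>2" by (intro power_mono) auto
      then have "(3/4::real) ^ 3 \<le> bump q"
        unfolding bump_def by (intro power_mono) (auto simp: power2_eq_square)
      moreover have "\<bar>c * q\<bar> \<le> \<bar>c\<bar> * 1"
        unfolding abs_mult using True by (intro mult_left_mono) auto
      then have "exp (- \<bar>c\<bar>) \<le> exp (c * q)" by (simp add: abs_le_iff)
      ultimately show ?thesis using True unfolding e_def by (simp add: mult_mono)
    qed (simp add: bump_nonneg)
  qed
  finally show "(LINT q|lborel. exp (c * q) * bump q) > 0" .
qed

section \<open>Moments of a spherical harmonic\<close>

lemma laplacian_plane_power: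
  assumes "norm \<omega> = 1"
  shows "laplacian (\<lambda>x. (of_real (\<omega> \<bullet> x)) ^ j) x = of_nat (j * (j - 1)) * (of_real (\<omega> \<bullet> x)) ^ (j - 2)"
proof -
  have D: "((\<lambda>s. (complex_of_real s) ^ j) has_vector_derivative of_nat j * (of_real s) ^ (j - 1)) (at s)" for j s
    by (rule has_vector_derivative_real_field) (auto intro!: derivative_eq_intros)
  have "laplacian (\<lambda>x. (of_real (\<omega> \<bullet> x)) ^ j) x
      = of_real ((norm \<omega>)\<^sup>2) * (of_nat j * (of_nat (j - 1) * (of_real (\<omega> \<bullet> x)) ^ (j - 1 - 1)))"
    by (rule laplacian_plane[where g="\<lambda>s. (of_real s) ^ j" and g'="\<lambda>s. of_nat j * (of_real s) ^ (j - 1)"])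
      (intro D has_vector_derivative_mult_right)+
  then show ?thesis using assms by (simp add: numeral_2_eq_2)
qed

lemma Ck_on_plane_power: "Ck_on m UNIV (\<lambda>x::'a::euclidean_space. (complex_of_real (\<omega> \<bullet> x)) ^ j)"
proof (rule Ck_on_inner[of m "\<lambda>s. of_real s ^ j"])
  show "Ck_on m UNIV (\<lambda>s::real. complex_of_real s ^ j)"
  proof (induction j)
    case (Suc j)
    show ?case
      unfolding power_Suc by (rule Ck_on_mult[OF open_UNIV Ck_on_linear[OF open_UNIV bounded_linear_of_real] Suc.IH])
  qed (simp add: Ck_on_const)
qed

text \<open>\<open>Y\<close> is the extension of degree 0 of an eigenfunction on the sphere. The locale is used for the conjugate of the
  given eigenfunction, and with \<open>k = 0\<close> for the constant \<open>1\<close>.\<close>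

locale spherical_harmonic =
  fixes k :: nat and Y :: "'a::euclidean_space \<Rightarrow> complex"
  assumes dim: "2 \<le> DIM('a)"
    and hom: "\<And>c x. c > 0 \<Longrightarrow> Y (c *\<^sub>R x) = Y x"
    and C2: "Ck_on 2 (UNIV - {0}) Y"
    and eig: "\<And>x. x \<noteq> 0 \<Longrightarrow> laplacian Y x = of_real (sphere_eigenvalue DIM('a) k / (norm x)\<^sup>2) * Y x"
begin

lemma measurable_Y [measurable]: "Y \<in> borel_measurable borel"
proof -
  have "(\<lambda>x. if x \<in> UNIV - {0} then Y x else Y x) \<in> borel_measurable borel"
    by (rule borel_measurable_continuous_on_if)
      (auto intro: Ck_on_imp_continuous_on[OF C2])
  then show ?thesis by simp
qed

lemma Y_sgn: "x \<noteq> 0 \<Longrightarrow> Y (sgn x) = Y x"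
  using hom[of "inverse (norm x)" x] by (simp add: sgn_div_norm)

text \<open>The bound includes the value at the origin, which is arbitrary.\<close>

lemma Y_bounded: obtains B where "B > 0" "\<And>x. norm (Y x) \<le> B"
proof -
  have "compact (Y ` sphere 0 1)"
    using Ck_on_imp_continuous_on[OF C2] by (intro compact_continuous_image) (auto intro: continuous_on_subset)
  then obtain B where B: "\<And>x. norm x = 1 \<Longrightarrow> norm (Y x) \<le> B"
    using compact_imp_bounded[of "Y ` sphere 0 1"] by (force simp: bounded_iff)
  have "norm (Y x) \<le> \<bar>B\<bar> + norm (Y 0) + 1" for x
  proof (cases "x = 0")
    case False
    then have "norm (Y x) \<le> B" using B[of "sgn x"] Y_sgn[of x] by (simp add: norm_sgn)
    then show ?thesis using norm_ge_zero[of "Y 0"] by linarith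
  qed simp
  then show ?thesis by (intro that[of "\<bar>B\<bar> + norm (Y 0) + 1"]) (auto intro: add_nonneg_pos)
qed

definition moment :: "nat \<Rightarrow> 'a \<Rightarrow> complex" where
  "moment j \<omega> = (LINT \<theta>|sphere_measure. (of_real (\<theta> \<bullet> \<omega>)) ^ j * Y \<theta>)"

text \<open>Green's identity for a radial cutoff times \<open>Y\<close> and the function \<open>(x \<bullet> \<omega>)\<^sup>j\<close>, whose Laplacian is
  \<open>j (j - 1) (x \<bullet> \<omega>)\<^sup>j\<^sup>-\<^sup>2\<close>. In polar coordinates both sides are products of a moment and a radial integral, and the radial
  integrals agree up to a factor by an integration by parts on the line. For \<open>j < 2\<close> the truncated index \<open>j - 2\<close> is multiplied by 0.\<close>

lemma moment_rec:
  assumes \<omega>: "norm \<omega> = 1"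
  shows "of_real (real j * (real j + DIM('a) - 2) - real k * (real k + DIM('a) - 2)) * moment j \<omega>
    = of_nat (j * (j - 1)) * moment (j - 2) \<omega>"
proof -
  define n where "n = DIM('a)"
  define \<mu> where "\<mu> = sphere_eigenvalue n k"
  define \<Phi> where "\<Phi> = (\<lambda>q. complex_of_real (bump q))"
  \<comment> \<open>The exponent of the radial weight on both sides of Green's identity.\<close>
  define c where "c = real j + real n - 2"
  have C\<Phi>: "Ck_on 2 UNIV \<Phi>" unfolding \<Phi>_def by (rule bump_C2)
  define \<Phi>' where "\<Phi>' = partial 1 \<Phi>"
  define \<Phi>'' where "\<Phi>'' = partial 1 \<Phi>'"
  have d1: "(\<Phi> has_vector_derivative \<Phi>' s) (at s)" and C\<Phi>': "Ck_on 1 UNIV \<Phi>'" for s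
    using real_Ck_SucD[of 1 \<Phi>] C\<Phi> unfolding \<Phi>'_def by (auto simp: numeral_2_eq_2)
  have d2: "(\<Phi>' has_vector_derivative \<Phi>'' s) (at s)" and C\<Phi>'': "Ck_on 0 UNIV \<Phi>''" for s
    using real_Ck_SucD[of 0 \<Phi>'] C\<Phi>' unfolding \<Phi>''_def by auto
  have z0: "\<Phi> q = 0" if "q \<notin> {-1..1}" for q
    using that bump_zero[of q] by (auto simp: \<Phi>_def)
  have z1: "\<Phi>' q = 0" if "q \<notin> {-1..1}" for q
    unfolding \<Phi>'_def by (rule partial_zero_outside[OF closed_atLeastAtMost z0 that])
  have z2: "\<Phi>'' q = 0" if "q \<notin> {-1..1}" for q
    unfolding \<Phi>''_def by (rule partial_zero_outside[OF closed_atLeastAtMost z1 that])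
  \<comment> \<open>The radial operator: the Laplacian of the cutoff times \<open>Y\<close> is \<open>L (ln \<bar>x\<bar>) / \<bar>x\<bar>\<^sup>2\<close> times \<open>Y\<close>.\<close>
  define L where "L = (\<lambda>q. \<Phi>'' q + (of_nat n - 2) * \<Phi>' q + of_real \<mu> * \<Phi> q)"
  define K where "K = cball (0::'a) (exp 1) - ball 0 (exp (-1))"
  have K: "compact K" unfolding K_def by (intro compact_diff) auto
  define u where "u = (\<lambda>x. if x = 0 then 0 else \<Phi> (ln (norm x)) * Y x)"
  have uK: "u x = 0" if "x \<notin> K" for x
  proof (cases "x = 0")
    case False
    define q where "q = ln (norm x)"
    have q: "norm x = exp q" using False by (simp add: q_def)
    have "q \<notin> {-1..1}" using that by (auto simp: K_def q not_less)
    then show ?thesis by (simp add: u_def z0 q_def)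
  qed (simp add: u_def)
  have K0: "K \<subseteq> UNIV - {0}" by (auto simp: K_def)
  have op: "open (UNIV - {0::'a})" by (intro open_delete open_UNIV)
  have Cu: "Ck_on 2 UNIV u"
  proof (rule Ck_on_UNIV_vanishing[OF op compact_imp_closed[OF K] K0 _ uK])
    show "Ck_on 2 (UNIV - {0}) u"
      by (rule Ck_on_cong[OF op _ Ck_on_mult[OF op Ck_on_ln_norm[OF C\<Phi>] C2]]) (simp add: u_def)
  qed
  have Lu: "laplacian u x = L (ln (norm x)) / of_real ((norm x)\<^sup>2) * Y x" if "x \<noteq> 0" for x
  proof -
    have "laplacian u x = laplacian (\<lambda>x. \<Phi> (ln (norm x)) * Y x) x"
      by (rule laplacian_cong_open[OF op]) (use that in \<open>auto simp: u_def\<close>)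
    also have "\<dots> = L (ln (norm x)) / of_real ((norm x)\<^sup>2) * Y x"
      by (subst laplacian_radial[where \<Phi>=\<Phi> and \<Phi>'=\<Phi>' and \<Phi>''=\<Phi>'', OF hom C2 d1 d2 that])
        (simp_all add: eig[OF that] L_def n_def \<mu>_def add_divide_distrib ring_distribs)
    finally show ?thesis .
  qed
  let ?\<phi> = "\<lambda>x. complex_of_real (\<omega> \<bullet> x) ^ j"
  note green = green_identity[OF Cu K uK Ck_on_plane_power[of 2 \<omega> j] open_UNIV subset_UNIV]
  define I where "I = (LINT q|lborel. of_real (exp (c * q)) * \<Phi> q)"
  have I: "I \<noteq> 0" "integrable lborel (\<lambda>q. of_real (exp (c * q)) * \<Phi> q)"
    using integral_exp_bump[of c] by (simp_all add: I_def \<Phi>_def of_real_mult[symmetric] del: of_real_mult)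
  have "(LINT x|lborel. laplacian u x * ?\<phi> x)
      = (LINT t|lborel. exp (- real DIM('a) * t) *\<^sub>R (L (- t) * of_real (exp (2 * t)) * of_real (exp (- t)) ^ j)) * moment j \<omega>"
    unfolding moment_def
  proof (rule polar_separated[OF green(1)])
    fix t :: real and \<theta> :: 'a assume th: "norm \<theta> = 1"
    then have nz: "exp (- t) *\<^sub>R \<theta> \<noteq> 0" by auto
    have Yt: "Y (exp (- t) *\<^sub>R \<theta>) = Y \<theta>" by (rule hom) simp
    have "exp (2 * t) = 1 / (exp (- t))\<^sup>2" by (simp add: exp_minus exp_double power_divide inverse_eq_divide)
    then have e2: "complex_of_real (exp (2 * t)) = 1 / (of_real (exp (- t)))\<^sup>2" by simp
    show "laplacian u (exp (- t) *\<^sub>R \<theta>) * ?\<phi> (exp (- t) *\<^sub>R \<theta>)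
      = L (- t) * of_real (exp (2 * t)) * of_real (exp (- t)) ^ j * (of_real (\<theta> \<bullet> \<omega>) ^ j * Y \<theta>)"
      using nz by (subst Lu) (simp_all add: e2 Yt th inner_commute power_mult_distrib)
  qed
  also have "(LINT t|lborel. exp (- real DIM('a) * t) *\<^sub>R (L (- t) * of_real (exp (2 * t)) * of_real (exp (- t)) ^ j))
      = (LINT t|lborel. of_real (exp (c * (- t))) * L (- t))"
  proof (rule Bochner_Integration.integral_cong[OF refl])
    fix t :: real
    have "exp (c * (- t)) = exp (- real DIM('a) * t) * exp (2 * t) * exp (- t) ^ j"
      by (simp add: c_def n_def exp_of_nat_mult[symmetric] exp_add[symmetric] algebra_simps)
    then show "exp (- real DIM('a) * t) *\<^sub>R (L (- t) * of_real (exp (2 * t)) * of_real (exp (- t)) ^ j) = of_real (exp (c * (- t))) * L (- t)"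
      by (simp add: scaleR_conv_of_real)
  qed
  also have "\<dots> = (LINT q|lborel. of_real (exp (c * q)) * L q)"
    by (rule lborel_integral_reflect)
  also have "\<dots> = of_real (\<mu> + c * real j) * I"
  proof -
    \<comment> \<open>The derivative of this function is the difference of the two integrands.\<close>
    define F where "F = (\<lambda>q. exp (of_real c * of_real q) * (\<Phi>' q + of_real (real n - 2 - c) * \<Phi> q))"
    have F1: "Ck_on 1 UNIV F"
      unfolding F_def by (intro Ck_on_mult Ck_on_exp Ck_on_add Ck_on_cmult C\<Phi>' Ck_on_mono[OF C\<Phi>] open_UNIV) auto
    have Fz: "F q = 0" if "q \<notin> {-1..1}" for q
      using z0[OF that] z1[OF that] by (simp add: F_def)
    have F': "partial 1 F q = of_real (exp (c * q)) * L q - of_real (\<mu> + c * real j) * (of_real (exp (c * q)) * \<Phi> q)" for q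
    proof -
      have "((\<lambda>q. exp (of_real c * of_real q)) has_vector_derivative of_real c * exp (complex_of_real c * of_real q)) (at q)"
        by (rule has_vector_derivative_real_field) (auto intro!: derivative_eq_intros)
      then have "(F has_vector_derivative (exp (of_real c * of_real q) * (\<Phi>'' q + of_real (real n - 2 - c) * \<Phi>' q)
          + of_real c * exp (of_real c * of_real q) * (\<Phi>' q + of_real (real n - 2 - c) * \<Phi> q))) (at q)"
        unfolding F_def by (intro has_vector_derivative_mult has_vector_derivative_add has_vector_derivative_mult_right d1 d2)
      from partial_eqI[OF this[unfolded has_vector_derivative_def], of 1]
      show ?thesis
        by (simp add: L_def c_def exp_of_real[symmetric] algebra_simps)
    qed
    have b1: "(1::real) \<in> Basis" by simp
    note F0 = integral_partial_zero[OF F1 compact_Icc Fz b1, unfolded F']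
    have i2: "integrable lborel (\<lambda>q. of_real (\<mu> + c * real j) * (of_real (exp (c * q)) * \<Phi> q))"
      using I(2) by (intro integrable_mult_right)
    have "integrable lborel (\<lambda>q. (of_real (exp (c * q)) * L q - of_real (\<mu> + c * real j) * (of_real (exp (c * q)) * \<Phi> q))
        + of_real (\<mu> + c * real j) * (of_real (exp (c * q)) * \<Phi> q))"
      by (intro Bochner_Integration.integrable_add i2 F0(1))
    then have i1: "integrable lborel (\<lambda>q. of_real (exp (c * q)) * L q)" by simp
    show ?thesis
      using F0(2) unfolding Bochner_Integration.integral_diff[OF i1 i2] I_def by simp
  qed
  also have "(LINT x|lborel. laplacian u x * ?\<phi> x) = (LINT x|lborel. u x * laplacian ?\<phi> x)"
    by (rule green(3))
  also have "\<dots> = (LINT t|lborel. exp (- real DIM('a) * t) *\<^sub>R (of_nat (j * (j - 1)) * \<Phi> (- t) * of_real (exp (- t)) ^ (j - 2))) * moment (j - 2) \<omega>"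
    unfolding moment_def
  proof (rule polar_separated[OF green(2)])
    fix t :: real and \<theta> :: 'a assume th: "norm \<theta> = 1"
    then have "exp (- t) *\<^sub>R \<theta> \<noteq> 0" by auto
    moreover have "Y (exp (- t) *\<^sub>R \<theta>) = Y \<theta>" by (rule hom) simp
    ultimately show "u (exp (- t) *\<^sub>R \<theta>) * laplacian ?\<phi> (exp (- t) *\<^sub>R \<theta>)
      = of_nat (j * (j - 1)) * \<Phi> (- t) * of_real (exp (- t)) ^ (j - 2) * (of_real (\<theta> \<bullet> \<omega>) ^ (j - 2) * Y \<theta>)"
      unfolding laplacian_plane_power[OF \<omega>] by (simp add: u_def th inner_commute power_mult_distrib)
  qed
  also have "(LINT t|lborel. exp (- real DIM('a) * t) *\<^sub>R (of_nat (j * (j - 1)) * \<Phi> (- t) * of_real (exp (- t)) ^ (j - 2)))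
      = (LINT t|lborel. of_nat (j * (j - 1)) * (of_real (exp (c * (- t))) * \<Phi> (- t)))"
  proof (rule Bochner_Integration.integral_cong[OF refl])
    fix t :: real
    show "exp (- real DIM('a) * t) *\<^sub>R (of_nat (j * (j - 1)) * \<Phi> (- t) * of_real (exp (- t)) ^ (j - 2))
        = of_nat (j * (j - 1)) * (of_real (exp (c * (- t))) * \<Phi> (- t))"
    proof (cases "j \<ge> 2")
      case True
      then have "exp (c * (- t)) = exp (- real DIM('a) * t) * exp (- t) ^ (j - 2)"
        by (simp add: c_def n_def exp_of_nat_mult[symmetric] exp_add[symmetric] algebra_simps of_nat_diff)
      then show ?thesis by (simp add: scaleR_conv_of_real)
    next
      case False
      then have "j = 0 \<or> j = 1" by auto
      then show ?thesis by auto
    qed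
  qed
  also have "\<dots> = of_nat (j * (j - 1)) * I"
    unfolding I_def integral_mult_right_zero by (subst lborel_integral_reflect) (rule refl)
  finally have "of_real (\<mu> + c * real j) * moment j \<omega> = of_nat (j * (j - 1)) * moment (j - 2) \<omega>"
    using I(1) by (simp add: mult.assoc)
  moreover have "\<mu> + c * real j = real j * (real j + DIM('a) - 2) - real k * (real k + DIM('a) - 2)"
    by (simp add: \<mu>_def sphere_eigenvalue_def c_def n_def algebra_simps)
  ultimately show ?thesis by simp
qed

section \<open>Gaussian transforms of solid harmonics\<close>

definition solid :: "'a \<Rightarrow> complex" where
  "solid x = of_real (norm x ^ k) * Y x"

lemma measurable_solid [measurable]: "solid \<in> borel_measurable borel"
  unfolding solid_def by measurable

definition gauss_coeff :: "'a \<Rightarrow> real \<Rightarrow> nat \<Rightarrow> complex" where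
  "gauss_coeff \<omega> s j = moment j \<omega> * of_real (radial_gauss (real DIM('a) + real j + real k) s) / fact j"

text \<open>Expand \<open>exp (t (x \<bullet> \<omega>))\<close> in powers of \<open>t\<close> and integrate term by term; in polar coordinates each term is a moment of \<open>Y\<close>
  times a radial Gaussian integral.\<close>

lemma gauss_coeff_series:
  assumes \<omega>: "norm \<omega> = 1" and s: "s > 0"
  shows "(\<lambda>j. gauss_coeff \<omega> s j * t ^ j) sums
    (LINT x|lborel. exp (t * of_real (x \<bullet> \<omega>)) * gauss s x * solid x)"
proof -
  let ?K = "\<lambda>x. exp (t * of_real (x \<bullet> \<omega>)) * gauss s x * solid x"
  let ?T = "\<lambda>j x. (t * of_real (x \<bullet> \<omega>)) ^ j / fact j"
  obtain B where B: "B > 0" "\<And>x. norm (Y x) \<le> B" using Y_bounded by blast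
  define f where "f = (\<lambda>j x. ?T j x * gauss s x * solid x)"
  define w where "w = (\<lambda>x::'a. B * fact k * exp ((norm t + 1) * norm x - s * (norm x)\<^sup>2))"
  have iw: "integrable lborel w"
    by (rule integrable_gaussian_bound[OF _ s, of w "B * fact k" "norm t + 1"]) (use B in \<open>auto simp: w_def\<close>)
  have nf: "(\<Sum>j<N. norm (?T j x)) * norm (gauss s x * solid x) \<le> w x" for x N
  proof -
    have "norm (t * of_real (x \<bullet> \<omega>)) \<le> norm t * norm x"
      unfolding norm_mult using Cauchy_Schwarz_ineq2[of x \<omega>] \<omega> by (intro mult_left_mono) auto
    then have "(\<Sum>j<N. norm (?T j x)) \<le> (\<Sum>j<N. (norm t * norm x) ^ j / fact j)"
      unfolding norm_divide norm_power norm_fact by (intro sum_mono divide_right_mono power_mono) auto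
    also have "\<dots> \<le> exp (norm t * norm x)" by (rule exp_Taylor_le) simp
    finally have 1: "(\<Sum>j<N. norm (?T j x)) \<le> exp (norm t * norm x)" .
    have 2: "norm (solid x) \<le> (fact k * exp (norm x)) * B"
      unfolding solid_def norm_mult by (intro mult_mono B) (auto simp: norm_power intro: power_le_fact_exp)
    have "(\<Sum>j<N. norm (?T j x)) * norm (gauss s x * solid x)
        \<le> exp (norm t * norm x) * (exp (- s * (norm x)\<^sup>2) * ((fact k * exp (norm x)) * B))"
      unfolding norm_mult by (intro mult_mono 1 2) (auto intro!: sum_nonneg simp: norm_mult)
    also have "\<dots> = w x"
      by (simp add: w_def exp_add[symmetric] algebra_simps)
    finally show ?thesis .
  qed
  have mf: "f j \<in> borel_measurable lborel" for j unfolding f_def by measurable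
  have "norm (f j x) \<le> norm (w x)" for j x
  proof -
    have "norm (f j x) = norm (?T j x) * norm (gauss s x * solid x)"
      by (simp only: f_def norm_mult mult.assoc)
    also have "\<dots> \<le> (\<Sum>j<Suc j. norm (?T j x)) * norm (gauss s x * solid x)"
      by (intro mult_right_mono member_le_sum) auto
    also have "\<dots> \<le> w x" by (rule nf)
    finally show ?thesis by simp
  qed
  then have if': "integrable lborel (f j)" for j
    by (intro Bochner_Integration.integrable_bound[OF iw mf]) auto
  have "(\<lambda>N. LINT x|lborel. (\<Sum>j<N. f j x)) \<longlonglongrightarrow>
    (LINT x|lborel. ?K x)"
  proof (rule integral_dominated_convergence[OF _ _ iw])
    show "AE x in lborel. (\<lambda>N. \<Sum>j<N. f j x) \<longlonglongrightarrow> ?K x"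
    proof (rule AE_I2)
      fix x
      have "(\<lambda>j. ?T j x) sums exp (t * of_real (x \<bullet> \<omega>))"
        using exp_converges[of "t * of_real (x \<bullet> \<omega>)"] by (simp add: scaleR_conv_of_real field_simps)
      from sums_mult2[OF this, of "gauss s x * solid x"]
      have "(\<lambda>j. f j x) sums (?K x)"
        by (simp add: f_def mult.assoc)
      then show "(\<lambda>N. \<Sum>j<N. f j x) \<longlonglongrightarrow> ?K x"
        by (simp add: sums_def)
    qed
    show "AE x in lborel. norm (\<Sum>j<N. f j x) \<le> w x" for N
    proof (rule AE_I2)
      fix x
      have "(\<Sum>j<N. f j x) = (\<Sum>j<N. ?T j x) * (gauss s x * solid x)"
        by (simp add: f_def sum_distrib_right mult.assoc)
      then have "norm (\<Sum>j<N. f j x) \<le> (\<Sum>j<N. norm (?T j x)) * norm (gauss s x * solid x)"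
        by (simp only: norm_mult) (intro mult_right_mono norm_sum, auto)
      also have "\<dots> \<le> w x" by (rule nf)
      finally show "norm (\<Sum>j<N. f j x) \<le> w x" .
    qed
  qed (use mf in \<open>auto intro!: borel_measurable_sum\<close>)
  moreover have "(LINT x|lborel. (\<Sum>j<N. f j x)) = (\<Sum>j<N. gauss_coeff \<omega> s j * t ^ j)" for N
  proof -
    have "(LINT x|lborel. f j x) = gauss_coeff \<omega> s j * t ^ j" for j
    proof -
      define p where "p = real DIM('a) + real j + real k"
      have p: "p > 0" by (simp add: p_def add_pos_nonneg)
      have "(LINT x|lborel. f j x) = (LINT \<tau>|lborel. exp (- real DIM('a) * \<tau>) *\<^sub>R
          (t ^ j / fact j * of_real (exp (- \<tau>) ^ j * exp (- s * exp (- 2 * \<tau>)) * exp (- \<tau>) ^ k))) * moment j \<omega>"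
        unfolding moment_def
      proof (rule polar_separated[OF if'])
        fix \<tau> :: real and \<theta> :: 'a assume th: "norm \<theta> = 1"
        have "Y (exp (- \<tau>) *\<^sub>R \<theta>) = Y \<theta>" by (rule hom) simp
        moreover have "(exp (- \<tau>))\<^sup>2 = exp (- 2 * \<tau>)" by (simp add: exp_double[symmetric])
        ultimately show "f j (exp (- \<tau>) *\<^sub>R \<theta>) = t ^ j / fact j * of_real (exp (- \<tau>) ^ j * exp (- s * exp (- 2 * \<tau>)) * exp (- \<tau>) ^ k)
            * (of_real (\<theta> \<bullet> \<omega>) ^ j * Y \<theta>)"
          by (simp add: f_def solid_def th power_mult_distrib)
      qed
      also have "(LINT \<tau>|lborel. exp (- real DIM('a) * \<tau>) *\<^sub>R
          (t ^ j / fact j * of_real (exp (- \<tau>) ^ j * exp (- s * exp (- 2 * \<tau>)) * exp (- \<tau>) ^ k)))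
        = (LINT \<tau>|lborel. t ^ j / fact j * of_real (exp (- p * \<tau> - s * exp (- 2 * \<tau>))))"
      proof (rule Bochner_Integration.integral_cong[OF refl])
        fix \<tau> :: real
        have "exp (- p * \<tau> - s * exp (- 2 * \<tau>)) = exp (- real DIM('a) * \<tau>) * (exp (- \<tau>) ^ j * exp (- s * exp (- 2 * \<tau>)) * exp (- \<tau>) ^ k)"
          by (simp add: p_def exp_of_nat_mult[symmetric] exp_add[symmetric] algebra_simps)
        then show "exp (- real DIM('a) * \<tau>) *\<^sub>R
          (t ^ j / fact j * of_real (exp (- \<tau>) ^ j * exp (- s * exp (- 2 * \<tau>)) * exp (- \<tau>) ^ k)) = t ^ j / fact j * of_real (exp (- p * \<tau> - s * exp (- 2 * \<tau>)))"
          by (simp add: scaleR_conv_of_real)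
      qed
      also have "\<dots> = t ^ j / fact j * of_real (radial_gauss p s)"
        using radial_gauss_integral[OF p s] by (simp add: has_bochner_integral_iff)
      finally show ?thesis by (simp add: gauss_coeff_def p_def)
    qed
    then show ?thesis by (simp add: Bochner_Integration.integral_sum[OF if'])
  qed
  ultimately show ?thesis by (simp add: sums_def)
qed

text \<open>The factor \<open>j + k + n - 2\<close> in the recursion of the moments cancels the one from the functional equation of \<open>\<Gamma>\<close>. It can vanish
  only for \<open>j = k = 0\<close>, where the claim is trivial.\<close>

lemma gauss_coeff_rec:
  assumes \<omega>: "norm \<omega> = 1" and s: "s > 0"
  shows "of_real (real j - real k) * gauss_coeff \<omega> s j = (if j < 2 then 0 else gauss_coeff \<omega> s (j - 2) / of_real (2 * s))"
proof -
  define d where "d = real j + real k + real DIM('a) - 2"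
  have mr: "of_real ((real j - real k) * d) * moment j \<omega> = of_nat (j * (j - 1)) * moment (j - 2) \<omega>"
    using moment_rec[OF \<omega>, of j] by (simp add: d_def algebra_simps)
  have n2: "real DIM('a) \<ge> 2" using dim by simp
  show ?thesis
  proof (cases "j < 2")
    case True
    then have "j * (j - 1) = 0" by (cases j) auto
    then have "of_real ((real j - real k) * d) * moment j \<omega> = 0" using mr by simp
    moreover have "real j - real k = 0" if "d = 0"
      using that n2 unfolding d_def by linarith
    ultimately have "of_real (real j - real k) * moment j \<omega> = 0" by auto
    then show ?thesis using True by (auto simp: gauss_coeff_def)
  next
    case False
    then have d: "d > 0" using n2 by (simp add: d_def)
    have d1: "d + 2 = real DIM('a) + real j + real k" and d2: "d = real DIM('a) + real (j - 2) + real k"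
      using False by (simp_all add: d_def)
    have R: "radial_gauss (real DIM('a) + real j + real k) s = d / (2 * s) * radial_gauss (real DIM('a) + real (j - 2) + real k) s"
      unfolding d1[symmetric] d2[symmetric] by (rule radial_gauss_rec[OF d s])
    obtain i where i: "j = Suc (Suc i)" using False by (metis add_2_eq_Suc le_Suc_ex not_less)
    have "of_real (real j - real k) * gauss_coeff \<omega> s j
        = (of_real ((real j - real k) * d) * moment j \<omega>) * of_real (radial_gauss (real DIM('a) + real (j - 2) + real k) s) / (of_real (2 * s) * fact j)"
      unfolding gauss_coeff_def R by simp
    also have "\<dots> = gauss_coeff \<omega> s (j - 2) / of_real (2 * s)"
    proof -
      obtain N where N: "N = complex_of_nat (j * (j - 1))" "N \<noteq> 0" using i by (auto simp del: of_nat_Suc of_nat_mult)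
      have fj: "(fact j :: complex) = N * fact (j - 2)" unfolding i N by (simp add: algebra_simps)
      show ?thesis unfolding mr N(1)[symmetric] gauss_coeff_def fj using N(2) by simp
    qed
    finally show ?thesis using False by simp
  qed
qed

text \<open>The recursion starts at \<open>j = k\<close>, where its left-hand side vanishes. That \<open>k\<close> is an integer is essential here.\<close>

lemma gauss_coeff_closed:
  assumes \<omega>: "norm \<omega> = 1" and s: "s > 0"
  shows "j < k \<Longrightarrow> gauss_coeff \<omega> s j = 0"
    and "gauss_coeff \<omega> s (k + 2 * i) = gauss_coeff \<omega> s k / (fact i * of_real (4 * s) ^ i)"
    and "gauss_coeff \<omega> s (k + 2 * i + 1) = 0"
proof -
  note rec = gauss_coeff_rec[OF \<omega> s]
  show low: "gauss_coeff \<omega> s j = 0" if "j < k" for j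
    using that
  proof (induction j rule: less_induct)
    case (less j)
    have "of_real (real j - real k) * gauss_coeff \<omega> s j = 0"
      using rec[of j] less.IH[of "j - 2"] less.prems by (cases "j < 2") auto
    with less.prems show ?case by (metis diff_0_eq_0 eq_iff_diff_eq_0 mult_eq_0_iff nat_neq_iff of_nat_eq_iff of_real_eq_0_iff)
  qed
  show "gauss_coeff \<omega> s (k + 2 * i) = gauss_coeff \<omega> s k / (fact i * of_real (4 * s) ^ i)"
  proof (induction i)
    case (Suc i)
    have "of_real (2 * (real i + 1)) * gauss_coeff \<omega> s (k + 2 * Suc i) = gauss_coeff \<omega> s (k + 2 * i) / of_real (2 * s)"
      using rec[of "k + 2 * Suc i"] by (simp add: algebra_simps)
    moreover have "2 * (real i + 1) \<noteq> 0" by simp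
    ultimately have "gauss_coeff \<omega> s (k + 2 * Suc i) = gauss_coeff \<omega> s (k + 2 * i) / of_real (2 * s) / of_real (2 * (real i + 1))"
      by (metis nonzero_mult_div_cancel_left of_real_eq_0_iff)
    with Suc show ?case by (simp add: field_simps)
  qed simp
  show "gauss_coeff \<omega> s (k + 2 * i + 1) = 0"
  proof (induction i)
    case 0
    then show ?case
      using rec[of "k + 1"] low[of "k - 1"] by (cases k) auto
  next
    case (Suc i)
    have "of_real (2 * real i + 3) * gauss_coeff \<omega> s (k + 2 * Suc i + 1) = gauss_coeff \<omega> s (k + 2 * i + 1) / of_real (2 * s)"
      using rec[of "k + 2 * Suc i + 1"] by (simp add: algebra_simps)
    moreover have "2 * real i + 3 \<noteq> 0" by linarith
    ultimately show ?case using Suc by (metis div_0 mult_eq_0_iff of_real_eq_0_iff)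
  qed
qed

text \<open>The nonzero coefficients are those of \<open>t\<^sup>k exp (t\<^sup>2 / (4 s))\<close>.\<close>

lemma gauss_kernel_closed:
  assumes \<omega>: "norm \<omega> = 1" and s: "s > 0"
  shows "(LINT x|lborel. exp (t * of_real (x \<bullet> \<omega>)) * gauss s x * solid x)
    = gauss_coeff \<omega> s k * t ^ k * exp (t\<^sup>2 / of_real (4 * s))"
proof -
  note cl = gauss_coeff_closed[OF \<omega> s]
  let ?a = "\<lambda>j. gauss_coeff \<omega> s j * t ^ j"
  have "?a j = 0" if "j \<notin> range (\<lambda>i. k + 2 * i)" for j
  proof (cases "j < k")
    case False
    then obtain m where m: "j = k + m" using le_Suc_ex not_less by blast
    have "odd m" using that m by (auto elim!: evenE)
    then obtain i where "m = 2 * i + 1" by (auto elim: oddE)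
    then show ?thesis using cl(3)[of i] m by simp
  qed (simp add: cl(1))
  moreover have "strict_mono (\<lambda>i::nat. k + 2 * i)" by (simp add: strict_mono_def)
  ultimately have "(\<lambda>i. ?a (k + 2 * i)) sums
      (LINT x|lborel. exp (t * of_real (x \<bullet> \<omega>)) * gauss s x * solid x)"
    using gauss_coeff_series[OF \<omega> s, of t] by (subst sums_mono_reindex) auto
  moreover have "(\<lambda>i. ?a (k + 2 * i)) sums (gauss_coeff \<omega> s k * t ^ k * exp (t\<^sup>2 / of_real (4 * s)))"
  proof -
    have "?a (k + 2 * i) = gauss_coeff \<omega> s k * t ^ k * ((t\<^sup>2 / of_real (4 * s)) ^ i /\<^sub>R fact i)" for i
    proof -
      have "t ^ (k + 2 * i) = t ^ k * (t\<^sup>2) ^ i" by (simp add: power_add power_mult)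
      then show ?thesis
        unfolding cl(2) by (simp add: power_divide scaleR_conv_of_real field_simps)
    qed
    then show ?thesis using sums_mult[OF exp_converges] by simp
  qed
  ultimately show ?thesis by (rule sums_unique2)
qed

text \<open>For \<open>t = 2 s \<tau>\<close> with real \<open>\<tau>\<close>, completing the square turns the integral of \<open>gauss_kernel_closed\<close> into the convolution of the
  solid harmonic with a Gaussian at \<open>\<tau> \<omega>\<close>. Divided by \<open>\<tau>\<^sup>k\<close>, this does not depend on \<open>\<tau>\<close>; its limit for \<open>\<tau> \<rightarrow> \<infinity>\<close>
  is \<open>Y \<omega>\<close> times the integral of the Gaussian, by homogeneity.\<close>

lemma gauss_coeff_value:
  assumes \<omega>: "norm \<omega> = 1" and s: "s > 0"
  shows "gauss_coeff \<omega> s k * of_real ((2 * s) ^ k) = of_real ((pi / s) powr (DIM('a) / 2)) * Y \<omega>"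
proof -
  obtain B where B: "B > 0" "\<And>x. norm (Y x) \<le> B" using Y_bounded by blast
  define f where "f = (\<lambda>N z. of_real (exp (- s * (norm z)\<^sup>2)) *
      (of_real (norm (\<omega> + (1 / real (Suc N)) *\<^sub>R z) ^ k) * Y (\<omega> + (1 / real (Suc N)) *\<^sub>R z)))"
  have mf: "f N \<in> borel_measurable lborel" for N unfolding f_def by measurable
  have const: "(LINT z|lborel. f N z) = gauss_coeff \<omega> s k * of_real ((2 * s) ^ k)" for N
  proof -
    define \<tau> where "\<tau> = real (Suc N)"
    have \<tau>: "\<tau> > 0" by (simp add: \<tau>_def)
    define t where "t = complex_of_real (2 * s * \<tau>)"
    let ?h = "\<lambda>x. of_real (exp (- s * (norm (x - \<tau> *\<^sub>R \<omega>))\<^sup>2)) * solid x"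
    have "exp (t * of_real (x \<bullet> \<omega>)) * gauss s x = of_real (exp (s * \<tau>\<^sup>2)) * of_real (exp (- s * (norm (x - \<tau> *\<^sub>R \<omega>))\<^sup>2))" for x
    proof -
      have eq: "(norm (x - \<tau> *\<^sub>R \<omega>))\<^sup>2 = (norm x)\<^sup>2 - 2 * \<tau> * (x \<bullet> \<omega>) + \<tau>\<^sup>2"
        using \<omega> unfolding power2_norm_eq_inner
        by (simp add: inner_diff_left inner_diff_right inner_commute power2_eq_square norm_eq_1 algebra_simps)
      have "exp (2 * s * \<tau> * (x \<bullet> \<omega>)) * exp (- s * (norm x)\<^sup>2) = exp (s * \<tau>\<^sup>2) * exp (- s * (norm (x - \<tau> *\<^sub>R \<omega>))\<^sup>2)"
        unfolding eq exp_add[symmetric] by (rule arg_cong[where f=exp]) (simp add: algebra_simps)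
      moreover have "exp (t * of_real (x \<bullet> \<omega>)) = of_real (exp (2 * s * \<tau> * (x \<bullet> \<omega>)))"
        by (simp add: t_def exp_of_real[symmetric])
      ultimately show ?thesis by (metis of_real_mult)
    qed
    then have "of_real (exp (s * \<tau>\<^sup>2)) * (LINT x|lborel. ?h x) = gauss_coeff \<omega> s k * t ^ k * exp (t\<^sup>2 / of_real (4 * s))"
      using gauss_kernel_closed[OF \<omega> s, of t] by (simp add: mult.assoc)
    moreover have "exp (t\<^sup>2 / of_real (4 * s)) = of_real (exp (s * \<tau>\<^sup>2))"
    proof -
      have "t\<^sup>2 / of_real (4 * s) = of_real ((2 * s * \<tau>)\<^sup>2 / (4 * s))" by (simp add: t_def)
      also have "(2 * s * \<tau>)\<^sup>2 / (4 * s) = s * \<tau>\<^sup>2" using s by (simp add: power2_eq_square)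
      finally show ?thesis by (simp only: exp_of_real)
    qed
    ultimately have 1: "(LINT x|lborel. ?h x) = gauss_coeff \<omega> s k * t ^ k" by simp
    have hz: "?h (\<tau> *\<^sub>R \<omega> + z) = of_real (\<tau> ^ k) * f N z" for z
    proof -
      have "\<tau> *\<^sub>R \<omega> + z = \<tau> *\<^sub>R (\<omega> + (1 / \<tau>) *\<^sub>R z)" using \<tau> by (simp add: scaleR_add_right)
      then have "solid (\<tau> *\<^sub>R \<omega> + z) = of_real (\<tau> ^ k) * (of_real (norm (\<omega> + (1 / \<tau>) *\<^sub>R z) ^ k) * Y (\<omega> + (1 / \<tau>) *\<^sub>R z))"
        using \<tau> hom[OF \<tau>] by (simp add: solid_def power_mult_distrib)
      then show ?thesis by (simp add: f_def \<tau>_def)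
    qed
    have "of_real (\<tau> ^ k) * (LINT z|lborel. f N z) = (LINT z|lborel. ?h (\<tau> *\<^sub>R \<omega> + z))"
      unfolding hz by simp
    also have "\<dots> = (LINT x|lborel. ?h x)"
      by (rule lborel_integral_translate) simp
    also note 1
    finally have "of_real (\<tau> ^ k) * (LINT z|lborel. f N z) = of_real (\<tau> ^ k) * (gauss_coeff \<omega> s k * of_real ((2 * s) ^ k))"
      by (simp add: t_def power_mult_distrib mult_ac)
    then show ?thesis using \<tau> by simp
  qed
  \<comment> \<open>The polynomial growth of the solid harmonic is absorbed by an exponential.\<close>
  define w where "w = (\<lambda>z::'a. (B * fact k * exp 1) * exp (1 * norm z - s * (norm z)\<^sup>2))"
  have iw: "integrable lborel w"
    by (rule integrable_gaussian_bound[OF _ s, of w "B * fact k * exp 1" 1]) (use B in \<open>auto simp: w_def\<close>)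
  have "(\<lambda>N. LINT z|lborel. f N z) \<longlonglongrightarrow> (LINT z|lborel. of_real (exp (- s * (norm (z::'a))\<^sup>2)) * Y \<omega>)"
  proof (rule integral_dominated_convergence[OF _ _ iw])
    have cY: "isCont Y \<omega>"
      using Ck_on_imp_continuous_on[OF C2] \<omega> by (auto simp: continuous_on_eq_continuous_at open_delete)
    show "AE z in lborel. (\<lambda>N. f N z) \<longlonglongrightarrow> of_real (exp (- s * (norm z)\<^sup>2)) * Y \<omega>"
    proof (rule AE_I2)
      fix z :: 'a
      have "(\<lambda>N. 1 / real (Suc N)) \<longlonglongrightarrow> 0"
        using LIMSEQ_inverse_real_of_nat by (simp add: inverse_eq_divide)
      then have "(\<lambda>N. \<omega> + (1 / real (Suc N)) *\<^sub>R z) \<longlonglongrightarrow> \<omega> + 0 *\<^sub>R z"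
        by (intro tendsto_intros)
      then have l: "(\<lambda>N. \<omega> + (1 / real (Suc N)) *\<^sub>R z) \<longlonglongrightarrow> \<omega>" by simp
      have "(\<lambda>N. f N z) \<longlonglongrightarrow> of_real (exp (- s * (norm z)\<^sup>2)) * (of_real (norm \<omega> ^ k) * Y \<omega>)"
        unfolding f_def
        by (intro tendsto_intros l isCont_tendsto_compose[OF cY])
      then show "(\<lambda>N. f N z) \<longlonglongrightarrow> of_real (exp (- s * (norm z)\<^sup>2)) * Y \<omega>" using \<omega> by simp
    qed
    show "AE z in lborel. norm (f N z) \<le> w z" for N
    proof (rule AE_I2)
      fix z :: 'a
      have "norm (\<omega> + (1 / real (Suc N)) *\<^sub>R z) \<le> 1 + norm z"
      proof -
        have "norm (\<omega> + (1 / real (Suc N)) *\<^sub>R z) \<le> norm \<omega> + norm ((1 / real (Suc N)) *\<^sub>R z)" by (rule norm_triangle_ineq)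
        also have "norm ((1 / real (Suc N)) *\<^sub>R z) \<le> 1 * norm z"
          unfolding norm_scaleR by (intro mult_right_mono) auto
        finally show ?thesis using \<omega> by simp
      qed
      then have "norm (\<omega> + (1 / real (Suc N)) *\<^sub>R z) ^ k \<le> (1 + norm z) ^ k" by (intro power_mono) auto
      also have "\<dots> \<le> fact k * exp (1 + norm z)" by (rule power_le_fact_exp) simp
      finally have "norm (f N z) \<le> exp (- s * (norm z)\<^sup>2) * ((fact k * exp (1 + norm z)) * B)"
        unfolding f_def norm_mult by (intro mult_mono B) (auto simp: norm_power intro: mult_nonneg_nonneg)
      also have "\<dots> = w z" by (simp add: w_def exp_add[symmetric] exp_diff exp_minus field_simps)
      finally show "norm (f N z) \<le> w z" .
    qed
  qed (use mf in \<open>auto intro: borel_measurable_times\<close>)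
  then have "gauss_coeff \<omega> s k * of_real ((2 * s) ^ k) = (LINT z|lborel. of_real (exp (- s * (norm (z::'a))\<^sup>2)) * Y \<omega>)"
    unfolding const by (simp add: LIMSEQ_const_iff)
  also have "\<dots> = of_real ((pi / s) powr (DIM('a) / 2)) * Y \<omega>"
    unfolding integral_mult_left_zero gaussian_integral[OF s] ..
  finally show ?thesis .
qed

text \<open>For \<open>c = \<plusminus> \<i>\<close> this is the classical identity for the Fourier transform of a Gaussian times a solid harmonic.\<close>

theorem bochner_hecke:
  assumes s: "s > 0" and \<xi>: "\<xi> \<noteq> 0"
  shows "(LINT x|lborel. exp (c * of_real (x \<bullet> \<xi>)) * gauss s x * solid x)
    = of_real ((pi / s) powr (DIM('a) / 2)) * (c / of_real (2 * s)) ^ k * exp (c\<^sup>2 * of_real ((norm \<xi>)\<^sup>2 / (4 * s))) * solid \<xi>"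
proof -
  define \<omega> where "\<omega> = sgn \<xi>"
  have \<omega>: "norm \<omega> = 1" using \<xi> by (simp add: \<omega>_def norm_sgn)
  define t where "t = c * of_real (norm \<xi>)"
  have "x \<bullet> \<xi> = norm \<xi> * (x \<bullet> \<omega>)" for x using \<xi> by (simp add: \<omega>_def sgn_div_norm)
  then have "(LINT x|lborel. exp (c * of_real (x \<bullet> \<xi>)) * gauss s x * solid x)
    = (LINT x|lborel. exp (t * of_real (x \<bullet> \<omega>)) * gauss s x * solid x)"
    by (simp add: t_def mult.assoc)
  also have "\<dots> = gauss_coeff \<omega> s k * t ^ k * exp (t\<^sup>2 / of_real (4 * s))"
    by (rule gauss_kernel_closed[OF \<omega> s])
  also have "gauss_coeff \<omega> s k = of_real ((pi / s) powr (DIM('a) / 2)) * Y \<xi> / of_real ((2 * s) ^ k)"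
    using gauss_coeff_value[OF \<omega> s] s Y_sgn[OF \<xi>] by (simp add: field_simps \<omega>_def)
  finally show ?thesis
    by (simp add: t_def solid_def power_mult_distrib power_divide field_simps)
qed

text \<open>Fubini's theorem and \<open>bochner_hecke\<close>.\<close>

lemma gaussian_pairing:
  assumes s: "s > 0" and c: "Re c = 0" "c\<^sup>2 = -1" and G: "integrable lborel G"
  shows "(LINT x|lborel. exp_transform c G x * (gauss s x * solid x))
    = of_real ((pi / s) powr (DIM('a) / 2)) * (c / of_real (2 * s)) ^ k *
      (LINT \<xi>|lborel. G \<xi> * (of_real (exp (- (norm \<xi>)\<^sup>2 / (4 * s))) * solid \<xi>))"
proof -
  obtain B where B: "B > 0" "\<And>x. norm (Y x) \<le> B" using Y_bounded by blast
  have [measurable]: "G \<in> borel_measurable borel" using G by auto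
  have nc: "norm (exp (c * of_real r)) = 1" for r using c(1) by (simp add: norm_exp_eq_Re)
  define \<phi> where "\<phi> = (\<lambda>x. gauss s x * solid x)"
  have m\<phi> [measurable]: "\<phi> \<in> borel_measurable borel" unfolding \<phi>_def by measurable
  have i\<phi>: "integrable lborel \<phi>"
  proof (rule integrable_gaussian_bound[OF m\<phi> s, of "fact k * B" 1])
    fix x
    have "norm (\<phi> x) \<le> exp (- s * (norm x)\<^sup>2) * ((fact k * exp (norm x)) * B)"
      unfolding \<phi>_def solid_def norm_mult by (intro mult_mono B) (auto simp: norm_power intro: power_le_fact_exp)
    then show "norm (\<phi> x) \<le> fact k * B * exp (1 * norm x - s * (norm x)\<^sup>2)"
      by (simp add: exp_diff exp_minus field_simps)
  qed
  have "integrable (lborel \<Otimes>\<^sub>M lborel) (\<lambda>(x, \<xi>). exp (c * of_real (\<xi> \<bullet> x)) * G \<xi> * \<phi> x)"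
  proof (rule lborel_pair.Fubini_integrable)
    show "integrable lborel (\<lambda>x. LINT \<xi>|lborel. norm (case (x, \<xi>) of (x, \<xi>) \<Rightarrow> exp (c * of_real (\<xi> \<bullet> x)) * G \<xi> * \<phi> x))"
      using i\<phi> by (simp add: norm_mult c(1))
    show "AE x in lborel. integrable lborel (\<lambda>\<xi>. case (x, \<xi>) of (x, \<xi>) \<Rightarrow> exp (c * of_real (\<xi> \<bullet> x)) * G \<xi> * \<phi> x)"
    proof (rule AE_I2)
      fix x
      have "integrable lborel (\<lambda>\<xi>. exp (c * of_real (\<xi> \<bullet> x)) * G \<xi>)"
        by (rule Bochner_Integration.integrable_bound[OF G]) (auto simp: norm_mult c(1))
      then show "integrable lborel (\<lambda>\<xi>. case (x, \<xi>) of (x, \<xi>) \<Rightarrow> exp (c * of_real (\<xi> \<bullet> x)) * G \<xi> * \<phi> x)"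
        by simp
    qed
  qed measurable
  from lborel_pair.Fubini_integral[OF this]
  have "(LINT x|lborel. LINT \<xi>|lborel. exp (c * of_real (\<xi> \<bullet> x)) * G \<xi> * \<phi> x)
      = (LINT \<xi>|lborel. LINT x|lborel. exp (c * of_real (\<xi> \<bullet> x)) * G \<xi> * \<phi> x)" by simp
  also have "(LINT x|lborel. LINT \<xi>|lborel. exp (c * of_real (\<xi> \<bullet> x)) * G \<xi> * \<phi> x)
      = (LINT x|lborel. exp_transform c G x * \<phi> x)" by simp
  also have "(LINT \<xi>|lborel. LINT x|lborel. exp (c * of_real (\<xi> \<bullet> x)) * G \<xi> * \<phi> x)
      = (LINT \<xi>|lborel. (of_real ((pi / s) powr (DIM('a) / 2)) * (c / of_real (2 * s)) ^ k) *
           (G \<xi> * (of_real (exp (- (norm \<xi>)\<^sup>2 / (4 * s))) * solid \<xi>)))"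
  proof (rule integral_cong_AE)
    show "AE \<xi> in lborel. (LINT x|lborel. exp (c * of_real (\<xi> \<bullet> x)) * G \<xi> * \<phi> x)
      = (of_real ((pi / s) powr (DIM('a) / 2)) * (c / of_real (2 * s)) ^ k) * (G \<xi> * (of_real (exp (- (norm \<xi>)\<^sup>2 / (4 * s))) * solid \<xi>))"
      using AE_lborel_nonzero
    proof eventually_elim
      case (elim \<xi>)
      have "(LINT x|lborel. exp (c * of_real (\<xi> \<bullet> x)) * G \<xi> * \<phi> x)
          = (LINT x|lborel. G \<xi> * (exp (c * of_real (x \<bullet> \<xi>)) * gauss s x * solid x))"
        by (rule Bochner_Integration.integral_cong) (auto simp: \<phi>_def inner_commute)
      also have "\<dots> = G \<xi> * (LINT x|lborel. exp (c * of_real (x \<bullet> \<xi>)) * gauss s x * solid x)"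
        by (rule integral_mult_right_zero)
      also have "exp (c\<^sup>2 * of_real ((norm \<xi>)\<^sup>2 / (4 * s))) = of_real (exp (- (norm \<xi>)\<^sup>2 / (4 * s)))"
        unfolding c(2) by (simp add: exp_of_real[symmetric])
      ultimately show ?case
        unfolding bochner_hecke[OF s elim, of c] by simp
    qed
  qed measurable
  finally show ?thesis by (simp add: \<phi>_def)
qed

end

section \<open>Pairings with homogeneous functions\<close>

text \<open>For fixed \<open>x\<close> the integral in \<open>u\<close> is a Gamma integral; the hypothesis on \<open>F\<close> is exactly what Fubini's theorem needs.\<close>

lemma gamma_subordination:
  fixes F :: "'a::euclidean_space \<Rightarrow> complex"
  assumes p: "Re p > 0" and \<kappa>: "\<kappa> > 0" and F: "F \<in> borel_measurable borel"
    and i: "integrable lborel (\<lambda>x. F x * npow (- 2 * p) x)"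
  shows "(LINT u|lborel. LINT x|lborel. F x * exp (p * of_real u - of_real (\<kappa> * (norm x)\<^sup>2 * exp u)))
    = Gamma p * exp (- p * of_real (ln \<kappa>)) * (LINT x|lborel. F x * npow (- 2 * p) x)"
proof -
  note [measurable] = F
  let ?f = "\<lambda>x u. F x * exp (p * of_real u - of_real (\<kappa> * (norm x)\<^sup>2 * exp u))"
  have ln': "ln (\<kappa> * (norm x)\<^sup>2) = ln \<kappa> + 2 * ln (norm x)" if "x \<noteq> 0" for x :: 'a
    using that \<kappa> by (simp add: ln_mult ln_realpow)
  have inner: "has_bochner_integral lborel (?f x) (Gamma p * exp (- p * of_real (ln \<kappa>)) * (F x * npow (- 2 * p) x))"
    if "x \<noteq> 0" for x
  proof -
    have "\<kappa> * (norm x)\<^sup>2 > 0" using that \<kappa> by simp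
    from has_bochner_integral_mult_right[OF Gamma_log_integral_scaled[OF p this], of "F x"]
    have "has_bochner_integral lborel (?f x) (F x * (Gamma p * exp (- p * of_real (ln (\<kappa> * (norm x)\<^sup>2)))))" by blast
    also have "exp (- p * of_real (ln (\<kappa> * (norm x)\<^sup>2))) = exp (- p * of_real (ln \<kappa>)) * npow (- 2 * p) x"
      unfolding ln'[OF that] exp_add[symmetric] by (simp add: algebra_simps)
    finally show ?thesis by (simp add: mult_ac)
  qed
  have norm_inner: "(LINT u|lborel. norm (?f x u)) = Gamma (Re p) * exp (- Re p * ln \<kappa>) * norm (F x * npow (- 2 * p) x)"
    if "x \<noteq> 0" for x
  proof -
    have k: "\<kappa> * (norm x)\<^sup>2 > 0" using that \<kappa> by simp
    have p': "Re (of_real (Re p)) > 0" using p by simp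
    have "norm (?f x u) = norm (F x) * Re (exp (of_real (Re p) * of_real u - of_real (\<kappa> * (norm x)\<^sup>2 * exp u)))" for u
    proof -
      have "exp (of_real (Re p) * of_real u - of_real (\<kappa> * (norm x)\<^sup>2 * exp u)) = complex_of_real (exp (Re p * u - \<kappa> * (norm x)\<^sup>2 * exp u))"
        by (simp add: exp_of_real[symmetric])
      then show ?thesis by (simp add: norm_mult norm_exp_eq_Re)
    qed
    then have "(LINT u|lborel. norm (?f x u)) = norm (F x) * (LINT u|lborel. Re (exp (of_real (Re p) * of_real u - of_real (\<kappa> * (norm x)\<^sup>2 * exp u))))"
      by simp
    also have "(LINT u|lborel. Re (exp (of_real (Re p) * of_real u - of_real (\<kappa> * (norm x)\<^sup>2 * exp u))))
        = Re (Gamma (of_real (Re p)) * exp (- of_real (Re p) * of_real (ln (\<kappa> * (norm x)\<^sup>2))))"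
      using has_bochner_integral_bounded_linear[OF bounded_linear_Re Gamma_log_integral_scaled[OF p' k]]
      by (simp only: has_bochner_integral_iff)
    also have "exp (- of_real (Re p) * of_real (ln (\<kappa> * (norm x)\<^sup>2))) = complex_of_real (exp (- Re p * ln \<kappa>) * exp (- 2 * Re p * ln (norm x)))"
      unfolding ln'[OF that] exp_add[symmetric] exp_of_real[symmetric] by (simp add: algebra_simps)
    also have "Re (Gamma (of_real (Re p)) * complex_of_real (exp (- Re p * ln \<kappa>) * exp (- 2 * Re p * ln (norm x))))
        = Gamma (Re p) * (exp (- Re p * ln \<kappa>) * exp (- 2 * Re p * ln (norm x)))"
      unfolding Gamma_complex_of_real by simp
    finally show ?thesis by (simp add: norm_mult norm_exp_eq_Re)
  qed
  have "integrable (lborel \<Otimes>\<^sub>M lborel) (\<lambda>(x, u). ?f x u)"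
  proof (rule lborel_pair.Fubini_integrable)
    have "integrable lborel (\<lambda>x. Gamma (Re p) * exp (- Re p * ln \<kappa>) * norm (F x * npow (- 2 * p) x))"
      using i by (intro integrable_mult_right integrable_norm)
    then show "integrable lborel (\<lambda>x. LINT u|lborel. norm (case (x, u) of (x, u) \<Rightarrow> ?f x u))"
    proof (rule integrable_cong_AE_imp)
      show "AE x in lborel. Gamma (Re p) * exp (- Re p * ln \<kappa>) * norm (F x * npow (- 2 * p) x) = (LINT u|lborel. norm (case (x, u) of (x, u) \<Rightarrow> ?f x u))"
        using AE_lborel_nonzero by eventually_elim (unfold prod.case, rule norm_inner[symmetric])
    qed measurable
    show "AE x in lborel. integrable lborel (\<lambda>u. case (x, u) of (x, u) \<Rightarrow> ?f x u)"
      using AE_lborel_nonzero by eventually_elim (use inner in \<open>auto simp: has_bochner_integral_iff\<close>)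
  qed measurable
  from lborel_pair.Fubini_integral[OF this]
  have "(LINT u|lborel. LINT x|lborel. ?f x u) = (LINT x|lborel. LINT u|lborel. ?f x u)" by simp
  also have "\<dots> = (LINT x|lborel. Gamma p * exp (- p * of_real (ln \<kappa>)) * (F x * npow (- 2 * p) x))"
  proof (rule integral_cong_AE)
    show "AE x in lborel. (LINT u|lborel. ?f x u) = Gamma p * exp (- p * of_real (ln \<kappa>)) * (F x * npow (- 2 * p) x)"
      using AE_lborel_nonzero by eventually_elim (use inner in \<open>auto simp only: has_bochner_integral_iff\<close>)
  qed measurable
  finally show ?thesis by simp
qed


text \<open>Up to normalization, the Fourier transform of \<open>\<bar>x\<bar>\<^sup>a Y\<close> is a multiple of \<open>\<bar>\<xi>\<bar>\<close> to the power \<open>- n - a\<close>, times \<open>Y\<close>, tested against an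
  integrable function \<open>G\<close>. Both sides arise from the Gaussian pairing with \<open>s = exp u\<close> by integrating over \<open>u\<close>
  against \<open>exp (p u)\<close> with \<open>p = (k - a) / 2\<close>: on the left this subordinates \<open>\<bar>x\<bar>\<^sup>a\<^sup>-\<^sup>k\<close> to Gaussians, on the right, where the Gaussians
  have the inverse width, it does so for the dual power. The bounds on \<open>a\<close> make both Gamma integrals converge.\<close>

theorem (in spherical_harmonic) hecke_riesz:
  fixes a c :: complex and G :: "'a \<Rightarrow> complex"
  defines "g \<equiv> exp_transform c G"
  assumes c: "Re c = 0" "c\<^sup>2 = -1" and G: "integrable lborel G"
    and a: "Re a < real k" "- (real k + real DIM('a)) < Re a"
    and ig: "integrable lborel (\<lambda>x. g x * (npow a x * Y x))"
    and iG: "integrable lborel (\<lambda>\<xi>. G \<xi> * (npow (- (a + of_nat DIM('a))) \<xi> * Y \<xi>))"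
  shows "Gamma ((of_nat k - a) / 2) * (LINT x|lborel. g x * (npow a x * Y x))
    = of_real (pi powr (DIM('a) / 2)) * (c / 2) ^ k * exp ((of_nat k + a + of_nat DIM('a)) * of_real (ln 2))
      * Gamma ((of_nat k + a + of_nat DIM('a)) / 2)
      * (LINT \<xi>|lborel. G \<xi> * (npow (- (a + of_nat DIM('a))) \<xi> * Y \<xi>))"
proof -
  define n where "n = DIM('a)"
  define p where "p = (of_nat k - a) / 2"
  define q where "q = (of_nat k + a + of_nat n) / 2"
  have p: "Re p > 0" and q: "Re q > 0" using a by (simp_all add: p_def q_def n_def)
  have p2: "- 2 * p = a - of_nat k" and q2: "- 2 * q = - (of_nat k + a + of_nat DIM('a))"
    by (simp_all add: p_def q_def n_def)
  have [measurable]: "G \<in> borel_measurable borel" using G by auto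
  have mg [measurable]: "g \<in> borel_measurable borel" unfolding g_def by measurable
  have sol: "solid x = npow (of_nat k) x * Y x" if "x \<noteq> 0" for x
  proof -
    have "npow (of_nat k) x = of_real (exp (real k * ln (norm x)))"
      by (simp add: exp_of_real[symmetric])
    also have "exp (real k * ln (norm x)) = norm x ^ k" using that by (simp add: exp_of_nat_mult)
    finally show ?thesis by (simp add: solid_def)
  qed
  have ae1: "AE x in lborel. g x * solid x * npow (- 2 * p) x = g x * (npow a x * Y x)"
    unfolding p2 using AE_lborel_nonzero by eventually_elim (simp add: sol exp_add[symmetric] algebra_simps)
  have ae2: "AE x in lborel. G x * solid x * npow (- 2 * q) x = G x * (npow (- (a + of_nat DIM('a))) x * Y x)"
    unfolding q2 using AE_lborel_nonzero by eventually_elim (simp add: sol exp_add[symmetric] algebra_simps)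
  have i1: "integrable lborel (\<lambda>x. g x * solid x * npow (- 2 * p) x)"
    by (rule integrable_cong_AE_imp[OF ig _ AE_symmetric[OF ae1]]) measurable
  have i2: "integrable lborel (\<lambda>x. G x * solid x * npow (- 2 * q) x)"
    by (rule integrable_cong_AE_imp[OF iG _ AE_symmetric[OF ae2]]) measurable
  define A where "A = of_real (pi powr (n / 2)) * (c / 2) ^ k"
  define h where "h = (\<lambda>u. LINT \<xi>|lborel. G \<xi> * solid \<xi> * exp (q * of_real u - of_real (1 / 4 * (norm \<xi>)\<^sup>2 * exp u)))"
  have "(LINT x|lborel. g x * solid x * exp (p * of_real u - of_real (1 * (norm x)\<^sup>2 * exp u))) = A * h (- u)" for u :: real
  proof -
    have "(LINT x|lborel. g x * solid x * exp (p * of_real u - of_real (1 * (norm x)\<^sup>2 * exp u)))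
        = (LINT x|lborel. exp (p * of_real u) * (g x * (of_real (exp (- exp u * (norm x)\<^sup>2)) * solid x)))"
      by (intro Bochner_Integration.integral_cong) (auto simp: exp_diff exp_of_real[symmetric] exp_minus field_simps)
    also have "\<dots> = exp (p * of_real u) * (of_real ((pi / exp u) powr (DIM('a) / 2)) * (c / of_real (2 * exp u)) ^ k *
      (LINT \<xi>|lborel. G \<xi> * (of_real (exp (- (norm \<xi>)\<^sup>2 / (4 * exp u))) * solid \<xi>)))"
      unfolding g_def by (subst gaussian_pairing[OF exp_gt_zero c G, symmetric]) simp
    also have "\<dots> = A * exp (- q * of_real u) * (LINT \<xi>|lborel. G \<xi> * (of_real (exp (- (norm \<xi>)\<^sup>2 / (4 * exp u))) * solid \<xi>))"
    proof -
      have 1: "complex_of_real ((pi / exp u) powr (DIM('a) / 2)) = of_real (pi powr (n / 2)) * exp (- (of_nat n / 2) * of_real u)"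
      proof -
        have "(pi / exp u) powr (DIM('a) / 2) = pi powr (n / 2) * exp (- (n / 2) * u)"
          unfolding powr_divide n_def by (simp add: powr_def exp_minus field_simps)
        moreover have "exp (- (of_nat n / 2) * complex_of_real u) = of_real (exp (- (n / 2) * u))"
          by (simp add: exp_of_real[symmetric])
        ultimately show ?thesis by simp
      qed
      have 2: "(c / of_real (2 * exp u)) ^ k = (c / 2) ^ k * exp (- of_nat k * of_real u)"
      proof -
        have "exp (- of_nat k * complex_of_real u) = 1 / (of_real (exp u)) ^ k"
          by (simp add: exp_minus exp_of_nat_mult exp_of_real inverse_eq_divide)
        then show ?thesis by (simp add: power_divide power_mult_distrib)
      qed
      have "exp (p * of_real u) * (exp (- (of_nat n / 2) * of_real u) * exp (- of_nat k * of_real u)) = exp (- q * of_real u)"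
        unfolding exp_add[symmetric] by (rule arg_cong[where f=exp]) (simp add: p_def q_def field_simps)
      then show ?thesis unfolding 1 2 A_def by (simp add: mult_ac)
    qed
    also have "\<dots> = A * (LINT \<xi>|lborel. exp (- q * of_real u) * (G \<xi> * (of_real (exp (- (norm \<xi>)\<^sup>2 / (4 * exp u))) * solid \<xi>)))"
      by simp
    also have "\<dots> = A * h (- u)"
    proof -
      have e: "exp (q * of_real (- u) - of_real (1 / 4 * (norm \<xi>)\<^sup>2 * exp (- u))) = exp (- q * of_real u) * complex_of_real (exp (- (norm \<xi>)\<^sup>2 / (4 * exp u)))"
        for \<xi> :: 'a
        unfolding exp_of_real[symmetric] exp_add[symmetric]
        by (rule arg_cong[where f=exp]) (simp add: exp_minus field_simps)
      show ?thesis
        unfolding h_def e by (simp only: mult_ac)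
    qed
    finally show ?thesis .
  qed
  then have "(LINT u|lborel. LINT x|lborel. g x * solid x * exp (p * of_real u - of_real (1 * (norm x)\<^sup>2 * exp u)))
      = (LINT u|lborel. A * h (- u))" by simp
  also have "\<dots> = A * (LINT u|lborel. h u)"
    unfolding integral_mult_right_zero lborel_integral_reflect ..
  also have "(LINT u|lborel. h u) = Gamma q * exp (- q * of_real (ln (1 / 4))) * (LINT x|lborel. G x * solid x * npow (- 2 * q) x)"
    unfolding h_def by (rule gamma_subordination[OF q _ _ i2]) auto
  also have "(LINT u|lborel. LINT x|lborel. g x * solid x * exp (p * of_real u - of_real (1 * (norm x)\<^sup>2 * exp u)))
      = Gamma p * exp (- p * of_real (ln 1)) * (LINT x|lborel. g x * solid x * npow (- 2 * p) x)"
    by (rule gamma_subordination[OF p _ _ i1]) auto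
  also have "(LINT x|lborel. g x * solid x * npow (- 2 * p) x) = (LINT x|lborel. g x * (npow a x * Y x))"
    by (rule integral_cong_AE[OF _ _ ae1]) measurable
  also have "(LINT x|lborel. G x * solid x * npow (- 2 * q) x) = (LINT x|lborel. G x * (npow (- (a + of_nat DIM('a))) x * Y x))"
    by (rule integral_cong_AE[OF _ _ ae2]) measurable
  also have "exp (- q * of_real (ln (1 / 4))) = exp ((of_nat k + a + of_nat DIM('a)) * of_real (ln 2))"
  proof -
    have "ln (1 / 4 :: real) = - 2 * ln 2"
      using ln_realpow[of "2::real" 2] by (simp add: ln_div)
    then show ?thesis by (simp add: q_def n_def)
  qed
  finally show ?thesis by (simp add: A_def p_def q_def n_def mult_ac)
qed

section \<open>Fourier transforms of test functions\<close>

definition test_on :: "'a::euclidean_space set \<Rightarrow> ('a \<Rightarrow> complex) \<Rightarrow> bool" where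
  "test_on K W \<longleftrightarrow> smooth_on UNIV W \<and> compact K \<and> (\<forall>x. x \<notin> K \<longrightarrow> W x = 0)"

lemma test_onD:
  assumes "test_on K W"
  shows "Ck_on k UNIV W" "compact K" "x \<notin> K \<Longrightarrow> W x = 0" "continuous_on UNIV W" "integrable lborel W" "W \<in> borel_measurable borel"
proof -
  show 1: "Ck_on k UNIV W" and 2: "compact K" and 3: "\<And>x. x \<notin> K \<Longrightarrow> W x = 0" for k
    using assms by (auto simp: test_on_def smooth_on_def)
  show 4: "continuous_on UNIV W" using 1[of 0] by simp
  show "integrable lborel W" by (rule continuous_compact_support_integrable[OF 4 2 3])
  show "W \<in> borel_measurable borel" by (rule borel_measurable_continuous_onI[OF 4])
qed

lemma test_on_laplacian:
  assumes "test_on K W"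
  shows "test_on K (laplacian W)"
proof -
  have "laplacian W x = 0" if "x \<notin> K" for x
    using test_onD(3)[OF assms] that by (intro laplacian_zero_outside[where f=W and K=K] compact_imp_closed test_onD(2)[OF assms]) auto
  then show ?thesis
    using Ck_on_laplacian[OF open_UNIV test_onD(1)[OF assms]] test_onD(2)[OF assms]
    by (auto simp: test_on_def smooth_on_def)
qed

lemma test_on_laplacian_iter: "test_on K W \<Longrightarrow> test_on K ((laplacian ^^ m) W)"
  by (induction m) (auto intro: test_on_laplacian)

lemma norm_exp_ii: "norm (exp (- \<i> * of_real r)) = 1" "norm (exp (\<i> * of_real r)) = 1"
  by (simp_all add: norm_exp_eq_Re)

lemma fourier_laplacian:
  assumes W: "test_on K W"
  shows "fourier (laplacian W) \<xi> = - of_real ((norm \<xi>)\<^sup>2) * fourier W \<xi>"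
proof -
  let ?\<phi> = "\<lambda>x. exp (- \<i> * of_real (\<xi> \<bullet> x))"
  have D: "((\<lambda>s::real. c * exp (- \<i> * of_real s)) has_vector_derivative (c * - \<i>) * exp (- \<i> * of_real s)) (at s)" for c s
    by (rule has_vector_derivative_real_field) (auto intro!: derivative_eq_intros)
  have L: "laplacian ?\<phi> x = - of_real ((norm \<xi>)\<^sup>2) * ?\<phi> x" for x
  proof -
    have "laplacian ?\<phi> x = of_real ((norm \<xi>)\<^sup>2) * ((- \<i> * - \<i>) * ?\<phi> x)"
      by (rule laplacian_plane[where g="\<lambda>s. exp (- \<i> * of_real s)" and g'="\<lambda>s. - \<i> * exp (- \<i> * of_real s)"
            and g''="\<lambda>s. (- \<i> * - \<i>) * exp (- \<i> * of_real s)"])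
        (use D[of 1] D[of "- \<i>"] in \<open>simp_all only: mult_1_left\<close>)
    then show ?thesis by simp
  qed
  have C: "Ck_on 2 UNIV ?\<phi>"
    by (rule Ck_on_inner[OF Ck_on_exp])
  note green = green_identity(3)[OF test_onD(1,2,3)[OF W] C open_UNIV subset_UNIV]
  have "(LINT x|lborel. ?\<phi> x * laplacian W x) = (LINT x|lborel. - of_real ((norm \<xi>)\<^sup>2) * (?\<phi> x * W x))"
    using green unfolding L by (simp add: mult_ac)
  then show ?thesis
    unfolding fourier_def integral_mult_right_zero by simp
qed

lemma fourier_laplacian_iter:
  assumes W: "test_on K W"
  shows "fourier ((laplacian ^^ m) W) \<xi> = (- of_real ((norm \<xi>)\<^sup>2)) ^ m * fourier W \<xi>"
  by (induction m) (simp_all add: fourier_laplacian[OF test_on_laplacian_iter[OF W]])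

lemma fourier_bounded:
  assumes W: "test_on K W"
  obtains C where "C \<ge> 0" "\<And>\<xi>. norm (fourier W \<xi>) \<le> C"
proof
  show "norm (fourier W \<xi>) \<le> norm (1 / complex_of_real (sqrt (2 * pi) ^ DIM('a))) * (LINT x|lborel. norm (W x))" for \<xi>
  proof -
    have "norm (LINT x|lborel. exp (- \<i> * of_real (\<xi> \<bullet> x)) * W x) \<le> (LINT x|lborel. norm (exp (- \<i> * of_real (\<xi> \<bullet> x)) * W x))"
      by (rule integral_norm_bound)
    also have "\<dots> = (LINT x|lborel. norm (W x))" unfolding norm_mult norm_exp_ii by simp
    finally show ?thesis unfolding fourier_def norm_mult by (rule mult_left_mono) simp
  qed
qed (simp add: integral_nonneg)

lemma measurable_fourier [measurable]:
  assumes [measurable]: "W \<in> borel_measurable borel"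
  shows "fourier W \<in> borel_measurable borel"
  unfolding fourier_def[abs_def] by measurable

text \<open>The transform decays faster than every power, because the transforms of all iterated Laplacians are bounded.\<close>

lemma integrable_fourier:
  fixes g :: "'a::euclidean_space \<Rightarrow> complex"
  assumes W: "test_on K W" and g: "g \<in> borel_measurable borel" and p: "p > - real DIM('a)" and B: "B \<ge> 0"
    and bound: "\<And>\<xi>. \<xi> \<noteq> 0 \<Longrightarrow> norm (g \<xi>) \<le> B * norm \<xi> powr p * norm (fourier W \<xi>)"
  shows "integrable lborel g"
proof -
  obtain m :: nat where m: "real m > (p + DIM('a)) / 2" using reals_Archimedean2 by blast
  obtain C0 where C0: "C0 \<ge> 0" "\<And>\<xi>. norm (fourier W \<xi>) \<le> C0" using fourier_bounded[OF W] by blast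
  obtain C1 where C1: "C1 \<ge> 0" "\<And>\<xi>. norm (fourier ((laplacian ^^ m) W) \<xi>) \<le> C1"
    using fourier_bounded[OF test_on_laplacian_iter[OF W]] by blast
  define C where "C = B * max C0 C1"
  show ?thesis
  proof (rule integrable_two_powers[OF g, of p "p - 2 * m" C])
    fix \<xi> :: 'a assume \<xi>: "\<xi> \<noteq> 0"
    have "norm (g \<xi>) \<le> B * norm \<xi> powr p * C0"
      by (intro order_trans[OF bound[OF \<xi>]] mult_left_mono C0) (use B in auto)
    also have "\<dots> \<le> B * norm \<xi> powr p * max C0 C1" using B by (intro mult_left_mono) auto
    finally show "norm (g \<xi>) \<le> C * norm \<xi> powr p" by (simp add: C_def mult_ac)
    have "norm \<xi> ^ (2 * m) * norm (fourier W \<xi>) \<le> C1"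
      using C1(2)[of \<xi>] unfolding fourier_laplacian_iter[OF W] by (simp add: norm_mult norm_power power_mult)
    then have "norm (fourier W \<xi>) \<le> C1 * norm \<xi> powr (- 2 * m)"
      using \<xi> by (simp add: powr_minus powr_realpow[symmetric] field_simps)
    then have "norm (g \<xi>) \<le> B * norm \<xi> powr p * (C1 * norm \<xi> powr (- 2 * m))"
      by (intro order_trans[OF bound[OF \<xi>]] mult_left_mono) (use B in auto)
    also have "\<dots> = B * C1 * norm \<xi> powr (p - 2 * m)" by (simp add: powr_diff powr_minus field_simps)
    also have "\<dots> \<le> C * norm \<xi> powr (p - 2 * m)" unfolding C_def using B by (intro mult_right_mono mult_left_mono) auto
    finally show "norm (g \<xi>) \<le> C * norm \<xi> powr (p - 2 * m)" .
  qed (use p m in auto)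
qed

lemma spherical_harmonic_const:
  assumes "2 \<le> DIM('a::euclidean_space)"
  shows "spherical_harmonic 0 (\<lambda>x::'a. 1)"
  by unfold_locales (use assms in \<open>auto simp: Ck_on_const laplacian_def frechet_derivative_const sphere_eigenvalue_def\<close>)

lemma npow_of_real: "x \<noteq> 0 \<Longrightarrow> npow (of_real p) x = complex_of_real (norm x powr p)"
  by (simp add: powr_def exp_of_real[symmetric])

lemma norm_npow: "x \<noteq> 0 \<Longrightarrow> norm (npow a x) = norm x powr (Re a)"
  by (simp add: powr_def norm_exp_eq_Re)

lemma integrable_test_off_origin:
  assumes W: "test_on K W" and K: "0 \<notin> K" and A: "continuous_on (UNIV - {0}) A"
  shows "integrable lborel (\<lambda>x::'a::euclidean_space. W x * A x)"
proof (rule continuous_compact_support_integrable[OF _ test_onD(2)[OF W]])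
  have "Ck_on 0 (UNIV - {0}) (\<lambda>x. W x * A x)"
    using A continuous_on_subset[OF test_onD(4)[OF W]] by (auto intro: continuous_on_mult)
  then have "Ck_on 0 UNIV (\<lambda>x. W x * A x)"
    by (intro Ck_on_UNIV_vanishing[of "UNIV - {0}" K 0] compact_imp_closed test_onD(2)[OF W])
      (use K test_onD(3)[OF W] in auto)
  then show "continuous_on UNIV (\<lambda>x. W x * A x)" by simp
qed (use test_onD(3)[OF W] in auto)

text \<open>Move the Laplacians to the power of \<open>\<bar>z\<bar>\<close>, which is smooth on the support; each of them lowers the exponent by 2.\<close>

lemma laplacian_power_norm:
  fixes p :: real
  assumes "2 \<le> DIM('a::euclidean_space)"
  shows "\<exists>c. \<forall>K V. test_on K V \<longrightarrow> (0::'a) \<notin> K \<longrightarrow>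
    (LINT z|lborel. (laplacian ^^ m) V z * npow (of_real p) z)
      = c * (LINT z|lborel. V z * npow (of_real (p - 2 * real m)) z)"
proof (induction m arbitrary: p)
  case 0
  show ?case by (intro exI[of _ 1]) simp
next
  case (Suc m)
  obtain c where c: "\<And>K V. test_on K V \<Longrightarrow> (0::'a) \<notin> K \<Longrightarrow>
    (LINT z|lborel. (laplacian ^^ m) V z * npow (of_real (p - 2)) z)
      = c * (LINT z|lborel. V z * npow (of_real (p - 2 - 2 * real m)) z)"
    using Suc.IH[of "p - 2"] by blast
  interpret spherical_harmonic 0 "\<lambda>x::'a. 1" by (rule spherical_harmonic_const[OF assms])
  have D: "((\<lambda>s::real. d * exp (of_real p * of_real s)) has_vector_derivative (d * of_real p) * exp (of_real p * of_real s)) (at s)" for d :: complex and s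
    by (rule has_vector_derivative_real_field) (auto intro!: derivative_eq_intros)
  define d where "d = (of_real p)\<^sup>2 + (of_nat DIM('a) - 2) * complex_of_real p"
  have L: "laplacian (\<lambda>z::'a. npow (of_real p) z) z = d * npow (of_real (p - 2)) z"
    if "z \<noteq> 0" for z
  proof -
    have "laplacian (\<lambda>z::'a. npow (of_real p) z * 1) z
      = ((of_real p * of_real p) * npow (of_real p) z + (of_nat DIM('a) - 2) * (of_real p * npow (of_real p) z)) / of_real ((norm z)\<^sup>2) * 1
        + npow (of_real p) z * laplacian (\<lambda>x::'a. 1) z"
      by (rule laplacian_radial[where \<Phi>="\<lambda>s. exp (of_real p * of_real s)" and \<Phi>'="\<lambda>s. of_real p * exp (of_real p * of_real s)"
            and \<Phi>''="\<lambda>s. (of_real p * of_real p) * exp (of_real p * of_real s)", OF hom C2 _ _ that])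
        (use D[of 1] D[of "of_real p"] in \<open>simp_all only: mult_1_left\<close>)
    moreover have "laplacian (\<lambda>x::'a. 1) z = 0" using eig[OF that] by (simp add: sphere_eigenvalue_def)
    moreover have "npow (of_real (p - 2)) z = npow (of_real p) z / of_real ((norm z)\<^sup>2)"
      unfolding npow_of_real[OF that] using that by (simp add: powr_diff)
    ultimately show ?thesis by (simp add: d_def power2_eq_square field_simps add_divide_distrib)
  qed
  have "(LINT z|lborel. (laplacian ^^ Suc m) V z * npow (of_real p) z)
      = (c * d) * (LINT z|lborel. V z * npow (of_real (p - 2 * real (Suc m))) z)"
    if V: "test_on K V" and K: "(0::'a) \<notin> K" for K V
  proof -
    note T = test_on_laplacian_iter[OF V, of m]
    have K': "K \<subseteq> UNIV - {0}" using K by auto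
    have "(LINT z|lborel. laplacian ((laplacian ^^ m) V) z * npow (of_real p) z)
        = (LINT z|lborel. (laplacian ^^ m) V z * laplacian (\<lambda>z. npow (of_real p) z) z)"
      by (rule green_identity(3)[OF test_onD(1,2,3)[OF T] _ _ K']) (auto intro!: Ck_on_ln_norm[OF Ck_on_exp] open_delete)
    also have "\<dots> = (LINT z|lborel. d * ((laplacian ^^ m) V z * npow (of_real (p - 2)) z))"
    proof (rule Bochner_Integration.integral_cong[OF refl])
      fix z
      show "(laplacian ^^ m) V z * laplacian (\<lambda>z. npow (of_real p) z) z = d * ((laplacian ^^ m) V z * npow (of_real (p - 2)) z)"
        using L[of z] test_onD(3)[OF T, of z] K by (cases "z = 0") auto
    qed
    finally show ?thesis using c[OF V K] by (simp add: algebra_simps)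
  qed
  then show ?case by blast
qed

section \<open>Decay of the fractional Laplacian\<close>

lemma Ck_on_translate: "Ck_on k UNIV W \<Longrightarrow> Ck_on k UNIV (\<lambda>z. W (x + z))"
proof (induction k arbitrary: W)
  case 0
  then show ?case by (auto intro!: continuous_on_compose2[of UNIV W] continuous_intros)
next
  case (Suc k)
  show ?case
  proof (rule Ck_on_SucI[OF open_UNIV])
    show "((\<lambda>z. W (x + z)) has_derivative frechet_derivative W (at (x + z))) (at z)" for z
    proof -
      have "((\<lambda>z. x + z) has_derivative (\<lambda>h. h)) (at z)" by (auto intro!: derivative_eq_intros)
      from has_derivative_compose[OF this has_derivative_frechet[of W "x + z"]] Suc.prems
      show ?thesis by simp
    qed
  qed (use Suc in auto)
qed

lemma test_on_translate:
  assumes "test_on K W"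
  shows "test_on ((\<lambda>y. y - x) ` K) (\<lambda>z. W (x + z))"
proof -
  have "W (x + z) = 0" if "z \<notin> (\<lambda>y. y - x) ` K" for z
    using that by (intro test_onD(3)[OF assms]) (auto simp: image_iff intro: bexI[of _ "x + z"])
  then show ?thesis
    using Ck_on_translate[OF test_onD(1)[OF assms]] test_onD(2)[OF assms]
    by (auto simp: test_on_def smooth_on_def intro!: compact_continuous_image continuous_intros)
qed

lemma fourier_translate:
  assumes "test_on K W"
  shows "fourier (\<lambda>z. W (x + z)) \<xi> = exp (\<i> * of_real (\<xi> \<bullet> x)) * fourier W \<xi>"
proof -
  note [measurable] = test_onD(6)[OF assms]
  have "(LINT z|lborel. exp (- \<i> * of_real (\<xi> \<bullet> z)) * W (x + z))
      = (LINT z|lborel. (\<lambda>y. exp (\<i> * of_real (\<xi> \<bullet> x)) * (exp (- \<i> * of_real (\<xi> \<bullet> y)) * W y)) (x + z))"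
  proof (rule Bochner_Integration.integral_cong[OF refl])
    fix z
    have "exp (- \<i> * of_real (\<xi> \<bullet> z)) = exp (\<i> * of_real (\<xi> \<bullet> x)) * exp (- \<i> * of_real (\<xi> \<bullet> (x + z)))"
      unfolding exp_add[symmetric] by (rule arg_cong[where f=exp]) (simp add: inner_add_right algebra_simps)
    then show "exp (- \<i> * of_real (\<xi> \<bullet> z)) * W (x + z) = (\<lambda>y. exp (\<i> * of_real (\<xi> \<bullet> x)) * (exp (- \<i> * of_real (\<xi> \<bullet> y)) * W y)) (x + z)"
      by simp
  qed
  also have "\<dots> = (LINT y|lborel. exp (\<i> * of_real (\<xi> \<bullet> x)) * (exp (- \<i> * of_real (\<xi> \<bullet> y)) * W y))"
    by (rule lborel_integral_translate) measurable
  finally show ?thesis by (simp add: fourier_def)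
qed

text \<open>This is the value at the origin of the fractional Laplacian of \<open>V\<close>, up to a constant. The symbol \<open>\<bar>\<xi>\<bar>\<close> to the power \<open>2\<gamma>\<close> grows, so
  \<open>hecke_riesz\<close> does not apply to it. Split off \<open>\<bar>\<xi>\<bar>\<close> to the power \<open>2m\<close>, which belongs to an iterated Laplacian of \<open>V\<close>, such
  that the remaining exponent \<open>a\<close> is negative but larger than \<open>- n\<close>, and move the Laplacians back at the end.\<close>

lemma fractional_symbol_pairing:
  assumes n: "2 \<le> DIM('a::euclidean_space)" and \<gamma>: "0 < \<gamma>" "\<gamma> < real DIM('a) / 2"
  shows "\<exists>C. \<forall>K V. test_on K V \<longrightarrow> (0::'a) \<notin> K \<longrightarrow>
    (LINT \<xi>|lborel. of_real (norm \<xi> powr (2 * \<gamma>)) * fourier V \<xi>)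
      = C * (LINT z|lborel. V z * exp (of_real (- (real DIM('a) + 2 * \<gamma>)) * of_real (ln (norm z))))"
proof -
  \<comment> \<open>The least integer above \<open>\<gamma>\<close>; then \<open>a \<ge> - 2\<close>, and for \<open>n = 2\<close> the inequality is strict because \<open>\<gamma> < 1\<close>.\<close>
  define m where "m = nat \<lfloor>\<gamma>\<rfloor> + 1"
  define a where "a = 2 * \<gamma> - 2 * real m"
  define p where "p = - (a + real DIM('a))"
  have m: "\<gamma> < real m" "real m \<le> \<gamma> + 1" using \<gamma> unfolding m_def by linarith+
  have a0: "a < 0" using m by (simp add: a_def)
  have an: "- real DIM('a) < a"
  proof (cases "DIM('a) = 2")
    case True
    then have "\<gamma> < 1" using \<gamma> by simp
    then have "m = 1" using \<gamma>(1) by (simp add: m_def floor_eq_iff)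
    then show ?thesis using True \<gamma> by (simp add: a_def)
  next
    case False
    then have "real DIM('a) > 2" using n by simp
    then show ?thesis using m by (simp add: a_def)
  qed
  interpret spherical_harmonic 0 "\<lambda>x::'a. 1" by (rule spherical_harmonic_const[OF n])
  obtain c where c: "\<And>K V. test_on K V \<Longrightarrow> (0::'a) \<notin> K \<Longrightarrow>
    (LINT z|lborel. (laplacian ^^ m) V z * npow (of_real p) z)
      = c * (LINT z|lborel. V z * npow (of_real (p - 2 * real m)) z)"
    using laplacian_power_norm[OF n, of m p] by blast
  define S where "S = complex_of_real (sqrt (2 * pi) ^ DIM('a))"
  have S0: "S \<noteq> 0" by (simp add: S_def)
  define A where "A = complex_of_real (pi powr (DIM('a) / 2)) * exp ((of_real a + of_nat DIM('a)) * of_real (ln 2))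
      * Gamma ((of_real a + of_nat DIM('a)) / 2)"
  have G0: "Gamma (- complex_of_real a / 2) \<noteq> 0"
  proof -
    have "- a / 2 > 0" using a0 by simp
    then have "Gamma (- a / 2) \<noteq> 0" using Gamma_real_pos[of "- a / 2"] by linarith
    moreover have "Gamma (- complex_of_real a / 2) = of_real (Gamma (- a / 2))"
      using Gamma_complex_of_real[of "- a / 2"] by simp
    ultimately show ?thesis by simp
  qed
  have "(LINT \<xi>|lborel. of_real (norm \<xi> powr (2 * \<gamma>)) * fourier V \<xi>)
      = (A * c / (Gamma (- complex_of_real a / 2) * S * (-1) ^ m)) * (LINT z|lborel. V z * exp (of_real (- (real DIM('a) + 2 * \<gamma>)) * of_real (ln (norm z))))"
    if V: "test_on K V" and K: "(0::'a) \<notin> K" for K V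
  proof -
    define U where "U = (laplacian ^^ m) V"
    have U: "test_on K U" unfolding U_def by (rule test_on_laplacian_iter[OF V])
    note [measurable] = test_onD(6)[OF U] test_onD(6)[OF V]
    have gU: "exp_transform (- \<i>) U x = S * fourier U x" for x
      using S0 by (simp add: fourier_def S_def inner_commute)
    have "Gamma ((of_nat 0 - complex_of_real a) / 2) * (LINT x|lborel. exp_transform (- \<i>) U x * (npow (of_real a) x * 1))
      = of_real (pi powr (DIM('a) / 2)) * (- \<i> / 2) ^ 0 * exp ((of_nat 0 + of_real a + of_nat DIM('a)) * of_real (ln 2))
      * Gamma ((of_nat 0 + of_real a + of_nat DIM('a)) / 2)
      * (LINT \<xi>|lborel. U \<xi> * (npow (- (of_real a + of_nat DIM('a))) \<xi> * 1))"
    proof (rule hecke_riesz)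
      show "integrable lborel (\<lambda>x. exp_transform (- \<i>) U x * (npow (of_real a) x * 1))"
        unfolding gU
        by (rule integrable_fourier[OF U _ an, of _ "norm S"]) (simp_all add: norm_mult powr_def)
      show "integrable lborel (\<lambda>\<xi>. U \<xi> * (npow (- (of_real a + of_nat DIM('a))) \<xi> * 1))"
        by (rule integrable_test_off_origin[OF U K]) (auto intro!: continuous_intros)
      show "integrable lborel U" by (rule test_onD(5)[OF U])
    qed (use a0 an in auto)
    then have "Gamma (- complex_of_real a / 2) * (LINT x|lborel. S * (fourier U x * npow (of_real a) x))
      = A * (LINT \<xi>|lborel. U \<xi> * npow (of_real p) \<xi>)"
      unfolding gU A_def p_def by (simp add: mult.assoc)
    also have "(LINT \<xi>|lborel. U \<xi> * npow (of_real p) \<xi>)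
        = c * (LINT z|lborel. V z * exp (of_real (- (real DIM('a) + 2 * \<gamma>)) * of_real (ln (norm z))))"
    proof -
      have "p - 2 * real m = - (real DIM('a) + 2 * \<gamma>)" by (simp add: p_def a_def)
      with c[OF V K] show ?thesis by (simp only: U_def)
    qed
    also have "(LINT x|lborel. S * (fourier U x * npow (of_real a) x))
        = (LINT x|lborel. (S * (-1) ^ m) * (of_real (norm x powr (2 * \<gamma>)) * fourier V x))"
    proof (rule integral_cong_AE)
      show "AE x in lborel. S * (fourier U x * npow (of_real a) x) = (S * (-1) ^ m) * (of_real (norm x powr (2 * \<gamma>)) * fourier V x)"
        using AE_lborel_nonzero
      proof eventually_elim
        case (elim x)
        have "norm x powr (2 * \<gamma>) = norm x ^ (2 * m) * norm x powr a"
          using elim by (simp add: powr_realpow[symmetric] powr_add[symmetric] a_def)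
        moreover have "(- of_real ((norm x)\<^sup>2)) ^ m = ((-1) ^ m * of_real (norm x ^ (2 * m)) :: complex)"
          by (subst power_minus) (simp add: power_mult)
        ultimately show ?case
          unfolding U_def fourier_laplacian_iter[OF V] npow_of_real[OF elim] by simp
      qed
    qed measurable
    finally have "Gamma (- complex_of_real a / 2) * S * (-1) ^ m * (LINT x|lborel. of_real (norm x powr (2 * \<gamma>)) * fourier V x)
      = A * c * (LINT z|lborel. V z * exp (of_real (- (real DIM('a) + 2 * \<gamma>)) * of_real (ln (norm z))))"
      by (simp add: mult.assoc)
    then show ?thesis using G0 S0 by (simp add: field_simps)
  qed
  then show ?thesis by blast
qed

lemma measurable_fractional_laplacian:
  assumes W: "test_on K W"
  shows "fractional_laplacian \<gamma> W \<in> borel_measurable borel"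
proof -
  note [measurable] = test_onD(6)[OF W]
  show ?thesis unfolding fractional_laplacian_def inverse_fourier_def[abs_def] by measurable
qed

lemma integrable_symbol_fourier:
  assumes W: "test_on K W" and \<gamma>: "0 < \<gamma>"
  shows "integrable lborel (\<lambda>\<xi>::'a::euclidean_space. of_real (norm \<xi> powr (2 * \<gamma>)) * fourier W \<xi>)"
proof -
  note [measurable] = test_onD(6)[OF W]
  have "- real DIM('a) < 2 * \<gamma>" using \<gamma> by (smt (verit) of_nat_0_le_iff)
  then show ?thesis
    by (intro integrable_fourier[OF W, of _ "2 * \<gamma>" 1]) (simp_all add: norm_mult)
qed

text \<open>For \<open>x\<close> away from the support, translate \<open>W\<close> by \<open>x\<close> and use \<open>fractional_symbol_pairing\<close>; on the support of the translate,
  \<open>\<bar>z\<bar>\<close> is at least \<open>\<bar>x\<bar> / 2\<close>.\<close>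

lemma fractional_laplacian_decay:
  fixes W :: "'a::euclidean_space \<Rightarrow> complex"
  assumes n: "2 \<le> DIM('a)" and \<gamma>: "0 < \<gamma>" "\<gamma> < real DIM('a) / 2" and W: "test_on K W"
  obtains C where "\<And>x. norm (fractional_laplacian \<gamma> W x) \<le> C"
    "\<And>x. x \<noteq> 0 \<Longrightarrow> norm (fractional_laplacian \<gamma> W x) \<le> C * norm x powr (- (real DIM('a) + 2 * \<gamma>))"
proof -
  let ?f = "fractional_laplacian \<gamma> W"
  note [measurable] = test_onD(6)[OF W]
  define d where "d = real DIM('a) + 2 * \<gamma>"
  have d: "d > 0" using \<gamma> by (simp add: d_def add_nonneg_pos)
  define S where "S = complex_of_real (sqrt (2 * pi) ^ DIM('a))"
  obtain C where C: "\<And>K V. test_on K V \<Longrightarrow> (0::'a) \<notin> K \<Longrightarrow>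
    (LINT \<xi>|lborel. of_real (norm \<xi> powr (2 * \<gamma>)) * fourier V \<xi>)
      = C * (LINT z|lborel. V z * npow (of_real (- d)) z)"
    using fractional_symbol_pairing[OF n \<gamma>] unfolding d_def by blast
  obtain R where R: "R > 0" "\<And>x. x \<in> K \<Longrightarrow> norm x \<le> R"
    using compact_imp_bounded[OF test_onD(2)[OF W]] by (auto simp: bounded_pos)
  have f: "?f x = 1 / S * (LINT \<xi>|lborel. exp (\<i> * of_real (\<xi> \<bullet> x)) * (of_real (norm \<xi> powr (2 * \<gamma>)) * fourier W \<xi>))" for x
    by (simp add: fractional_laplacian_def inverse_fourier_def S_def inner_commute)
  define M1 where "M1 = norm (1 / S) * (LINT \<xi>|lborel. norm (of_real (norm \<xi> powr (2 * \<gamma>)) * fourier W \<xi>))"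
  define M2 where "M2 = norm (1 / S) * (norm C * ((1 / 2) powr (- d) * (LINT z|lborel. norm (W z))))"
  have M1: "norm (?f x) \<le> M1" for x
  proof -
    have "norm (LINT \<xi>|lborel. exp (\<i> * of_real (\<xi> \<bullet> x)) * (of_real (norm \<xi> powr (2 * \<gamma>)) * fourier W \<xi>))
      \<le> (LINT \<xi>|lborel. norm (exp (\<i> * of_real (\<xi> \<bullet> x)) * (of_real (norm \<xi> powr (2 * \<gamma>)) * fourier W \<xi>)))"
      by (rule integral_norm_bound)
    also have "\<dots> = (LINT \<xi>|lborel. norm (of_real (norm \<xi> powr (2 * \<gamma>)) * fourier W \<xi>))"
      unfolding norm_mult[of "exp _"] norm_exp_ii by simp
    finally show ?thesis unfolding f M1_def norm_mult[of "1 / S"] by (rule mult_left_mono) simp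
  qed
  have M2: "norm (?f x) \<le> M2 * norm x powr (- d)" if x: "norm x \<ge> 2 * R" for x
  proof -
    have xK: "x \<notin> K" using R x by fastforce
    have "(LINT \<xi>|lborel. exp (\<i> * of_real (\<xi> \<bullet> x)) * (of_real (norm \<xi> powr (2 * \<gamma>)) * fourier W \<xi>))
        = (LINT \<xi>|lborel. of_real (norm \<xi> powr (2 * \<gamma>)) * fourier (\<lambda>z. W (x + z)) \<xi>)"
      unfolding fourier_translate[OF W] by (simp add: mult_ac)
    also have "\<dots> = C * (LINT z|lborel. W (x + z) * npow (of_real (- d)) z)"
      by (rule C[OF test_on_translate[OF W]]) (use xK in auto)
    finally have fx: "?f x = 1 / S * (C * (LINT z|lborel. W (x + z) * npow (of_real (- d)) z))"
      unfolding f by simp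
    have iW: "integrable lborel (\<lambda>z. W (x + z))" by (rule test_onD(5)[OF test_on_translate[OF W]])
    have iWe: "integrable lborel (\<lambda>z. W (x + z) * npow (of_real (- d)) z)"
      by (rule integrable_test_off_origin[OF test_on_translate[OF W]]) (use xK in \<open>auto intro!: continuous_intros\<close>)
    have pw: "norm (W (x + z) * npow (of_real (- d)) z) \<le> (norm x / 2) powr (- d) * norm (W (x + z))" for z
    proof (cases "W (x + z) = 0")
      case False
      then have "x + z \<in> K" using test_onD(3)[OF W] by blast
      then have "norm (x + z) \<le> R" by (rule R)
      moreover have "norm x \<le> norm (x + z) + norm z" using norm_triangle_ineq4[of "x + z" z] by simp
      ultimately have z: "norm x / 2 \<le> norm z" using x by simp
      have x0: "norm x / 2 > 0" using x R by auto
      then have "z \<noteq> 0" using z by auto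
      have "norm z powr (- d) \<le> (norm x / 2) powr (- d)"
        using z x0 d by (intro powr_mono2') auto
      then show ?thesis
        unfolding norm_mult norm_npow[OF \<open>z \<noteq> 0\<close>] by (simp add: mult.commute mult_left_mono)
    qed simp
    have "norm (LINT z|lborel. W (x + z) * npow (of_real (- d)) z)
        \<le> (LINT z|lborel. norm (W (x + z) * npow (of_real (- d)) z))"
      by (rule integral_norm_bound)
    also have "\<dots> \<le> (LINT z|lborel. (norm x / 2) powr (- d) * norm (W (x + z)))"
      by (rule integral_mono[OF _ _ pw]) (use iW iWe in auto)
    also have "\<dots> = (norm x / 2) powr (- d) * (LINT z|lborel. norm (W z))"
      using lborel_integral_translate[of "\<lambda>z. norm (W z)" x] by simp
    also have "(norm x / 2) powr (- d) = (1 / 2) powr (- d) * norm x powr (- d)"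
      using powr_mult[of "1/2" "norm x" "- d"] by simp
    finally have "norm (LINT z|lborel. W (x + z) * npow (of_real (- d)) z) \<le> (1 / 2) powr (- d) * norm x powr (- d) * (LINT z|lborel. norm (W z))" .
    then have "norm (?f x) \<le> norm (1 / S) * (norm C * ((1 / 2) powr (- d) * norm x powr (- d) * (LINT z|lborel. norm (W z))))"
      unfolding fx norm_mult by (intro mult_left_mono) auto
    then show ?thesis by (simp add: M2_def mult_ac)
  qed
  have M1': "M1 \<ge> 0" using M1[of 0] norm_ge_zero[of "?f 0"] by linarith
  have M2': "M2 \<ge> 0" by (simp add: M2_def)
  define B where "B = M1 + M2 + M1 * (2 * R) powr d"
  show ?thesis
  proof
    show "norm (?f x) \<le> B" for x
      using M1[of x] M2' M1' by (simp add: B_def add_increasing2)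
    fix x :: 'a assume x: "x \<noteq> 0"
    show "norm (?f x) \<le> B * norm x powr (- (real DIM('a) + 2 * \<gamma>))"
      unfolding d_def[symmetric]
    proof (cases "norm x \<ge> 2 * R")
      case True
      have "M2 * norm x powr (- d) \<le> B * norm x powr (- d)"
        using M1' by (intro mult_right_mono) (auto simp: B_def)
      with M2[OF True] show "norm (?f x) \<le> B * norm x powr (- d)" by linarith
    next
      case False
      have "norm x powr d \<le> (2 * R) powr d" using False d by (intro powr_mono2) auto
      then have "1 \<le> (2 * R) powr d * norm x powr (- d)"
        using x by (simp add: powr_minus field_simps)
      then have "M1 * 1 \<le> M1 * ((2 * R) powr d * norm x powr (- d))" using M1' by (intro mult_left_mono)
      also have "\<dots> \<le> B * norm x powr (- d)"
        unfolding mult.assoc[symmetric] using M1' M2' by (intro mult_right_mono) (auto simp: B_def)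
      finally show "norm (?f x) \<le> B * norm x powr (- d)" using M1[of x] by linarith
    qed
  qed
qed


section \<open>The Fourier multiplier\<close>

lemma laplacian_cnj:
  assumes "open U" "x \<in> U" "Ck_on 2 U f"
  shows "laplacian (\<lambda>x. cnj (f x)) x = cnj (laplacian f x)"
proof -
  have "laplacian (\<lambda>x. cnj (f x)) x = (\<Sum>i\<in>Basis. cnj (frechet_derivative (partial i f) (at x) i))"
    by (rule laplacian_eqI[OF assms(1,2), of _ "\<lambda>y h. cnj (frechet_derivative f (at y) h)"])
      (use assms in \<open>auto intro!: bounded_linear.has_derivative[OF bounded_linear_cnj] Ck_on_2_D[OF assms(3)]\<close>)
  then show ?thesis by (simp add: laplacian_def)
qed

text \<open>The eigenvalue equation extends from the sphere to the punctured space by homogeneity.\<close>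

lemma spherical_harmonic_cnj_eigenfunction:
  fixes E :: "'a::euclidean_space \<Rightarrow> complex"
  assumes n: "2 \<le> DIM('a)" and E: "is_sphere_eigenfunction (sphere_eigenvalue DIM('a) k) E"
  shows "spherical_harmonic k (\<lambda>x. cnj (E (sgn x)))"
proof
  let ?A = "\<lambda>x. E (sgn x)"
  have op: "open (UNIV - {0::'a})" by (intro open_delete open_UNIV)
  have A2: "Ck_on 2 (UNIV - {0}) ?A"
    using E by (auto simp: is_sphere_eigenfunction_def smooth_on_sphere_def smooth_on_def)
  have hom: "?A (c *\<^sub>R x) = ?A x" if "c > 0" for c x
    using that by (simp add: sgn_scaleR)
  show "2 \<le> DIM('a)" by (rule n)
  show "cnj (?A (c *\<^sub>R x)) = cnj (?A x)" if "c > 0" for c x using hom[OF that, of x] by simp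
  show "Ck_on 2 (UNIV - {0}) (\<lambda>x. cnj (?A x))" by (rule Ck_on_cnj[OF op A2])
  fix x :: 'a assume x: "x \<noteq> 0"
  have "laplacian ?A x = laplacian ?A (norm x *\<^sub>R sgn x)" using x by (simp add: sgn_div_norm)
  also have "\<dots> = laplacian ?A (sgn x) / of_real ((norm x)\<^sup>2)"
    by (rule laplacian_homogeneous_0[OF hom A2]) (use x in \<open>auto simp: sgn_zero_iff\<close>)
  also have "laplacian ?A (sgn x) = of_real (sphere_eigenvalue DIM('a) k) * E (sgn x)"
    using E x by (auto simp: is_sphere_eigenfunction_def sphere_laplacian_def norm_sgn)
  finally have "laplacian ?A x = of_real (sphere_eigenvalue DIM('a) k / (norm x)\<^sup>2) * ?A x" by simp
  then show "laplacian (\<lambda>x. cnj (?A x)) x = of_real (sphere_eigenvalue DIM('a) k / (norm x)\<^sup>2) * cnj (?A x)"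
    using laplacian_cnj[OF op _ A2, of x] x by simp
qed

lemma test_on_cylinder:
  fixes E :: "'a::euclidean_space \<Rightarrow> complex"
  assumes E: "smooth_on_sphere E" and v: "smooth_on UNIV v" "compactly_supported v"
  obtains K where "test_on K (cylinder_to_euclidean \<gamma> (\<lambda>s \<omega>. v s * E \<omega>))" "0 \<notin> K"
proof -
  let ?w = "cylinder_to_euclidean \<gamma> (\<lambda>s \<omega>. v s * E \<omega>)"
  have op: "open (UNIV - {0::'a})" by (intro open_delete open_UNIV)
  obtain T where T: "T > 0" "\<And>s. v s \<noteq> 0 \<Longrightarrow> \<bar>s\<bar> \<le> T"
  proof -
    have "bounded (closure {s. v s \<noteq> 0})"
      using v(2) by (intro compact_imp_bounded) (simp add: compactly_supported_def)
    then obtain T where "T > 0" "\<And>s. s \<in> closure {s. v s \<noteq> 0} \<Longrightarrow> \<bar>s\<bar> \<le> T"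
      by (auto simp: bounded_pos)
    with closure_subset[of "{s. v s \<noteq> 0}"] show ?thesis by (intro that[of T]) auto
  qed
  define K where "K = cball (0::'a) (exp T) - ball 0 (exp (- T))"
  have K: "compact K" unfolding K_def by (intro compact_diff) auto
  have K0: "K \<subseteq> UNIV - {0}" by (auto simp: K_def)
  have wK: "?w x = 0" if "x \<notin> K" for x
  proof (cases "x = 0")
    case False
    define q where "q = ln (norm x)"
    have q: "norm x = exp q" using False by (simp add: q_def)
    have "\<not> \<bar>- q\<bar> \<le> T" using that by (auto simp: K_def q not_less)
    then have "v (- q) = 0" using T(2) by blast
    then show ?thesis by (simp add: cylinder_to_euclidean_def q)
  qed (simp add: cylinder_to_euclidean_def)
  have "Ck_on m UNIV ?w" for m
  proof (rule Ck_on_UNIV_vanishing[OF op compact_imp_closed[OF K] K0 _ wK])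
    have "Ck_on m UNIV (\<lambda>q. v (- q))"
      by (rule Ck_on_compose_real[where q'="\<lambda>q h. - h"])
        (use v(1) in \<open>auto simp: smooth_on_def intro!: derivative_eq_intros Ck_on_const\<close>)
    then have "Ck_on m UNIV (\<lambda>q. exp (of_real (- ((real DIM('a) - 2 * \<gamma>) / 2)) * of_real q) * v (- q))"
      by (intro Ck_on_mult Ck_on_exp open_UNIV)
    then have "Ck_on m (UNIV - {0::'a}) (\<lambda>x. exp (of_real (- ((real DIM('a) - 2 * \<gamma>) / 2)) * of_real (ln (norm x))) * v (- ln (norm x)))"
      by (rule Ck_on_ln_norm)
    then have "Ck_on m (UNIV - {0::'a}) (\<lambda>x. exp (of_real (- ((real DIM('a) - 2 * \<gamma>) / 2)) * of_real (ln (norm x))) * v (- ln (norm x)) * E (sgn x))"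
      by (rule Ck_on_mult[OF op]) (use E in \<open>simp add: smooth_on_sphere_def smooth_on_def\<close>)
    then show "Ck_on m (UNIV - {0}) ?w"
      by (rule Ck_on_cong[OF op, rotated]) (simp add: cylinder_to_euclidean_def npow_of_real[symmetric])
  qed
  with K wK have "test_on K ?w" by (auto simp: test_on_def smooth_on_def)
  then show ?thesis by (rule that) (simp add: K_def)
qed

text \<open>The square root is \<open>k + n/2 - 1\<close>.\<close>

lemma Theta_eq:
  assumes n: "2 \<le> n"
  shows "Theta n \<gamma> k \<tau> = 2 powr (2 * \<gamma>) *
    (cmod (Gamma (Complex ((real k + \<gamma> + real n / 2) / 2) (\<tau> / 2))))\<^sup>2 /
    (cmod (Gamma (Complex ((real k - \<gamma> + real n / 2) / 2) (\<tau> / 2))))\<^sup>2"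
proof -
  have "(real n / 2 - 1)\<^sup>2 - sphere_eigenvalue n k = (real k + real n / 2 - 1)\<^sup>2"
    by (simp add: sphere_eigenvalue_def power2_eq_square field_simps)
  moreover have "real k + real n / 2 - 1 \<ge> 0" using n by simp
  ultimately have s: "sqrt ((real n / 2 - 1)\<^sup>2 - sphere_eigenvalue n k) = real k + real n / 2 - 1"
    by simp
  have "1/2 + \<gamma>/2 + (real k + real n / 2 - 1)/2 = (real k + \<gamma> + real n / 2) / 2"
    "1/2 - \<gamma>/2 + (real k + real n / 2 - 1)/2 = (real k - \<gamma> + real n / 2) / 2"
    by (simp_all add: field_simps)
  then show ?thesis by (simp only: Theta_def s Let_def)
qed

lemma Gamma_mult_cnj: "Gamma z * Gamma (cnj z) = of_real ((cmod (Gamma z))\<^sup>2)"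
  by (simp add: cnj_Gamma[symmetric] complex_norm_square[symmetric])

text \<open>Two applications of \<open>hecke_riesz\<close>: first to \<open>f\<close> with the exponent \<open>a\<close>, which leads to the transform of \<open>W\<close> times \<open>\<bar>\<xi>\<bar>\<^sup>b Y\<close>
  with \<open>b = 2\<gamma> - n - a\<close>, then to the transform of \<open>W\<close> with the exponent \<open>b\<close>, which leads to \<open>d = - n - b\<close>. Since
  \<open>b\<close> is the conjugate of \<open>a\<close>, so are the arguments of the Gamma functions.\<close>

lemma mellin_multiplier:
  fixes Y :: "'a::euclidean_space \<Rightarrow> complex" and W :: "'a \<Rightarrow> complex" and \<tau> :: real
  assumes Y: "spherical_harmonic k Y" and \<gamma>: "0 < \<gamma>" "\<gamma> < real DIM('a) / 2"
    and W: "test_on K W" "0 \<notin> K"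
  defines "a \<equiv> Complex (\<gamma> - real DIM('a) / 2) \<tau>" and "d \<equiv> Complex (- real DIM('a) / 2 - \<gamma>) \<tau>"
  shows "integrable lborel (\<lambda>x. fractional_laplacian \<gamma> W x * (npow a x * Y x))"
    "integrable lborel (\<lambda>x. W x * (npow d x * Y x))"
    "(LINT x|lborel. fractional_laplacian \<gamma> W x * (npow a x * Y x))
      = of_real (Theta DIM('a) \<gamma> k \<tau>) * (LINT x|lborel. W x * (npow d x * Y x))"
proof -
  let ?f = "fractional_laplacian \<gamma> W"
  interpret spherical_harmonic k Y by fact
  define n where "n = DIM('a)"
  have n: "real n \<ge> 2" using dim by (simp add: n_def)
  note [measurable] = test_onD(6)[OF W(1)] measurable_fractional_laplacian[OF W(1)]
  define f where "f = ?f"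
  \<comment> \<open>The conjugate of \<open>a\<close>.\<close>
  define b where "b = Complex (\<gamma> - real n / 2) (- \<tau>)"
  define S where "S = complex_of_real (sqrt (2 * pi) ^ n)"
  have S0: "S \<noteq> 0" by (simp add: S_def)
  define G where "G = (\<lambda>\<xi>::'a. of_real (norm \<xi> powr (2 * \<gamma>)) * fourier W \<xi>)"
  obtain B where B: "B > 0" "\<And>x. norm (Y x) \<le> B" using Y_bounded by blast
  have iG: "integrable lborel G" unfolding G_def by (rule integrable_symbol_fourier[OF W(1) \<gamma>(1)])
  have Sf: "exp_transform \<i> G x = S * f x" for x
    using S0 by (simp add: f_def fractional_laplacian_def inverse_fourier_def S_def G_def n_def inner_commute)
  have Sw: "exp_transform (- \<i>) W x = S * fourier W x" for x
    using S0 by (simp add: fourier_def S_def n_def inner_commute)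
  show if': "integrable lborel (\<lambda>x. ?f x * (npow a x * Y x))"
  proof -
    obtain C where C: "\<And>x. norm (?f x) \<le> C"
      "\<And>x. x \<noteq> 0 \<Longrightarrow> norm (?f x) \<le> C * norm x powr (- (real DIM('a) + 2 * \<gamma>))"
      using fractional_laplacian_decay[OF dim \<gamma> W(1)] by blast
    have C0: "C \<ge> 0" using C(1)[of 0] norm_ge_zero order_trans by blast
    show ?thesis
    proof (rule integrable_two_powers[of _ "\<gamma> - n / 2" "\<gamma> - n / 2 - (n + 2 * \<gamma>)" "C * B"])
      fix x :: 'a assume x: "x \<noteq> 0"
      have "norm (?f x * (npow a x * Y x)) \<le> C * (norm x powr (\<gamma> - n / 2) * B)"
        unfolding norm_mult norm_npow[OF x] a_def n_def complex.sel using C0 by (intro mult_mono C(1) B) (auto intro: mult_nonneg_nonneg)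
      then show "norm (?f x * (npow a x * Y x)) \<le> C * B * norm x powr (\<gamma> - n / 2)"
        by (simp add: mult_ac)
      have "norm (?f x * (npow a x * Y x))
        \<le> (C * norm x powr (- (real DIM('a) + 2 * \<gamma>))) * (norm x powr (\<gamma> - n / 2) * B)"
        unfolding norm_mult norm_npow[OF x] a_def n_def complex.sel using C0 B(1) by (intro mult_mono C(2)[OF x] B) auto
      also have "\<dots> = C * B * norm x powr (\<gamma> - n / 2 - (n + 2 * \<gamma>))"
        by (simp add: n_def powr_add[symmetric] algebra_simps)
      finally show "norm (?f x * (npow a x * Y x)) \<le> C * B * norm x powr (\<gamma> - n / 2 - (n + 2 * \<gamma>))" .
    qed (use \<gamma> n in \<open>auto simp: n_def\<close>)
  qed
  have iwb: "integrable lborel (\<lambda>x. fourier W x * (npow b x * Y x))"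
  proof (rule integrable_fourier[OF W(1), of _ "\<gamma> - n / 2" B])
    fix x :: 'a assume x: "x \<noteq> 0"
    have "norm (fourier W x * (npow b x * Y x)) \<le> norm (fourier W x) * (norm x powr (\<gamma> - n / 2) * B)"
      unfolding norm_mult norm_npow[OF x] b_def complex.sel by (intro mult_left_mono B) auto
    then show "norm (fourier W x * (npow b x * Y x)) \<le> B * norm x powr (\<gamma> - n / 2) * norm (fourier W x)"
      by (simp add: mult_ac)
  qed (use \<gamma> n B in \<open>auto simp: n_def\<close>)
  show iwd: "integrable lborel (\<lambda>x. W x * (npow d x * Y x))"
    by (rule integrable_test_off_origin[OF W]) (auto intro!: continuous_intros Ck_on_imp_continuous_on[OF C2])
  have ab: "- (a + of_nat n) = b - 2 * of_real \<gamma>" "- (b + of_nat n) = d"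
    by (simp_all add: a_def b_def d_def n_def complex_eq_iff)
  have Gb: "AE \<xi> in lborel. G \<xi> * (npow (- (a + of_nat DIM('a))) \<xi> * Y \<xi>)
      = fourier W \<xi> * (npow b \<xi> * Y \<xi>)"
    using AE_lborel_nonzero
  proof eventually_elim
    case (elim \<xi>)
    have "of_real (norm \<xi> powr (2 * \<gamma>)) * npow (- (a + of_nat n)) \<xi> = npow b \<xi>"
      unfolding ab(1) npow_of_real[OF elim, symmetric] exp_add[symmetric] by (simp add: algebra_simps)
    then show ?case by (simp add: G_def n_def mult_ac)
  qed
  have mG: "G \<in> borel_measurable borel" unfolding G_def by measurable
  have iGa: "integrable lborel (\<lambda>\<xi>. G \<xi> * (npow (- (a + of_nat DIM('a))) \<xi> * Y \<xi>))"
    by (rule integrable_cong_AE_imp[OF iwb _ AE_symmetric[OF Gb]]) (use mG in measurable)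
  have hr1: "Gamma ((of_nat k - a) / 2) * (LINT x|lborel. exp_transform \<i> G x * (npow a x * Y x))
    = of_real (pi powr (DIM('a) / 2)) * (\<i> / 2) ^ k * exp ((of_nat k + a + of_nat DIM('a)) * of_real (ln 2))
      * Gamma ((of_nat k + a + of_nat DIM('a)) / 2)
      * (LINT \<xi>|lborel. G \<xi> * (npow (- (a + of_nat DIM('a))) \<xi> * Y \<xi>))"
  proof (rule hecke_riesz[OF _ _ iG])
    show "integrable lborel (\<lambda>x. exp_transform \<i> G x * (npow a x * Y x))"
      unfolding Sf f_def mult.assoc using if' by (intro integrable_mult_right)
  qed (use \<gamma> n iGa in \<open>auto simp: a_def n_def\<close>)
  have hr2: "Gamma ((of_nat k - b) / 2) * (LINT x|lborel. exp_transform (- \<i>) W x * (npow b x * Y x))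
    = of_real (pi powr (DIM('a) / 2)) * (- \<i> / 2) ^ k * exp ((of_nat k + b + of_nat DIM('a)) * of_real (ln 2))
      * Gamma ((of_nat k + b + of_nat DIM('a)) / 2)
      * (LINT \<xi>|lborel. W \<xi> * (npow (- (b + of_nat DIM('a))) \<xi> * Y \<xi>))"
  proof (rule hecke_riesz[OF _ _ test_onD(5)[OF W(1)]])
    show "integrable lborel (\<lambda>x. exp_transform (- \<i>) W x * (npow b x * Y x))"
      unfolding Sw mult.assoc using iwb by (intro integrable_mult_right)
    show "integrable lborel (\<lambda>\<xi>. W \<xi> * (npow (- (b + of_nat DIM('a))) \<xi> * Y \<xi>))"
      using iwd ab(2) by (simp add: n_def)
  qed (use \<gamma> n in \<open>auto simp: b_def n_def\<close>)
  define If where "If = (LINT x|lborel. f x * (npow a x * Y x))"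
  define Ib where "Ib = (LINT x|lborel. fourier W x * (npow b x * Y x))"
  define Iw where "Iw = (LINT x|lborel. W x * (npow d x * Y x))"
  define P where "P = complex_of_real (pi powr (n / 2))"
  have G_Ib: "(LINT \<xi>|lborel. G \<xi> * (npow (- (a + of_nat DIM('a))) \<xi> * Y \<xi>)) = Ib"
    unfolding Ib_def by (rule integral_cong_AE[OF _ _ Gb]) (use mG in measurable)
  have h1: "Gamma ((of_nat k - a) / 2) * (S * If) = P * (\<i> / 2) ^ k * exp ((of_nat k + a + of_nat n) * of_real (ln 2)) * Gamma ((of_nat k + a + of_nat n) / 2) * Ib"
    using hr1 unfolding Sf G_Ib by (simp add: mult.assoc If_def P_def n_def)
  have h2: "Gamma ((of_nat k - b) / 2) * (S * Ib) = P * (- \<i> / 2) ^ k * exp ((of_nat k + b + of_nat n) * of_real (ln 2)) * Gamma ((of_nat k + b + of_nat n) / 2) * Iw"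
    using hr2 unfolding Sw ab(2)[unfolded n_def] by (simp add: mult.assoc Ib_def Iw_def P_def n_def)
  define zp where "zp = Complex ((real k + \<gamma> + real n / 2) / 2) (\<tau> / 2)"
  define zm where "zm = Complex ((real k - \<gamma> + real n / 2) / 2) (\<tau> / 2)"
  have g1: "(of_nat k + a + of_nat n) / 2 = zp" "(of_nat k + b + of_nat n) / 2 = cnj zp"
    "(of_nat k - a) / 2 = cnj zm" "(of_nat k - b) / 2 = zm"
    by (simp_all add: a_def b_def zp_def zm_def n_def complex_eq_iff)
  have Gm: "Gamma zm \<noteq> 0" "Gamma (cnj zm) \<noteq> 0"
  proof -
    have "Re zm > 0" using \<gamma> by (simp add: zm_def n_def)
    then have "zm \<notin> \<int>\<^sub>\<le>\<^sub>0" by (auto elim!: nonpos_Ints_cases)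
    then show "Gamma zm \<noteq> 0" by (simp add: Gamma_eq_zero_iff)
    then show "Gamma (cnj zm) \<noteq> 0" by (simp add: cnj_Gamma[symmetric])
  qed
  have const: "P * (\<i> / 2) ^ k * exp ((of_nat k + a + of_nat n) * of_real (ln 2)) * (P * (- \<i> / 2) ^ k * exp ((of_nat k + b + of_nat n) * of_real (ln 2)))
      = S\<^sup>2 * of_real (2 powr (2 * \<gamma>))"
  proof -
    have "exp ((of_nat k + a + of_nat n) * of_real (ln 2)) * exp ((of_nat k + b + of_nat n) * of_real (ln 2)) = exp (complex_of_real ((2 * real k + real n + 2 * \<gamma>) * ln 2))"
      unfolding exp_add[symmetric] by (rule arg_cong[where f=exp]) (simp add: complex_eq_iff a_def b_def n_def algebra_simps)
    also have "\<dots> = of_real (2 powr (2 * real k + real n + 2 * \<gamma>))" by (subst exp_of_real) (simp add: powr_def)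
    also have "2 powr (2 * real k + real n + 2 * \<gamma>) = 4 ^ k * 2 ^ n * 2 powr (2 * \<gamma>)"
    proof -
      have "2 powr (2 * real k) = (4::real) ^ k"
      proof -
        have "2 powr (2 * real k) = (2::real) powr real (2 * k)" by simp
        also have "\<dots> = 2 ^ (2 * k)" by (rule powr_realpow) simp
        finally show ?thesis by (simp only: power_mult) simp
      qed
      then show ?thesis by (simp add: powr_add powr_realpow)
    qed
    finally have e: "exp ((of_nat k + a + of_nat n) * of_real (ln 2)) * exp ((of_nat k + b + of_nat n) * of_real (ln 2)) = complex_of_real (4 ^ k * 2 ^ n * 2 powr (2 * \<gamma>))" .
    have i: "(\<i> / 2) ^ k * (- \<i> / 2) ^ k = complex_of_real (1 / 4 ^ k)"
      unfolding power_mult_distrib[symmetric] by (simp add: power_divide power_one_over)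
    have "pi powr (n / 2) * pi powr (n / 2) = pi ^ n" unfolding powr_add[symmetric] by (simp add: powr_realpow)
    then have p: "P * P = of_real (pi ^ n)" unfolding P_def of_real_mult[symmetric] by (rule arg_cong)
    have "sqrt (2 * pi) ^ n * sqrt (2 * pi) ^ n = (2 * pi) ^ n" unfolding power_mult_distrib[symmetric] by simp
    then have s: "S\<^sup>2 = of_real ((2 * pi) ^ n)" unfolding S_def power2_eq_square of_real_mult[symmetric] by (rule arg_cong)
    have "P * (\<i> / 2) ^ k * exp ((of_nat k + a + of_nat n) * of_real (ln 2)) * (P * (- \<i> / 2) ^ k * exp ((of_nat k + b + of_nat n) * of_real (ln 2)))
      = (P * P) * ((\<i> / 2) ^ k * (- \<i> / 2) ^ k) * (exp ((of_nat k + a + of_nat n) * of_real (ln 2)) * exp ((of_nat k + b + of_nat n) * of_real (ln 2)))"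
      by (simp only: mult_ac)
    also have "\<dots> = S\<^sup>2 * of_real (2 powr (2 * \<gamma>))"
      unfolding e i p s by (simp add: power_mult_distrib)
    finally show ?thesis .
  qed
  have "Gamma (cnj zm) * Gamma zm * (S\<^sup>2 * If) = Gamma zm * S * (Gamma (cnj zm) * (S * If))"
    by (simp add: power2_eq_square)
  also have "\<dots> = P * (\<i> / 2) ^ k * exp ((of_nat k + a + of_nat n) * of_real (ln 2)) * Gamma zp * (Gamma zm * (S * Ib))"
    using h1 unfolding g1 by (simp add: mult_ac)
  also have "\<dots> = (P * (\<i> / 2) ^ k * exp ((of_nat k + a + of_nat n) * of_real (ln 2)) * (P * (- \<i> / 2) ^ k * exp ((of_nat k + b + of_nat n) * of_real (ln 2)))) * (Gamma zp * Gamma (cnj zp)) * Iw"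
    using h2 unfolding g1 by (simp add: mult_ac)
  also have "\<dots> = S\<^sup>2 * (of_real (2 powr (2 * \<gamma>)) * (Gamma zp * Gamma (cnj zp)) * Iw)"
    unfolding const by (simp only: mult_ac)
  finally have "S\<^sup>2 * (Gamma zm * Gamma (cnj zm) * If) = S\<^sup>2 * (of_real (2 powr (2 * \<gamma>)) * (Gamma zp * Gamma (cnj zp)) * Iw)"
    by (simp only: mult_ac)
  then have "Gamma zm * Gamma (cnj zm) * If = of_real (2 powr (2 * \<gamma>)) * (Gamma zp * Gamma (cnj zp)) * Iw"
    using S0 by simp
  then have e: "of_real ((cmod (Gamma zm))\<^sup>2) * If = of_real (2 powr (2 * \<gamma>) * (cmod (Gamma zp))\<^sup>2) * Iw"
    unfolding Gamma_mult_cnj by simp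
  have cancel: "z = of_real (r / q) * w" if "of_real q * z = of_real r * w" "q \<noteq> 0" for q r :: real and z w :: complex
    using that by (simp add: field_simps)
  have "Theta DIM('a) \<gamma> k \<tau> = 2 powr (2 * \<gamma>) * (cmod (Gamma zp))\<^sup>2 / (cmod (Gamma zm))\<^sup>2"
    unfolding zp_def zm_def n_def by (rule Theta_eq[OF dim])
  then have "If = of_real (Theta DIM('a) \<gamma> k \<tau>) * Iw"
    using cancel[OF e] Gm(1) by simp
  then show "(LINT x|lborel. ?f x * (npow a x * Y x))
      = of_real (Theta DIM('a) \<gamma> k \<tau>) * (LINT x|lborel. W x * (npow d x * Y x))"
    unfolding If_def Iw_def f_def .
qed

text \<open>It remains to write the Fourier integrals of the projection and of \<open>v\<close> in polar coordinates. The exponents \<open>a\<close> and \<open>d\<close> are such that the radial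
  weights combine to \<open>exp (- \<i> \<xi> t)\<close>.\<close>

theorem theorem1p1:
  fixes \<gamma> \<xi> :: real and n k :: nat
    and E :: "'a::euclidean_space \<Rightarrow> complex" and v :: "real \<Rightarrow> complex"
  assumes "n = DIM('a)" and "n \<ge> 2"
    and "0 < \<gamma>" and "\<gamma> < real n / 2"
    and "is_sphere_eigenfunction (sphere_eigenvalue n k) E"
    and "(LINT \<theta>|sphere_measure. (cmod (E \<theta>))\<^sup>2) = 1"
    and "smooth_on UNIV v" and "compactly_supported v"
  shows "fourier (P_proj \<gamma> E v) \<xi> = of_real (Theta n \<gamma> k \<xi>) * fourier v \<xi>"
proof -
  let ?w = "cylinder_to_euclidean \<gamma> (\<lambda>s \<omega>. v s * E \<omega>)"
  let ?f = "fractional_laplacian \<gamma> ?w"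
  define Y where "Y = (\<lambda>x. cnj (E (sgn x)))"
  define a where "a = Complex (\<gamma> - real n / 2) \<xi>"
  define d where "d = Complex (- real n / 2 - \<gamma>) \<xi>"
  have Y: "spherical_harmonic k Y"
    unfolding Y_def using assms by (intro spherical_harmonic_cnj_eigenfunction) auto
  have "smooth_on_sphere E" using assms(5) by (simp add: is_sphere_eigenfunction_def)
  from test_on_cylinder[OF this assms(7,8), of \<gamma>] obtain K where K: "test_on K ?w" "0 \<notin> K" .
  have \<gamma>: "\<gamma> < real DIM('a) / 2" using assms by simp
  note mellin = mellin_multiplier[OF Y assms(3) \<gamma> K, of \<xi>, folded assms(1), folded a_def d_def]
  have Ysph: "Y (exp (- t) *\<^sub>R \<theta>) = cnj (E \<theta>)" if "norm \<theta> = 1" for t \<theta>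
    using that by (simp add: Y_def sgn_scaleR) (simp add: sgn_div_norm)
  have "(LINT t|lborel. exp (- \<i> * of_real (\<xi> * t)) * P_proj \<gamma> E v t)
      = (LINT x|lborel. ?f x * (npow a x * Y x))"
    unfolding polar_integral(2)[OF mellin(1)]
  proof (rule Bochner_Integration.integral_cong[OF refl])
    fix t :: real
    have e: "exp (- real DIM('a) * t) *\<^sub>R exp (a * of_real (- t)) = exp (- \<i> * of_real (\<xi> * t)) * complex_of_real (exp (- t) powr ((real DIM('a) + 2 * \<gamma>) / 2))"
    proof -
      have "exp (- real DIM('a) * t) *\<^sub>R exp (a * of_real (- t)) = exp (complex_of_real (- real DIM('a) * t) + a * of_real (- t))"
        by (simp only: exp_add exp_of_real scaleR_conv_of_real)
      also have "complex_of_real (- real DIM('a) * t) + a * of_real (- t) = - \<i> * of_real (\<xi> * t) + of_real ((real DIM('a) + 2 * \<gamma>) / 2 * (- t))"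
        by (simp add: a_def assms(1) complex_eq_iff field_simps)
      also have "exp \<dots> = exp (- \<i> * of_real (\<xi> * t)) * complex_of_real (exp (- t) powr ((real DIM('a) + 2 * \<gamma>) / 2))"
        unfolding exp_add exp_of_real by (simp add: powr_def)
      finally show ?thesis .
    qed
    have "exp (- real DIM('a) * t) *\<^sub>R (LINT \<theta>|sphere_measure. ?f (exp (- t) *\<^sub>R \<theta>) * (npow a (exp (- t) *\<^sub>R \<theta>) * Y (exp (- t) *\<^sub>R \<theta>)))
      = exp (- real DIM('a) * t) *\<^sub>R (LINT \<theta>|sphere_measure. exp (a * of_real (- t)) * (?f (exp (- t) *\<^sub>R \<theta>) * cnj (E \<theta>)))"
      by (intro arg_cong[where f="\<lambda>z. exp (- real DIM('a) * t) *\<^sub>R z"] Bochner_Integration.integral_cong[OF refl]) (simp add: Ysph)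
    also have "\<dots> = (exp (- real DIM('a) * t) *\<^sub>R exp (a * of_real (- t))) * (LINT \<theta>|sphere_measure. ?f (exp (- t) *\<^sub>R \<theta>) * cnj (E \<theta>))"
      by (simp add: mult_scaleR_left)
    also have "\<dots> = exp (- \<i> * of_real (\<xi> * t)) * P_proj \<gamma> E v t"
      unfolding e by (simp add: P_proj_def P_cyl_def Let_def mult.assoc)
    finally show "exp (- \<i> * of_real (\<xi> * t)) * P_proj \<gamma> E v t = exp (- real DIM('a) * t) *\<^sub>R (LINT \<theta>|sphere_measure. ?f (exp (- t) *\<^sub>R \<theta>) * (npow a (exp (- t) *\<^sub>R \<theta>) * Y (exp (- t) *\<^sub>R \<theta>)))"
      by (rule sym)
  qed
  also have "\<dots> = of_real (Theta n \<gamma> k \<xi>) * (LINT x|lborel. ?w x * (npow d x * Y x))"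
    by (rule mellin(3))
  also have "(LINT x|lborel. ?w x * (npow d x * Y x))
      = (LINT t|lborel. exp (- real DIM('a) * t) *\<^sub>R (of_real (exp (- t) powr (- ((real DIM('a) - 2 * \<gamma>) / 2))) * v t * exp (d * of_real (- t)))) * (LINT \<theta>|(sphere_measure :: 'a measure). of_real ((cmod (E \<theta>))\<^sup>2))"
  proof (rule polar_separated[OF mellin(2)])
    fix t :: real and \<theta> :: 'a assume th: "norm \<theta> = 1"
    have "E (sgn (exp (- t) *\<^sub>R \<theta>)) = E \<theta>" using Ysph[OF th, of t] by (simp add: Y_def)
    then show "?w (exp (- t) *\<^sub>R \<theta>) * (npow d (exp (- t) *\<^sub>R \<theta>) * Y (exp (- t) *\<^sub>R \<theta>))
      = of_real (exp (- t) powr (- ((real DIM('a) - 2 * \<gamma>) / 2))) * v t * exp (d * of_real (- t)) * of_real ((cmod (E \<theta>))\<^sup>2)"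
      unfolding cylinder_to_euclidean_def Ysph[OF th] by (simp add: th complex_norm_square[symmetric])
  qed
  also have "(LINT \<theta>|(sphere_measure :: 'a measure). complex_of_real ((cmod (E \<theta>))\<^sup>2)) = 1"
    using assms(6) by (simp del: of_real_power)
  also have "(LINT t|lborel. exp (- real DIM('a) * t) *\<^sub>R (of_real (exp (- t) powr (- ((real DIM('a) - 2 * \<gamma>) / 2))) * v t * exp (d * of_real (- t))))
      = (LINT t|lborel. exp (- \<i> * of_real (\<xi> * t)) * v t)"
  proof (rule Bochner_Integration.integral_cong[OF refl])
    fix t :: real
    have "exp (- real DIM('a) * t) *\<^sub>R (of_real (exp (- t) powr (- ((real DIM('a) - 2 * \<gamma>) / 2))) * v t * exp (d * of_real (- t)))
      = exp (complex_of_real (- real DIM('a) * t) + (of_real (- ((real DIM('a) - 2 * \<gamma>) / 2) * (- t)) + d * of_real (- t))) * v t"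
      unfolding exp_add exp_of_real scaleR_conv_of_real by (simp add: powr_def)
    also have "complex_of_real (- real DIM('a) * t) + (of_real (- ((real DIM('a) - 2 * \<gamma>) / 2) * (- t)) + d * of_real (- t)) = - \<i> * of_real (\<xi> * t)"
      by (simp add: d_def assms(1) complex_eq_iff field_simps)
    finally show "exp (- real DIM('a) * t) *\<^sub>R (of_real (exp (- t) powr (- ((real DIM('a) - 2 * \<gamma>) / 2))) * v t * exp (d * of_real (- t))) = exp (- \<i> * of_real (\<xi> * t)) * v t" .
  qed
  finally show ?thesis by (simp add: fourier_real)
qed

end
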